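(* Let $G,N$ be Banach--Lie groups and let $\pi: G\to \mathrm{Aut}(N)$ be a homomorphism defining a continuous action of $G$ on $N$. If $N$ is abelian, then every continuous one-parameter subgroup $\gamma: \mathbb R\to H=N\rtimes_{\pi}G$ is conjugate (in $H$) to a smooth one-parameter subgroup of $H$, hence is of the form $\gamma(t) = g\exp_H(tx) g^{-1}$ $(t\in\mathbb R)$ for some $g \in H$, $x\in \mathfrak h$.
   Context: $\mathrm{Aut}(N)$ is the group of Lie group automorphisms of $N$; "$\pi$ defines a continuous action" means that $G\times N\to N$, $(g,n)\mapsto \pi(g)n$, is continuous. $H=N\rtimes_\pi G$ is the product Banach manifold $N\times G$ with multiplication $(n_1,g_1)(n_2,g_2)=(n_1\cdot\pi(g_1)n_2,\,g_1g_2)$; it is a topological group whose left multiplications $\lambda_h: x\mapsto hx$ are smooth (right multiplications are in general only continuous). Put $\mathfrak h:=T_1H=\mathfrak n\times\mathfrak g$ and, for $h\in H$, $x\in\mathfrak h$, $h.x:=T_1(\lambda_h)x\in T_hH$. The exponential function $\exp_H:\mathfrak h\to H$ is $\exp_H(x):=\eta(1)$, where $\eta:[0,1]\to H$ is the unique (existing) $C^1$ solution of $\eta'(t)=\eta(t).x$, $\eta(0)=1_H$. A continuous (smooth) one-parameter subgroup is a group homomorphism $\mathbb R\to H$ that is continuous (smooth as a map of manifolds). *)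

theory Defs
  imports "HOL-Analysis.Analysis" "HOL-Algebra.Bij"
begin

section \<open>Smooth maps between open subsets of normed spaces\<close>

text \<open>A \<open>k\<close>-linear map is a function on argument lists of length \<open>k\<close>; its values on lists of any
  other length are irrelevant.  Thus all the spaces of bounded \<open>k\<close>-linear maps live in one type.\<close>

definition bounded_multilinear ::
  "nat \<Rightarrow> ('a::real_normed_vector list \<Rightarrow> 'b::real_normed_vector) \<Rightarrow> bool" where
  "bounded_multilinear k T \<longleftrightarrow>
     (\<forall>vs i. length vs = k \<and> i < k \<longrightarrow> linear (\<lambda>v. T (vs[i := v]))) \<and>
     (\<exists>C. \<forall>vs. length vs = k \<longrightarrow> norm (T vs) \<le> C * prod_list (map norm vs))"

text \<open>\<open>D k\<close> is the \<open>k\<close>-th Frechet derivative: under the isometry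
  \<open>L(E, L\<^sup>k(E; F)) = L\<^sup>k\<^sup>+\<^sup>1(E; F)\<close>, the inequality below says that \<open>D (Suc k) x\<close> is the Frechet
  derivative of \<open>D k\<close> at \<open>x\<close> with respect to the operator norm on \<open>L\<^sup>k(E; F)\<close>.\<close>

definition smooth_on ::
  "'a::real_normed_vector set \<Rightarrow> ('a \<Rightarrow> 'b::real_normed_vector) \<Rightarrow> bool" where
  "smooth_on U f \<longleftrightarrow> open U \<and>
     (\<exists>D :: nat \<Rightarrow> 'a \<Rightarrow> 'a list \<Rightarrow> 'b.
        (\<forall>x\<in>U. D 0 x [] = f x) \<and>
        (\<forall>k. \<forall>x\<in>U. bounded_multilinear k (D k x)) \<and>
        (\<forall>k. \<forall>x\<in>U. \<forall>e>0. \<exists>d>0. \<forall>y\<in>U. norm (y - x) < d \<longrightarrow>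
           (\<forall>vs. length vs = k \<longrightarrow>
              norm (D k y vs - D k x vs - D (Suc k) x ((y - x) # vs))
                \<le> e * norm (y - x) * prod_list (map norm vs))))"


section \<open>Banach manifolds\<close>

text \<open>A chart is a pair of its domain and its coordinate map; the latter is a total function, whose
  values off the domain are irrelevant.\<close>

type_synonym ('m, 'e) chart = "'m set \<times> ('m \<Rightarrow> 'e)"

abbreviation chart_inv :: "('m, 'e) chart \<Rightarrow> 'e \<Rightarrow> 'm" where
  "chart_inv c \<equiv> inv_into (fst c) (snd c)"

record ('m, 'e) manifold =
  mtop :: "'m topology"
  charts :: "('m, 'e) chart set"

text \<open>The atlas need not be maximal, and all charts take values in one Banach space \<open>'e\<close>.  For Lie
  groups the latter is no restriction, since translations identify the model spaces of all charts.\<close>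

definition banach_manifold :: "('m, 'e::banach) manifold \<Rightarrow> bool" where
  "banach_manifold M \<longleftrightarrow>
     Hausdorff_space (mtop M) \<and>
     (\<Union>c\<in>charts M. fst c) = topspace (mtop M) \<and>
     (\<forall>c\<in>charts M. openin (mtop M) (fst c) \<and> open (snd c ` fst c) \<and>
        homeomorphic_map (subtopology (mtop M) (fst c)) (top_of_set (snd c ` fst c)) (snd c)) \<and>
     (\<forall>c\<in>charts M. \<forall>d\<in>charts M.
        smooth_on (snd c ` (fst c \<inter> fst d)) (snd d \<circ> chart_inv c))"

definition smooth_map ::
  "('m, 'e::banach) manifold \<Rightarrow> ('n, 'f::banach) manifold \<Rightarrow> ('m \<Rightarrow> 'n) \<Rightarrow> bool" where
  "smooth_map M M' f \<longleftrightarrow>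
     continuous_map (mtop M) (mtop M') f \<and>
     (\<forall>c\<in>charts M. \<forall>d\<in>charts M'.
        smooth_on (snd c ` (fst c \<inter> f -` fst d)) (snd d \<circ> f \<circ> chart_inv c))"

definition prod_manifold ::
  "('m, 'e) manifold \<Rightarrow> ('n, 'f) manifold \<Rightarrow> ('m \<times> 'n, 'e \<times> 'f) manifold" where
  "prod_manifold M M' =
     \<lparr>mtop = prod_topology (mtop M) (mtop M'),
      charts = {(fst c \<times> fst d, map_prod (snd c) (snd d)) |c d. c \<in> charts M \<and> d \<in> charts M'}\<rparr>"

definition real_manifold :: "(real, real) manifold" where
  "real_manifold = \<lparr>mtop = euclideanreal, charts = {(UNIV, \<lambda>t. t)}\<rparr>"


section \<open>Tangent vectors\<close>

definition charts_at :: "('m, 'e) manifold \<Rightarrow> 'm \<Rightarrow> ('m, 'e) chart set" where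
  "charts_at M p = {c \<in> charts M. p \<in> fst c}"

text \<open>A tangent vector at \<open>p\<close> is the compatible family of its coordinate representations in all
  charts around \<open>p\<close>, extended by \<open>0\<close> to the other pairs.  The vector space operations are
  therefore the pointwise ones.\<close>

definition tangent_space ::
  "('m, 'e::banach) manifold \<Rightarrow> 'm \<Rightarrow> (('m, 'e) chart \<Rightarrow> 'e) set" where
  "tangent_space M p =
     {v. (\<forall>c\<in>charts_at M p. \<forall>d\<in>charts_at M p.
            v d = frechet_derivative (snd d \<circ> chart_inv c) (at (snd c p)) (v c)) \<and>
         (\<forall>c. c \<notin> charts_at M p \<longrightarrow> v c = 0)}"

text \<open>By the chain rule the choice of the chart \<open>c\<close> around \<open>p\<close> does not matter for smooth \<open>f\<close>.\<close>

definition tangent_map ::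
  "('m, 'e::banach) manifold \<Rightarrow> ('n, 'f::banach) manifold \<Rightarrow> ('m \<Rightarrow> 'n) \<Rightarrow> 'm \<Rightarrow>
   (('m, 'e) chart \<Rightarrow> 'e) \<Rightarrow> (('n, 'f) chart \<Rightarrow> 'f)" where
  "tangent_map M M' f p v = (\<lambda>d.
     if d \<in> charts_at M' (f p)
     then let c = (SOME c. c \<in> charts_at M p)
          in frechet_derivative (snd d \<circ> f \<circ> chart_inv c) (at (snd c p)) (v c)
     else 0)"

text \<open>\<open>\<eta>\<close> is a \<open>C\<^sup>1\<close> curve on \<open>[0,1]\<close> (with one-sided derivatives at the end points) and \<open>\<eta>'\<close>
  is its velocity.\<close>

definition C1_curve_velocity ::
  "('m, 'e::banach) manifold \<Rightarrow> (real \<Rightarrow> 'm) \<Rightarrow> (real \<Rightarrow> ('m, 'e) chart \<Rightarrow> 'e) \<Rightarrow> bool" where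
  "C1_curve_velocity M \<eta> \<eta>' \<longleftrightarrow>
     continuous_map (top_of_set {0..1}) (mtop M) \<eta> \<and>
     (\<forall>t\<in>{0..1}. \<eta>' t \<in> tangent_space M (\<eta> t)) \<and>
     (\<forall>c\<in>charts M.
        (\<forall>t\<in>{0..1}. \<eta> t \<in> fst c \<longrightarrow>
           ((snd c \<circ> \<eta>) has_vector_derivative \<eta>' t c) (at t within {0..1})) \<and>
        continuous_on {t\<in>{0..1}. \<eta> t \<in> fst c} (\<lambda>t. \<eta>' t c))"


section \<open>Banach--Lie groups and semidirect products\<close>

definition banach_lie_group ::
  "('g, 'x) monoid_scheme \<Rightarrow> ('g, 'e::banach) manifold \<Rightarrow> bool" where
  "banach_lie_group G M \<longleftrightarrow>
     group G \<and> banach_manifold M \<and> topspace (mtop M) = carrier G \<and>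
     smooth_map (prod_manifold M M) M (\<lambda>(x, y). x \<otimes>\<^bsub>G\<^esub> y) \<and>
     smooth_map M M (\<lambda>x. inv\<^bsub>G\<^esub> x)"

definition lie_aut_group ::
  "('g, 'x) monoid_scheme \<Rightarrow> ('g, 'e::banach) manifold \<Rightarrow> ('g \<Rightarrow> 'g) monoid" where
  "lie_aut_group N M = AutoGroup N
     \<lparr>carrier := {f \<in> auto N. smooth_map M M f \<and> smooth_map M M (inv_into (carrier N) f)}\<rparr>"

definition semidirect_product ::
  "('n, 'x) monoid_scheme \<Rightarrow> ('g, 'y) monoid_scheme \<Rightarrow> ('g \<Rightarrow> 'n \<Rightarrow> 'n) \<Rightarrow> ('n \<times> 'g) monoid" where
  "semidirect_product N G \<pi> =
     \<lparr>carrier = carrier N \<times> carrier G,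
      monoid.mult = (\<lambda>(n1, g1) (n2, g2). (n1 \<otimes>\<^bsub>N\<^esub> \<pi> g1 n2, g1 \<otimes>\<^bsub>G\<^esub> g2)),
      one = (\<one>\<^bsub>N\<^esub>, \<one>\<^bsub>G\<^esub>)\<rparr>"


section \<open>Exponential function and one-parameter subgroups\<close>

text \<open>These notions are meant for groups on Banach manifolds with smooth left multiplications.  Right
  multiplications need not be smooth.\<close>

definition left_translate ::
  "('h, 'x) monoid_scheme \<Rightarrow> ('h, 'e::banach) manifold \<Rightarrow> 'h \<Rightarrow>
   (('h, 'e) chart \<Rightarrow> 'e) \<Rightarrow> (('h, 'e) chart \<Rightarrow> 'e)" where
  "left_translate H M h x = tangent_map M M (\<lambda>y. h \<otimes>\<^bsub>H\<^esub> y) \<one>\<^bsub>H\<^esub> x"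

text \<open>The value at \<open>1\<close> of the unique \<open>C\<^sup>1\<close> solution of \<open>\<eta>' = \<eta>.x\<close> on \<open>[0,1]\<close> with \<open>\<eta>(0) = 1\<close>.\<close>

definition lie_exp ::
  "('h, 'x) monoid_scheme \<Rightarrow> ('h, 'e::banach) manifold \<Rightarrow> (('h, 'e) chart \<Rightarrow> 'e) \<Rightarrow> 'h" where
  "lie_exp H M x =
     (THE y. \<exists>\<eta>. C1_curve_velocity M \<eta> (\<lambda>t. left_translate H M (\<eta> t) x) \<and>
                 \<eta> 0 = \<one>\<^bsub>H\<^esub> \<and> \<eta> 1 = y)"

definition real_group :: "real monoid" where
  "real_group = \<lparr>carrier = UNIV, monoid.mult = (+), one = 0\<rparr>"

definition continuous_one_parameter_subgroup ::
  "('h, 'x) monoid_scheme \<Rightarrow> ('h, 'e) manifold \<Rightarrow> (real \<Rightarrow> 'h) \<Rightarrow> bool" where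
  "continuous_one_parameter_subgroup H M \<gamma> \<longleftrightarrow>
     \<gamma> \<in> hom real_group H \<and> continuous_map euclideanreal (mtop M) \<gamma>"

definition smooth_one_parameter_subgroup ::
  "('h, 'x) monoid_scheme \<Rightarrow> ('h, 'e::banach) manifold \<Rightarrow> (real \<Rightarrow> 'h) \<Rightarrow> bool" where
  "smooth_one_parameter_subgroup H M \<gamma> \<longleftrightarrow>
     \<gamma> \<in> hom real_group H \<and> smooth_map real_manifold M \<gamma>"

end

theory Submission
  imports Defs
begin

text \<open>
  Write \<open>\<gamma>(t) = (\<beta>(t), \<alpha>(t))\<close>.  The component \<open>\<alpha>\<close> is a continuous one-parameter subgroup of \<open>G\<close>; in a
  chart, \<open>\<integral>\<^sub>0\<^sup>h \<alpha>(t + s) ds\<close> is differentiable in \<open>t\<close> and, by \<open>\<alpha>(t + s) = \<alpha>(t) \<alpha>(s)\<close>, nearly \<open>h \<alpha>(t)\<close>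
  plus a constant, so that \<open>\<alpha>\<close> is differentiable at \<open>0\<close>; then \<open>\<alpha>' = \<alpha>.w\<close> makes it smooth by
  bootstrapping.  The component \<open>\<beta>\<close> is a continuous cocycle with values in the abelian group \<open>N\<close>.
  In logarithmic coordinates, \<open>B(s + t) = B(s) + T(s) B(t)\<close> with \<open>T(s)\<close> linear.  For a bump function
  \<open>\<phi>\<close> with integral \<open>1\<close> and \<open>v = \<integral>\<phi>(s) B(s) ds\<close> the cocycle \<open>B(t) + T(t) v - v\<close> equals
  \<open>\<integral>\<phi>(s) B(t + s) ds - v\<close> and is smooth, and adding the coboundary of \<open>v\<close> is conjugation by
  \<open>(exp(-v), 1)\<close>.

  Right multiplications in \<open>H\<close> are not smooth, so the uniqueness of solutions of \<open>\<eta>' = \<eta>.x\<close> in \<open>H\<close> is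
  proved first for the component in \<open>G\<close>, then for the one in \<open>N\<close>: two curves in a Lie group with
  the same left logarithmic derivative have a locally constant quotient \<open>c\<^sub>1 c\<^sub>2\<^sup>-\<^sup>1\<close>.
\<close>

section \<open>Smooth maps and smooth curves\<close>

text \<open>The action is only continuous, so s \<mapsto> T(s) need not be differentiable, nor even
  norm continuous, and no differential equation for the cocycle is available. After the coboundary
  of v is added, T occurs only in T(t) v - v, and the cocycle law converts this into an integral in
  which t occurs solely in the bump function. For this the cocycle law has to be additive and T(t)
  has to be pulled through an integral: hence logarithmic coordinates and an abelian N. The
  exponential map is built by repeated squaring and controlled by Lipschitz estimates alone. They
  yield a derivative at 0 and a continuous inverse, but no smoothness; that exp(b(t)) is smooth for
  a smooth curve b comes from additivity, by the same bootstrap that serves for \<alpha>. The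
  tangent map and the exponential function are defined by choice operators, so the argument is
  carried out in precisely the chart around the unit that the choice operator selects.\<close>

definition higher_derivs ::
  "'a::real_normed_vector set \<Rightarrow> (nat \<Rightarrow> 'a \<Rightarrow> 'a list \<Rightarrow> 'b::real_normed_vector) \<Rightarrow> bool" where
  "higher_derivs U D \<longleftrightarrow> open U \<and>
     (\<forall>k. \<forall>x\<in>U. bounded_multilinear k (D k x)) \<and>
     (\<forall>k. \<forall>x\<in>U. \<forall>e>0. \<exists>d>0. \<forall>y\<in>U. norm (y - x) < d \<longrightarrow>
        (\<forall>vs. length vs = k \<longrightarrow>
           norm (D k y vs - D k x vs - D (Suc k) x ((y - x) # vs))
             \<le> e * norm (y - x) * prod_list (map norm vs)))"

lemma smooth_on_iff_higher_derivs:
  "smooth_on U f \<longleftrightarrow> open U \<and> (\<exists>D. higher_derivs U D \<and> (\<forall>x\<in>U. D 0 x [] = f x))"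
  unfolding smooth_on_def higher_derivs_def by (auto 4 3)

lemma smooth_on_open: "smooth_on U f \<Longrightarrow> open U"
  by (simp add: smooth_on_iff_higher_derivs)

lemma smooth_on_cong:
  assumes "smooth_on U f" "\<And>x. x \<in> U \<Longrightarrow> f x = g x" "U = V"
  shows "smooth_on V g"
  using assms unfolding smooth_on_iff_higher_derivs by auto

lemma higher_derivsE:
  assumes "higher_derivs U D" "x \<in> U" "e > 0"
  obtains d where "d > 0" "\<And>y vs. y \<in> U \<Longrightarrow> norm (y - x) < d \<Longrightarrow> length vs = k \<Longrightarrow>
      norm (D k y vs - D k x vs - D (Suc k) x ((y - x) # vs)) \<le> e * norm (y - x) * prod_list (map norm vs)"
proof -
  note assms(1)[unfolded higher_derivs_def, THEN conjunct2, THEN conjunct2, rule_format, OF assms(2,3), of k]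
  then show thesis by (elim exE conjE) (rule that, auto)
qed

section \<open>Multilinear maps with moving arguments\<close>

lemma bounded_multilinear_Cons:
  assumes "bounded_multilinear (Suc n) T"
  shows "bounded_multilinear n (\<lambda>ws. T (v # ws))"
  unfolding bounded_multilinear_def
proof (intro conjI allI impI)
  fix vs :: "'a list" and i assume "length vs = n \<and> i < n"
  moreover have "linear (\<lambda>u. T ((v # vs)[Suc i := u]))" if "length vs = n \<and> i < n"
    using assms that unfolding bounded_multilinear_def
    by (metis Suc_less_eq length_Cons)
  ultimately show "linear (\<lambda>u. T (v # vs[i := u]))" by simp
next
  from assms obtain C where C: "\<And>vs. length vs = Suc n \<Longrightarrow> norm (T vs) \<le> C * prod_list (map norm vs)"
    unfolding bounded_multilinear_def by blast
  then have "norm (T (v # vs)) \<le> (C * norm v) * prod_list (map norm vs)" if "length vs = n" for vs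
    using C[of "v # vs"] that by (simp add: mult.assoc)
  then show "\<exists>C. \<forall>vs. length vs = n \<longrightarrow> norm (T (v # vs)) \<le> C * prod_list (map norm vs)"
    by blast
qed

lemma prod_list_map_norm_nonneg: "0 \<le> prod_list (map norm vs)"
  by (induction vs) auto

lemma bounded_multilinear_bound:
  assumes "bounded_multilinear n T"
  obtains C where "C \<ge> 0" "\<And>vs. length vs = n \<Longrightarrow> norm (T vs) \<le> C * prod_list (map norm vs)"
proof -
  from assms obtain C where C: "\<And>vs. length vs = n \<Longrightarrow> norm (T vs) \<le> C * prod_list (map norm vs)"
    unfolding bounded_multilinear_def by blast
  have "norm (T vs) \<le> \<bar>C\<bar> * prod_list (map norm vs)" if "length vs = n" for vs
    by (rule order_trans[OF C[OF that]]) (simp add: mult_right_mono prod_list_map_norm_nonneg)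
  then show ?thesis using that[of "\<bar>C\<bar>"] by simp
qed

lemma bounded_multilinear_linear_Cons:
  assumes "bounded_multilinear (Suc n) T" "length ws = n"
  shows "bounded_linear (\<lambda>v. T (v # ws))"
proof -
  have "linear (\<lambda>u. T ((0 # ws)[0 := u]))"
    using assms unfolding bounded_multilinear_def by (metis length_Cons zero_less_Suc)
  then have l: "linear (\<lambda>u. T (u # ws))" by simp
  obtain C where C: "C \<ge> 0" "\<And>vs. length vs = Suc n \<Longrightarrow> norm (T vs) \<le> C * prod_list (map norm vs)"
    using bounded_multilinear_bound[OF assms(1)] by blast
  have "norm (T (v # ws)) \<le> norm v * (C * prod_list (map norm ws))" for v
    using C(2)[of "v # ws"] assms(2) by (simp add: mult_ac)
  then show ?thesis
    by (intro bounded_linear_intro) (auto simp: linear_add[OF l] linear_scale[OF l])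
qed

lemma bounded_multilinear_Cons_simps:
  assumes "bounded_multilinear (Suc n) T" "length ws = n"
  shows "T (0 # ws) = 0" "T ((a - b) # ws) = T (a # ws) - T (b # ws)"
    "T ((c *\<^sub>R a) # ws) = c *\<^sub>R T (a # ws)"
  using linear_0 linear_diff linear_scale bounded_linear.linear[OF bounded_multilinear_linear_Cons[OF assms]]
  by blast+

lemma prod_list_norm_tendsto:
  assumes "list_all2 (\<lambda>v l. (v \<longlongrightarrow> l) F) vs ls"
  shows "((\<lambda>s. prod_list (map (\<lambda>v. norm (v s)) vs)) \<longlongrightarrow> prod_list (map norm ls)) F"
  using assms by (induction rule: list_all2_induct) (auto intro!: tendsto_mult tendsto_norm)

text \<open>One argument at a time: T(v(s), ...) = T(v(s) - l, ...) + T(l, ...). The operator bound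
  makes the first term vanish in the limit; the second is the induction hypothesis for T with its
  first slot frozen.\<close>

lemma bounded_multilinear_tendsto:
  assumes "bounded_multilinear n T" "list_all2 (\<lambda>v l. (v \<longlongrightarrow> l) F) vs ls" "length vs = n"
  shows "((\<lambda>s. T (map (\<lambda>v. v s) vs)) \<longlongrightarrow> T ls) F"
  using assms(2,1,3)
proof (induction arbitrary: T n rule: list_all2_induct)
  case Nil
  then show ?case by simp
next
  case (Cons v vs l ls)
  obtain k where n: "n = Suc k" and k: "length vs = k" using Cons.prems by auto
  note T = Cons.prems(1)[unfolded n]
  obtain C where C: "C \<ge> 0" "\<And>vs. length vs = n \<Longrightarrow> norm (T vs) \<le> C * prod_list (map norm vs)"
    using bounded_multilinear_bound[OF Cons.prems(1)] by blast
  have ih: "((\<lambda>s. T (l # map (\<lambda>v. v s) vs)) \<longlongrightarrow> T (l # ls)) F"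
    using Cons.IH[OF bounded_multilinear_Cons[OF T] k] .
  have prod: "((\<lambda>s. prod_list (map (\<lambda>v. norm (v s)) vs)) \<longlongrightarrow> prod_list (map norm ls)) F"
    by (rule prod_list_norm_tendsto[OF Cons.hyps(2)])
  have "((\<lambda>s. C * (norm (v s - l) * prod_list (map (\<lambda>v. norm (v s)) vs))) \<longlongrightarrow>
          C * (norm (l - l) * prod_list (map norm ls))) F"
    by (intro tendsto_intros prod Cons.hyps)
  then have "((\<lambda>s. C * (norm (v s - l) * prod_list (map (\<lambda>v. norm (v s)) vs))) \<longlongrightarrow> 0) F"
    by simp
  then have "((\<lambda>s. T ((v s - l) # map (\<lambda>v. v s) vs)) \<longlongrightarrow> 0) F"
    apply (rule Lim_null_comparison[rotated])
    using C(2)[of "(v _ - l) # map (\<lambda>v. v _) vs"] k n by (auto simp: o_def)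
  from tendsto_add[OF this ih]
  have "((\<lambda>s. T ((v s - l) # map (\<lambda>v. v s) vs) + T (l # map (\<lambda>v. v s) vs)) \<longlongrightarrow> T (l # ls)) F"
    by simp
  moreover have "T ((v s - l) # map (\<lambda>v. v s) vs) + T (l # map (\<lambda>v. v s) vs)
      = T (map (\<lambda>v. v s) (v # vs))" for s
    using k by (simp add: bounded_multilinear_Cons_simps[OF T])
  ultimately show ?case by simp
qed

lemma has_vector_derivative_iff_quotient:
  "(f has_vector_derivative f') (at t) \<longleftrightarrow> ((\<lambda>s. (f s - f t) /\<^sub>R (s - t)) \<longlongrightarrow> f') (at t)"
proof -
  have "(f has_vector_derivative f') (at t) \<longleftrightarrow>
     ((\<lambda>y. norm (f y - f t - (y - t) *\<^sub>R f') / norm (y - t)) \<longlongrightarrow> 0) (at t)"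
    unfolding has_vector_derivative_def has_derivative_iff_norm
    by (simp add: bounded_linear_scaleR_left)
  also have "\<dots> \<longleftrightarrow> ((\<lambda>y. norm ((f y - f t) /\<^sub>R (y - t) - f')) \<longlongrightarrow> 0) (at t)"
  proof (rule filterlim_cong[OF refl refl])
    show "\<forall>\<^sub>F y in at t. norm (f y - f t - (y - t) *\<^sub>R f') / norm (y - t)
        = norm ((f y - f t) /\<^sub>R (y - t) - f')"
    proof (intro eventually_at_topological[THEN iffD2] exI[of _ UNIV] conjI ballI impI)
      fix y :: real assume "y \<noteq> t"
      then have "f y - f t - (y - t) *\<^sub>R f' = (y - t) *\<^sub>R ((f y - f t) /\<^sub>R (y - t) - f')"
        by (simp add: scaleR_diff_right)
      with \<open>y \<noteq> t\<close> show "norm (f y - f t - (y - t) *\<^sub>R f') / norm (y - t)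
        = norm ((f y - f t) /\<^sub>R (y - t) - f')" by simp
    qed auto
  qed
  also have "\<dots> \<longleftrightarrow> ((\<lambda>s. (f s - f t) /\<^sub>R (s - t)) \<longlongrightarrow> f') (at t)"
    by (simp add: tendsto_norm_zero_iff Lim_null[symmetric])
  finally show ?thesis .
qed

lemma list_all2_map_right: "(\<And>v. v \<in> set vs \<Longrightarrow> P v (f v)) \<Longrightarrow> list_all2 P vs (map f vs)"
  by (induction vs) auto

lemma list_all2_tendsto_if_differentiable:
  assumes "length vs = n" "\<And>i. i < n \<Longrightarrow> ((vs ! i) has_vector_derivative (ds ! i)) (at t)"
  shows "list_all2 (\<lambda>v l. (v \<longlongrightarrow> l) (at t)) vs (map (\<lambda>v. v t) vs)"
proof (rule list_all2_map_right)
  fix w assume "w \<in> set vs"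
  then obtain i where "i < n" "w = vs ! i" using assms(1) by (metis in_set_conv_nth)
  then have "isCont w t" using assms(2) has_vector_derivative_continuous by blast
  then show "(w \<longlongrightarrow> w t) (at t)" by (simp add: isCont_def)
qed

text \<open>Leibniz rule by induction on the number of slots: the difference quotient splits into T
  applied to the quotient of the first argument, the others still moving, and the quotient of T with
  its first slot frozen at time t.\<close>

lemma bounded_multilinear_has_vector_derivative:
  assumes "bounded_multilinear n T" "length vs = n" "length ds = n"
    and "\<And>i. i < n \<Longrightarrow> ((vs ! i) has_vector_derivative (ds ! i)) (at t)"
  shows "((\<lambda>s. T (map (\<lambda>v. v s) vs)) has_vector_derivative
          (\<Sum>j<n. T ((map (\<lambda>v. v t) vs)[j := ds ! j]))) (at t)"
  using assms
proof (induction n arbitrary: T vs ds)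
  case 0
  then show ?case by simp
next
  case (Suc n)
  then obtain v ws d es where vs: "vs = v # ws" and ds: "ds = d # es"
    and l: "length ws = n" "length es = n" by (metis length_Suc_conv)
  have v: "(v has_vector_derivative d) (at t)" using Suc.prems(4)[of 0] vs ds by simp
  have ws: "((ws ! i) has_vector_derivative (es ! i)) (at t)" if "i < n" for i
    using Suc.prems(4)[of "Suc i"] vs ds that by simp
  note T = Suc.prems(1)
  have ih: "((\<lambda>s. T (v t # map (\<lambda>v. v s) ws)) has_vector_derivative
          (\<Sum>j<n. T (v t # (map (\<lambda>v. v t) ws)[j := es ! j]))) (at t)"
    using Suc.IH[OF bounded_multilinear_Cons[OF T] l ws] .
  have "list_all2 (\<lambda>v l. (v \<longlongrightarrow> l) (at t)) ws (map (\<lambda>v. v t) ws)"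
    by (rule list_all2_tendsto_if_differentiable[OF l(1) ws])
  moreover have "((\<lambda>s. (v s - v t) /\<^sub>R (s - t)) \<longlongrightarrow> d) (at t)"
    using v by (simp only: has_vector_derivative_iff_quotient)
  ultimately have "((\<lambda>s. T (map (\<lambda>v. v s) ((\<lambda>s. (v s - v t) /\<^sub>R (s - t)) # ws))) \<longlongrightarrow>
      T (d # map (\<lambda>v. v t) ws)) (at t)"
    by (intro bounded_multilinear_tendsto[OF T]) (auto simp: l)
  from tendsto_add[OF this ih[unfolded has_vector_derivative_iff_quotient]]
  have "((\<lambda>s. T ((v s - v t) /\<^sub>R (s - t) # map (\<lambda>v. v s) ws) +
       (T (v t # map (\<lambda>v. v s) ws) - T (v t # map (\<lambda>v. v t) ws)) /\<^sub>R (s - t)) \<longlongrightarrow>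
      T (d # map (\<lambda>v. v t) ws) + (\<Sum>j<n. T (v t # (map (\<lambda>v. v t) ws)[j := es ! j]))) (at t)"
    by simp
  moreover have "T ((v s - v t) /\<^sub>R (s - t) # map (\<lambda>v. v s) ws) +
       (T (v t # map (\<lambda>v. v s) ws) - T (v t # map (\<lambda>v. v t) ws)) /\<^sub>R (s - t)
     = (T (v s # map (\<lambda>v. v s) ws) - T (v t # map (\<lambda>v. v t) ws)) /\<^sub>R (s - t)" for s
    using l by (simp add: bounded_multilinear_Cons_simps[OF T] scaleR_diff_right)
  ultimately show ?case
    unfolding has_vector_derivative_iff_quotient vs ds
    by (simp add: sum.lessThan_Suc_shift del: sum.lessThan_Suc)
qed

text \<open>The remainder estimate is one in operator norm, so it stays valid while the arguments
  move together with the base point C s.\<close>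

lemma higher_derivs_remainder:
  assumes D: "higher_derivs U D" and t: "C t \<in> U" and C: "(C \<longlongrightarrow> C t) (at t)"
    and vs: "length vs = n" and e: "e > 0"
  shows "\<forall>\<^sub>F s in at t. norm (D n (C s) (map (\<lambda>v. v s) vs) - D n (C t) (map (\<lambda>v. v s) vs)
      - D (Suc n) (C t) ((C s - C t) # map (\<lambda>v. v s) vs))
      \<le> e * norm (C s - C t) * prod_list (map (\<lambda>v. norm (v s)) vs)"
proof -
  obtain d where d: "d > 0" "\<And>y vs. y \<in> U \<Longrightarrow> norm (y - C t) < d \<Longrightarrow> length vs = n \<Longrightarrow>
      norm (D n y vs - D n (C t) vs - D (Suc n) (C t) ((y - C t) # vs))
             \<le> e * norm (y - C t) * prod_list (map norm vs)"
    using higher_derivsE[OF D t e, of n] by blast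
  have "open U" using D by (simp add: higher_derivs_def)
  then have "\<forall>\<^sub>F s in at t. C s \<in> U" using topological_tendstoD[OF C _ t] by blast
  moreover have "\<forall>\<^sub>F s in at t. norm (C s - C t) < d"
    using tendstoD[OF C d(1)] by (simp add: dist_norm)
  ultimately show ?thesis
  proof eventually_elim
    case (elim s)
    then show ?case using d(2)[OF elim, of "map (\<lambda>v. v s) vs"] vs by (simp add: o_def)
  qed
qed

lemma higher_derivs_isCont:
  assumes D: "higher_derivs U D" and t: "C t \<in> U" and C: "isCont C t"
    and vs: "length vs = n" "\<And>v. v \<in> set vs \<Longrightarrow> isCont v t"
  shows "isCont (\<lambda>s. D n (C s) (map (\<lambda>v. v s) vs)) t"
proof -
  have bm: "bounded_multilinear k (D k (C t))" for k using D t by (simp add: higher_derivs_def)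
  have C': "(C \<longlongrightarrow> C t) (at t)" using C by (simp add: isCont_def)
  have l2: "list_all2 (\<lambda>v l. (v \<longlongrightarrow> l) (at t)) vs (map (\<lambda>v. v t) vs)"
    using vs by (intro list_all2_map_right) (simp add: isCont_def)
  have a: "((\<lambda>s. D n (C t) (map (\<lambda>v. v s) vs)) \<longlongrightarrow> D n (C t) (map (\<lambda>v. v t) vs)) (at t)"
    by (rule bounded_multilinear_tendsto[OF bm l2 vs(1)])
  have Ct: "((\<lambda>s. C s - C t) \<longlongrightarrow> 0) (at t)" using C' by (simp add: Lim_null[symmetric])
  have "((\<lambda>s. D (Suc n) (C t) (map (\<lambda>v. v s) ((\<lambda>s. C s - C t) # vs))) \<longlongrightarrow>
     D (Suc n) (C t) (0 # map (\<lambda>v. v t) vs)) (at t)"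
    using l2 Ct vs by (intro bounded_multilinear_tendsto[OF bm]) auto
  moreover have "D (Suc n) (C t) (0 # map (\<lambda>v. v t) vs) = 0"
    using vs(1) by (simp add: bounded_multilinear_Cons_simps[OF bm])
  ultimately have b: "((\<lambda>s. D (Suc n) (C t) ((C s - C t) # map (\<lambda>v. v s) vs)) \<longlongrightarrow> 0) (at t)"
    by simp
  have prod: "((\<lambda>s. prod_list (map (\<lambda>v. norm (v s)) vs)) \<longlongrightarrow> prod_list (map norm (map (\<lambda>v. v t) vs))) (at t)"
    by (rule prod_list_norm_tendsto[OF l2])
  have "((\<lambda>s. 1 * norm (C s - C t) * prod_list (map (\<lambda>v. norm (v s)) vs)) \<longlongrightarrow>
      1 * norm (C t - C t) * prod_list (map norm (map (\<lambda>v. v t) vs))) (at t)"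
    by (intro tendsto_intros prod C')
  then have "((\<lambda>s. 1 * norm (C s - C t) * prod_list (map (\<lambda>v. norm (v s)) vs)) \<longlongrightarrow> 0) (at t)" by simp
  then have c: "((\<lambda>s. D n (C s) (map (\<lambda>v. v s) vs) - D n (C t) (map (\<lambda>v. v s) vs)
      - D (Suc n) (C t) ((C s - C t) # map (\<lambda>v. v s) vs)) \<longlongrightarrow> 0) (at t)"
    by (rule Lim_null_comparison[OF higher_derivs_remainder[OF D t C' vs(1) zero_less_one]])
  show ?thesis unfolding isCont_def
    using tendsto_add[OF tendsto_add[OF c b] a] by simp
qed

text \<open>Moving the base point first contributes the next derivative in direction C'; moving the
  arguments at the fixed base point C t contributes the Leibniz sum.\<close>

lemma higher_derivs_has_vector_derivative:
  assumes D: "higher_derivs U D" and t: "C t \<in> U" and C: "(C has_vector_derivative C') (at t)"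
    and vs: "length vs = n" "length ds = n"
      "\<And>i. i < n \<Longrightarrow> ((vs ! i) has_vector_derivative (ds ! i)) (at t)"
  shows "((\<lambda>s. D n (C s) (map (\<lambda>v. v s) vs)) has_vector_derivative
          D (Suc n) (C t) (C' # map (\<lambda>v. v t) vs) +
          (\<Sum>j<n. D n (C t) ((map (\<lambda>v. v t) vs)[j := ds ! j]))) (at t)"
proof -
  have bm: "bounded_multilinear k (D k (C t))" for k using D t by (simp add: higher_derivs_def)
  have C': "(C \<longlongrightarrow> C t) (at t)" using C has_vector_derivative_continuous isCont_def by blast
  have l2: "list_all2 (\<lambda>v l. (v \<longlongrightarrow> l) (at t)) vs (map (\<lambda>v. v t) vs)"
    by (rule list_all2_tendsto_if_differentiable[OF vs(1,3)])
  have prod: "((\<lambda>s. prod_list (map (\<lambda>v. norm (v s)) vs)) \<longlongrightarrow> prod_list (map norm (map (\<lambda>v. v t) vs))) (at t)"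
    by (rule prod_list_norm_tendsto[OF l2])
  define P where "P = prod_list (map norm (map (\<lambda>v. v t) vs))"
  have P: "P \<ge> 0" unfolding P_def by (rule prod_list_map_norm_nonneg)
  have a: "((\<lambda>s. D n (C t) (map (\<lambda>v. v s) vs)) has_vector_derivative
          (\<Sum>j<n. D n (C t) ((map (\<lambda>v. v t) vs)[j := ds ! j]))) (at t)"
    by (rule bounded_multilinear_has_vector_derivative[OF bm vs])
  have q: "((\<lambda>s. (C s - C t) /\<^sub>R (s - t)) \<longlongrightarrow> C') (at t)"
    using C by (simp only: has_vector_derivative_iff_quotient)
  then have "((\<lambda>s. D (Suc n) (C t) (map (\<lambda>v. v s) ((\<lambda>s. (C s - C t) /\<^sub>R (s - t)) # vs))) \<longlongrightarrow>
     D (Suc n) (C t) (C' # map (\<lambda>v. v t) vs)) (at t)"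
    using l2 vs by (intro bounded_multilinear_tendsto[OF bm]) auto
  then have b: "((\<lambda>s. D (Suc n) (C t) ((C s - C t) /\<^sub>R (s - t) # map (\<lambda>v. v s) vs)) \<longlongrightarrow>
     D (Suc n) (C t) (C' # map (\<lambda>v. v t) vs)) (at t)" by simp
  define R where "R s = D n (C s) (map (\<lambda>v. v s) vs) - D n (C t) (map (\<lambda>v. v s) vs)
      - D (Suc n) (C t) ((C s - C t) # map (\<lambda>v. v s) vs)" for s
  have c: "((\<lambda>s. R s /\<^sub>R (s - t)) \<longlongrightarrow> 0) (at t)"
  proof (rule tendstoI)
    fix e :: real assume e: "e > 0"
    \<comment> \<open>The two moving factors, the difference quotient of C and the product of norms,
      are eventually below norm C' + 1 and P + 1; the factor 2 yields a strict inequality.\<close>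
    define e' where "e' = e / (2 * ((norm C' + 1) * (P + 1)))"
    have K: "(norm C' + 1) * (P + 1) > 0"
      using P by (intro mult_pos_pos) (auto simp: add_nonneg_pos)
    have e': "e' > 0" using e K unfolding e'_def by simp
    have 1: "\<forall>\<^sub>F s in at t. norm ((C s - C t) /\<^sub>R (s - t)) < norm C' + 1"
      using tendsto_norm[OF q] by (rule order_tendstoD) simp
    have 2: "\<forall>\<^sub>F s in at t. prod_list (map (\<lambda>v. norm (v s)) vs) < P + 1"
      using prod unfolding P_def by (rule order_tendstoD) simp
    have 3: "\<forall>\<^sub>F s in at t. s \<noteq> t" by (simp add: eventually_at_filter)
    show "\<forall>\<^sub>F s in at t. dist (R s /\<^sub>R (s - t)) 0 < e"
      using 1 2 3 higher_derivs_remainder[OF D t C' vs(1) e']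
    proof eventually_elim
      case (elim s)
      have "norm (R s /\<^sub>R (s - t)) = norm (R s) / \<bar>s - t\<bar>"
        by (simp add: divide_inverse_commute)
      also have "\<dots> \<le> (e' * norm (C s - C t) * prod_list (map (\<lambda>v. norm (v s)) vs)) / \<bar>s - t\<bar>"
        using elim(4) unfolding R_def by (intro divide_right_mono) auto
      also have "\<dots> = e' * (norm ((C s - C t) /\<^sub>R (s - t)) * prod_list (map (\<lambda>v. norm (v s)) vs))"
        by (simp add: divide_inverse_commute)
      also have "\<dots> \<le> e' * ((norm C' + 1) * (P + 1))"
        using elim(1,2) e' prod_list_map_norm_nonneg[of "map (\<lambda>v. v s) vs"]
        by (intro mult_left_mono mult_mono) (auto simp: o_def)
      also have "\<dots> = e / 2" unfolding e'_def using K by (simp add: field_simps)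
      also have "\<dots> < e" using e by simp
      finally show ?case by simp
    qed
  qed
  have eq: "(D n (C s) (map (\<lambda>v. v s) vs) - D n (C t) (map (\<lambda>v. v t) vs)) /\<^sub>R (s - t)
     = R s /\<^sub>R (s - t) + D (Suc n) (C t) ((C s - C t) /\<^sub>R (s - t) # map (\<lambda>v. v s) vs)
      + (D n (C t) (map (\<lambda>v. v s) vs) - D n (C t) (map (\<lambda>v. v t) vs)) /\<^sub>R (s - t)" for s
    unfolding R_def
    using vs(1) by (simp add: bounded_multilinear_Cons_simps[OF bm] scaleR_diff_right)
  show ?thesis
    using tendsto_add[OF tendsto_add[OF c b] a[unfolded has_vector_derivative_iff_quotient]]
    unfolding has_vector_derivative_iff_quotient eq by simp
qed

lemma higher_derivs_has_derivative:
  assumes D: "higher_derivs U D" and x: "x \<in> U" and vs: "length vs = k"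
  shows "((\<lambda>y. D k y vs) has_derivative (\<lambda>h. D (Suc k) x (h # vs))) (at x)"
  unfolding has_derivative_at_alt
proof (intro conjI allI impI)
  show "bounded_linear (\<lambda>h. D (Suc k) x (h # vs))"
    using D x vs by (intro bounded_multilinear_linear_Cons) (auto simp: higher_derivs_def)
  fix e :: real assume e: "e > 0"
  define P where "P = prod_list (map norm vs)"
  have P: "P \<ge> 0" unfolding P_def by (rule prod_list_map_norm_nonneg)
  have "e / (P + 1) > 0" using e P by simp
  then obtain d where d: "d > 0" "\<And>y. y \<in> U \<Longrightarrow> norm (y - x) < d \<Longrightarrow>
      norm (D k y vs - D k x vs - D (Suc k) x ((y - x) # vs)) \<le> e / (P + 1) * norm (y - x) * P"
    using higher_derivsE[OF D x, of "e / (P + 1)" k] vs unfolding P_def by metis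
  have "open U" using D by (simp add: higher_derivs_def)
  then obtain r where r: "r > 0" "ball x r \<subseteq> U" using x open_contains_ball by blast
  have "norm (D k y vs - D k x vs - D (Suc k) x ((y - x) # vs)) \<le> e * norm (y - x)"
    if y: "norm (y - x) < min d r" for y
  proof -
    have "y \<in> U" using y r by (auto simp: dist_norm norm_minus_commute)
    then have "norm (D k y vs - D k x vs - D (Suc k) x ((y - x) # vs)) \<le> e / (P + 1) * norm (y - x) * P"
      using d y by simp
    also have "\<dots> = (P / (P + 1)) * (e * norm (y - x))" by simp
    also have "\<dots> \<le> 1 * (e * norm (y - x))" using P e by (intro mult_right_mono) auto
    finally show ?thesis by simp
  qed
  then show "\<exists>d>0. \<forall>y. norm (y - x) < d \<longrightarrow>
      norm (D k y vs - D k x vs - D (Suc k) x ((y - x) # vs)) \<le> e * norm (y - x)"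
    using d r by (intro exI[of _ "min d r"]) auto
qed

lemma higher_derivs_has_derivative_0:
  assumes D: "higher_derivs U D" "\<forall>x\<in>U. D 0 x [] = f x" and x: "x \<in> U"
  shows "(f has_derivative (\<lambda>h. D 1 x [h])) (at x)"
proof -
  have "open U" using D by (simp add: higher_derivs_def)
  have "((\<lambda>y. D 0 y []) has_derivative (\<lambda>h. D 1 x [h])) (at x)"
    using higher_derivs_has_derivative[OF D(1) x, of "[]" 0] by simp
  then show ?thesis
    by (rule has_derivative_transform_within_open[OF _ \<open>open U\<close> x]) (use D in auto)
qed

lemma smooth_on_differentiable: "smooth_on U f \<Longrightarrow> x \<in> U \<Longrightarrow> f differentiable (at x)"
  unfolding smooth_on_iff_higher_derivs differentiable_def using higher_derivs_has_derivative_0 by blast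

text \<open>The second derivative makes the first one deviate from A at most linearly in the
  distance from x, so the mean value inequality for f - A on a ball of radius \<rho> gains a factor
  \<rho>. This rate is what later makes the dyadic approximations of the exponential map
  converge.\<close>

lemma smooth_on_strict_estimate:
  assumes f: "smooth_on U f" and x: "x \<in> U"
  obtains C r A where "r > 0" "C \<ge> 0" "bounded_linear A" "(f has_derivative A) (at x)" "ball x r \<subseteq> U"
    "\<And>\<rho> y z. \<rho> < r \<Longrightarrow> norm (y - x) \<le> \<rho> \<Longrightarrow> norm (z - x) \<le> \<rho> \<Longrightarrow>
       norm (f y - f z - A (y - z)) \<le> C * \<rho> * norm (y - z)"
proof -
  obtain D where D: "higher_derivs U D" "\<forall>x\<in>U. D 0 x [] = f x"
    using f unfolding smooth_on_iff_higher_derivs by blast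
  define A where "A h = D 1 x [h]" for h
  note der = higher_derivs_has_derivative_0[OF D]
  obtain C0 where C0: "C0 \<ge> 0" "\<And>vs. length vs = 2 \<Longrightarrow> norm (D 2 x vs) \<le> C0 * prod_list (map norm vs)"
    using D x bounded_multilinear_bound[of 2 "D 2 x"] unfolding higher_derivs_def by blast
  obtain d where d: "d > 0" "\<And>y vs. y \<in> U \<Longrightarrow> norm (y - x) < d \<Longrightarrow> length vs = 1 \<Longrightarrow>
      norm (D 1 y vs - D 1 x vs - D (Suc 1) x ((y - x) # vs)) \<le> 1 * norm (y - x) * prod_list (map norm vs)"
    using higher_derivsE[OF D(1) x zero_less_one, of 1] by blast
  obtain r0 where r0: "r0 > 0" "ball x r0 \<subseteq> U" using smooth_on_open[OF f] x open_contains_ball by blast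
  define r where "r = min d r0"
  \<comment> \<open>C0 bounds the second derivative at x; the added 1 absorbs the remainder, taken
    with tolerance 1.\<close>
  define C where "C = C0 + 1"
  have bnd: "norm (D 1 y [h] - A h) \<le> C * norm (y - x) * norm h" if "norm (y - x) < r" for y h
  proof -
    have y: "y \<in> U" using r0 that unfolding r_def by (auto simp: dist_norm norm_minus_commute)
    have "norm (D 1 y [h] - D 1 x [h] - D (Suc 1) x [y - x, h]) \<le> norm (y - x) * norm h"
      using d(2)[OF y, of "[h]"] that unfolding r_def by simp
    moreover have "norm (D 2 x [y - x, h]) \<le> C0 * (norm (y - x) * norm h)" using C0(2)[of "[y-x,h]"] by simp
    moreover have "norm (D 1 y [h] - A h) \<le> norm (D 1 y [h] - D 1 x [h] - D (Suc 1) x [y - x, h])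
        + norm (D 2 x [y - x, h])"
      unfolding A_def numeral_2_eq_2 One_nat_def
      by (metis add.commute diff_add_cancel norm_triangle_ineq)
    ultimately show ?thesis unfolding C_def by (simp add: algebra_simps)
  qed
  have est: "norm (f y - f z - A (y - z)) \<le> C * \<rho> * norm (y - z)"
    if "\<rho> < r" "norm (y - x) \<le> \<rho>" "norm (z - x) \<le> \<rho>" for y z \<rho>
  proof -
    have A: "bounded_linear A" using der[OF x] unfolding A_def by (rule has_derivative_bounded_linear)
    have "norm ((f y - A y) - (f z - A z)) \<le> (C * \<rho>) * norm (y - z)"
    proof (rule differentiable_bound[where S = "cball x \<rho>"])
      fix w assume w: "w \<in> cball x \<rho>"
      then have wr: "norm (w - x) \<le> \<rho>" "norm (w - x) < r" using that by (auto simp: dist_norm norm_minus_commute)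
      then have "w \<in> U" using r0 unfolding r_def by (auto simp: dist_norm norm_minus_commute)
      then show "((\<lambda>w. f w - A w) has_derivative (\<lambda>h. D 1 w [h] - A h)) (at w within cball x \<rho>)"
        by (rule has_derivative_diff[OF has_derivative_at_withinI[OF der] bounded_linear_imp_has_derivative[OF A]])
      have "0 \<le> C" unfolding C_def using C0 by simp
      show "onorm (\<lambda>h. D 1 w [h] - A h) \<le> C * \<rho>"
      proof (rule onorm_bound)
        show "0 \<le> C * \<rho>" using \<open>0 \<le> C\<close> order_trans[OF norm_ge_zero wr(1)] by simp
        fix h
        have "norm (D 1 w [h] - A h) \<le> C * norm (w - x) * norm h" using bnd wr by blast
        also have "\<dots> \<le> C * \<rho> * norm h" using wr \<open>0 \<le> C\<close> by (intro mult_right_mono mult_left_mono) auto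
        finally show "norm (D 1 w [h] - A h) \<le> C * \<rho> * norm h" .
      qed
    qed (use that in \<open>auto simp: dist_norm norm_minus_commute\<close>)
    then show ?thesis by (simp add: linear_diff[OF bounded_linear.linear[OF A]] algebra_simps)
  qed
  show ?thesis
  proof (rule that)
    show "r > 0" unfolding r_def using d r0 by simp
    show "0 \<le> C" unfolding C_def using C0 by simp
    show "(f has_derivative A) (at x)" using der[OF x] unfolding A_def .
    then show "bounded_linear A" by (rule has_derivative_bounded_linear)
    show "ball x r \<subseteq> U" using r0 unfolding r_def by auto
  qed (fact est)
qed

lemma prod_list_norm_map_le:
  assumes "\<And>v. norm (A v) \<le> norm v * K"
  shows "prod_list (map norm (map A vs)) \<le> prod_list (map norm vs) * K ^ length vs"
proof (induction vs)
  case (Cons v vs)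
  have "prod_list (map norm (map A (v # vs))) \<le> (norm v * K) * (prod_list (map norm vs) * K ^ length vs)"
    using Cons assms order_trans[OF norm_ge_zero assms[of v]] prod_list_map_norm_nonneg[of "map A vs"]
    by (simp only: list.map prod_list.Cons) (rule mult_mono, auto)
  then show ?case by (simp add: mult_ac)
qed simp

text \<open>Serves two purposes: moving the unit of a Lie group to the origin of its chart, and
  freezing one argument of a map on a product.\<close>

lemma smooth_on_affine:
  assumes f: "smooth_on U f" and A: "bounded_linear A"
  shows "smooth_on {x. A x + a \<in> U} (\<lambda>x. f (A x + a) - b)"
proof -
  obtain D where D: "higher_derivs U D" "\<forall>x\<in>U. D 0 x [] = f x"
    using f unfolding smooth_on_iff_higher_derivs by blast
  obtain K where K: "K > 0" "\<And>x. norm (A x) \<le> norm x * K"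
    using bounded_linear.pos_bounded[OF A] by blast
  have bm: "bounded_multilinear k (D k x)" if "x \<in> U" for k x using D that by (simp add: higher_derivs_def)
  \<comment> \<open>A is inserted in every slot; the subtracted constant survives only in order
    0.\<close>
  define D' where "D' k x vs = D k (A x + a) (map A vs) - (if k = 0 then b else 0)" for k x vs
  have op: "open {x. A x + a \<in> U}"
    using continuous_open_vimage[of U "\<lambda>x. A x + a"] smooth_on_open[OF f]
      linear_continuous_at[OF A] by (simp add: vimage_def continuous_intros)
  have "higher_derivs {x. A x + a \<in> U} D'"
    unfolding higher_derivs_def
  proof (intro conjI allI ballI impI op)
    fix k x assume x: "x \<in> {x. A x + a \<in> U}"
    obtain C where C: "C \<ge> 0" "\<And>vs. length vs = k \<Longrightarrow> norm (D k (A x + a) vs) \<le> C * prod_list (map norm vs)"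
      using bounded_multilinear_bound[OF bm] x by blast
    show "bounded_multilinear k (D' k x)"
      unfolding bounded_multilinear_def
    proof (intro conjI allI impI)
      fix vs :: "'c list" and i assume i: "length vs = k \<and> i < k"
      then have "linear (\<lambda>v. D k (A x + a) ((map A vs)[i := v]))"
        using bm[of "A x + a" k] x by (simp add: bounded_multilinear_def)
      from linear_compose[OF bounded_linear.linear[OF A] this]
      show "linear (\<lambda>v. D' k x (vs[i := v]))" unfolding D'_def using i by (simp add: o_def map_update)
    next
      have "norm (D' k x vs) \<le> (C * K ^ k + norm b) * prod_list (map norm vs)" if "length vs = k" for vs
      proof -
        have "norm (D k (A x + a) (map A vs)) \<le> C * prod_list (map norm (map A vs))"
          using C(2)[of "map A vs"] that by simp
        also have "\<dots> \<le> C * (prod_list (map norm vs) * K ^ k)"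
          using prod_list_norm_map_le[of A K vs, OF K(2)] C(1) that by (intro mult_left_mono) auto
        finally have 1: "norm (D k (A x + a) (map A vs)) \<le> C * K ^ k * prod_list (map norm vs)"
          by (simp add: mult_ac)
        have 2: "norm (if k = 0 then b else 0) \<le> norm b * prod_list (map norm vs)"
          using that prod_list_map_norm_nonneg[of vs] by auto
        show ?thesis
          using norm_triangle_ineq4[of "D k (A x + a) (map A vs)" "if k = 0 then b else 0"] 1 2
          unfolding D'_def by (simp add: algebra_simps)
      qed
      then show "\<exists>C. \<forall>vs. length vs = k \<longrightarrow> norm (D' k x vs) \<le> C * prod_list (map norm vs)" by blast
    qed
    fix e :: real assume e: "e > 0"
    \<comment> \<open>The displacement of the base point costs one factor K, and the k slots cost K
      ^ k.\<close>
    define e' where "e' = e / (K * K ^ k)"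
    have e': "e' > 0" unfolding e'_def using e K by simp
    then obtain d where d: "d > 0" "\<And>y vs. y \<in> U \<Longrightarrow> norm (y - (A x + a)) < d \<Longrightarrow> length vs = k \<Longrightarrow>
        norm (D k y vs - D k (A x + a) vs - D (Suc k) (A x + a) ((y - (A x + a)) # vs))
           \<le> e' * norm (y - (A x + a)) * prod_list (map norm vs)"
      using higher_derivsE[OF D(1) _ e', of "A x + a" k] x by blast
    have "norm (D' k y vs - D' k x vs - D' (Suc k) x ((y - x) # vs)) \<le> e * norm (y - x) * prod_list (map norm vs)"
      if y: "y \<in> {x. A x + a \<in> U}" and yx: "norm (y - x) < d / K" and l: "length vs = k" for y vs
    proof -
      have Axy: "A y + a - (A x + a) = A (y - x)" using A by (simp add: bounded_linear.linear linear_diff)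
      have n: "norm (A (y - x)) < d" using K(2)[of "y - x"] yx K(1) by (simp add: field_simps)
      have "norm (D' k y vs - D' k x vs - D' (Suc k) x ((y - x) # vs)) \<le>
          e' * norm (A (y - x)) * prod_list (map norm (map A vs))"
        using d(2)[of "A y + a" "map A vs"] y n l unfolding Axy D'_def by simp
      also have "\<dots> \<le> e' * (norm (y - x) * K) * (prod_list (map norm vs) * K ^ k)"
        using prod_list_norm_map_le[of A K vs, OF K(2)] K(2)[of "y - x"] e' l K(1)
          prod_list_map_norm_nonneg[of "map A vs"]
        by (intro mult_mono mult_left_mono mult_nonneg_nonneg) auto
      also have "\<dots> = e * norm (y - x) * prod_list (map norm vs)" unfolding e'_def using K by simp
      finally show ?thesis .
    qed
    then show "\<exists>d>0. \<forall>y\<in>{x. A x + a \<in> U}. norm (y - x) < d \<longrightarrow> (\<forall>vs. length vs = k \<longrightarrow>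
        norm (D' k y vs - D' k x vs - D' (Suc k) x ((y - x) # vs)) \<le> e * norm (y - x) * prod_list (map norm vs))"
      using d K by (intro exI[of _ "d / K"]) auto
  qed
  moreover have "\<forall>x\<in>{x. A x + a \<in> U}. D' 0 x [] = f (A x + a) - b" using D by (simp add: D'_def)
  ultimately show ?thesis unfolding smooth_on_iff_higher_derivs using op by blast
qed

text \<open>\<open>f\<close> is a curve of class \<open>C\<^sup>k\<close> on some neighbourhood of \<open>t\<close>.\<close>

fun Ck_at :: "nat \<Rightarrow> (real \<Rightarrow> 'a::real_normed_vector) \<Rightarrow> real \<Rightarrow> bool" where
  "Ck_at 0 f t \<longleftrightarrow> (\<forall>\<^sub>F s in nhds t. isCont f s)"
| "Ck_at (Suc k) f t \<longleftrightarrow> (\<forall>\<^sub>F s in nhds t. f differentiable (at s)) \<and>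
     Ck_at k (\<lambda>s. vector_derivative f (at s)) t"

lemma Ck_at_cong_imp:
  assumes "\<forall>\<^sub>F s in nhds t. f s = g s" "Ck_at k f t"
  shows "Ck_at k g t"
  using assms
proof (induction k arbitrary: f g)
  case 0
  from 0(1) have "\<forall>\<^sub>F s in nhds t. \<forall>\<^sub>F u in nhds s. f u = g u" by (simp add: eventually_eventually)
  then have "\<forall>\<^sub>F s in nhds t. isCont g s"
    using 0(2)[unfolded Ck_at.simps] by eventually_elim (simp add: isCont_cong)
  then show ?case by simp
next
  case (Suc k)
  from Suc.prems(1) have ev: "\<forall>\<^sub>F s in nhds t. \<forall>\<^sub>F u in nhds s. f u = g u" by (simp add: eventually_eventually)
  then have "\<forall>\<^sub>F s in nhds t. vector_derivative f (at s) = vector_derivative g (at s)"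
    by (rule eventually_mono) (rule vector_derivative_cong_eq, auto simp: eventually_nhds_x_imp_x)
  moreover have "\<forall>\<^sub>F s in nhds t. g differentiable (at s)"
    using ev Suc.prems(2)[unfolded Ck_at.simps, THEN conjunct1]
  proof eventually_elim
    case (elim s)
    then obtain f' where "(f has_derivative f') (at s)" by (auto simp: differentiable_def)
    moreover obtain S where "open S" "s \<in> S" "\<And>u. u \<in> S \<Longrightarrow> f u = g u"
      using elim(1) unfolding eventually_nhds by blast
    ultimately have "(g has_derivative f') (at s)" by (rule has_derivative_transform_within_open)
    then show ?case by (auto simp: differentiable_def)
  qed
  ultimately show ?case using Suc.IH Suc.prems(2) by auto
qed

lemma Ck_at_SucI:
  assumes "\<forall>\<^sub>F s in nhds t. (f has_vector_derivative f' s) (at s)" "Ck_at k f' t"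
  shows "Ck_at (Suc k) f t"
proof -
  have "\<forall>\<^sub>F s in nhds t. f' s = vector_derivative f (at s)"
    using assms(1) by (rule eventually_mono) (simp add: vector_derivative_at)
  then have "Ck_at k (\<lambda>s. vector_derivative f (at s)) t" by (rule Ck_at_cong_imp) (fact assms(2))
  moreover have "\<forall>\<^sub>F s in nhds t. f differentiable (at s)"
    using assms(1) by (rule eventually_mono) (rule differentiableI_vector)
  ultimately show ?thesis by simp
qed

lemma Ck_at_SucE:
  assumes "Ck_at (Suc k) f t"
  shows "\<forall>\<^sub>F s in nhds t. (f has_vector_derivative vector_derivative f (at s)) (at s)"
    "Ck_at k (\<lambda>s. vector_derivative f (at s)) t"
  using assms by (simp_all only: Ck_at.simps vector_derivative_works[symmetric])

lemma Ck_at_isCont: "Ck_at k f t \<Longrightarrow> \<forall>\<^sub>F s in nhds t. isCont f s"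
proof (cases k)
  case (Suc n)
  assume "Ck_at k f t"
  then have "\<forall>\<^sub>F s in nhds t. f differentiable (at s)" unfolding Suc by simp
  then show ?thesis by (rule eventually_mono) (rule differentiable_imp_continuous_within)
qed simp

lemma Ck_at_eventually_in:
  assumes "Ck_at k C t" "open U" "C t \<in> U"
  shows "\<forall>\<^sub>F s in nhds t. C s \<in> U"
proof -
  have "isCont C t" using Ck_at_isCont[OF assms(1)] by (auto dest: eventually_nhds_x_imp_x)
  then have "(C \<longlongrightarrow> C t) (nhds t)" by (simp add: continuous_at tendsto_at_iff_tendsto_nhds)
  then show ?thesis using assms(2,3) by (rule topological_tendstoD)
qed

lemma Ck_at_Suc_imp: "Ck_at (Suc k) f t \<Longrightarrow> Ck_at k f t"
proof (induction k arbitrary: f)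
  case 0
  then show ?case using Ck_at_isCont[OF 0] by simp
next
  case (Suc k)
  then show ?case using Ck_at.simps(2) by blast
qed

lemma Ck_at_const [simp]: "Ck_at k (\<lambda>s. c) t"
proof (induction k arbitrary: c)
  case (Suc k)
  have "Ck_at k (\<lambda>s. 0 :: 'a) t" by (rule Suc)
  then show ?case by (rule Ck_at_SucI[rotated]) (simp add: always_eventually)
qed simp

lemma Ck_at_add: "Ck_at k f t \<Longrightarrow> Ck_at k g t \<Longrightarrow> Ck_at k (\<lambda>s. f s + g s) t"
proof (induction k arbitrary: f g)
  case 0
  then have "\<forall>\<^sub>F s in nhds t. isCont (\<lambda>s. f s + g s) s"
    unfolding Ck_at.simps by eventually_elim simp
  then show ?case by simp
next
  case (Suc k)
  have "\<forall>\<^sub>F s in nhds t. ((\<lambda>s. f s + g s) has_vector_derivative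
      vector_derivative f (at s) + vector_derivative g (at s)) (at s)"
    using Ck_at_SucE(1)[OF Suc.prems(1)] Ck_at_SucE(1)[OF Suc.prems(2)]
    by eventually_elim (rule has_vector_derivative_add)
  then show ?case
    by (rule Ck_at_SucI) (intro Suc.IH Ck_at_SucE(2) Suc.prems)
qed

lemma Ck_at_sum: "(\<And>i. i \<in> I \<Longrightarrow> Ck_at k (f i) t) \<Longrightarrow> Ck_at k (\<lambda>s. \<Sum>i\<in>I. f i s) t"
  by (induction I rule: infinite_finite_induct) (auto intro: Ck_at_add)

lemma Ck_at_bounded_linear: "bounded_linear A \<Longrightarrow> Ck_at k f t \<Longrightarrow> Ck_at k (\<lambda>s. A (f s)) t"
proof (induction k arbitrary: f)
  case 0
  from 0(2)[unfolded Ck_at.simps] have "\<forall>\<^sub>F s in nhds t. isCont (\<lambda>s. A (f s)) s"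
    by (rule eventually_mono) (rule bounded_linear.isCont[OF 0(1)])
  then show ?case by simp
next
  case (Suc k)
  have "\<forall>\<^sub>F s in nhds t. ((\<lambda>s. A (f s)) has_vector_derivative A (vector_derivative f (at s))) (at s)"
    using Ck_at_SucE(1)[OF Suc.prems(2)]
    by (rule eventually_mono) (rule bounded_linear.has_vector_derivative[OF Suc.prems(1)])
  then show ?case by (rule Ck_at_SucI) (intro Suc.IH Ck_at_SucE(2) Suc.prems)
qed

lemma Ck_at_Pair:
  assumes "Ck_at k f t" "Ck_at k g t" shows "Ck_at k (\<lambda>s. (f s, g s)) t"
proof -
  have "Ck_at k (\<lambda>s. (f s, 0) + (0, g s)) t"
    by (intro Ck_at_add Ck_at_bounded_linear[of "\<lambda>x. (x, 0)"] Ck_at_bounded_linear[of "\<lambda>x. (0, x)"] assms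
        bounded_linear_Pair bounded_linear_ident bounded_linear_zero)
  then show ?thesis by simp
qed

lemma Ck_at_shift:
  assumes "Ck_at k f (t - a)" shows "Ck_at k (\<lambda>s. f (s - a)) t"
  using assms
proof (induction k arbitrary: f)
  case 0
  have "filterlim (\<lambda>s. s - a) (nhds (t - a)) (nhds t)" by (intro tendsto_intros filterlim_ident)
  then have "\<forall>\<^sub>F s in nhds t. isCont f (s - a)"
    using 0 eventually_compose_filterlim by fastforce
  then have "\<forall>\<^sub>F s in nhds t. isCont (\<lambda>s. f (s - a)) s"
    by (rule eventually_mono) (rule isCont_o2[where f = "\<lambda>s. s - a"], simp_all)
  then show ?case by simp
next
  case (Suc k)
  have "filterlim (\<lambda>s. s - a) (nhds (t - a)) (nhds t)" by (intro tendsto_intros filterlim_ident)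
  then have ev: "\<forall>\<^sub>F s in nhds t. (f has_vector_derivative vector_derivative f (at (s - a))) (at (s - a))"
    using Ck_at_SucE(1)[OF Suc.prems] eventually_compose_filterlim by fastforce
  have ev': "\<forall>\<^sub>F s in nhds t. ((\<lambda>s. f (s - a)) has_vector_derivative vector_derivative f (at (s - a))) (at s)"
    using ev
  proof eventually_elim
    case (elim s)
    have "((\<lambda>s. s - a) has_vector_derivative 1) (at s)" by (auto intro!: derivative_eq_intros)
    from vector_diff_chain_at[OF this elim] show ?case by (simp add: o_def)
  qed
  show ?case using Suc.IH[OF Ck_at_SucE(2)[OF Suc.prems]] by (intro Ck_at_SucI[OF ev'])
qed

text \<open>Stated for every order n and every list of moving arguments because this family is
  closed under differentiation: each term of the derivative either raises n and prepends the
  derivative of C, or replaces one argument by its derivative. So the induction on k needs no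
  formula for higher derivatives of composites.\<close>

lemma Ck_at_higher_derivs:
  assumes D: "higher_derivs U D" and t: "C t \<in> U"
  shows "Ck_at k C t \<Longrightarrow> length vs = n \<Longrightarrow> (\<And>v. v \<in> set vs \<Longrightarrow> Ck_at k v t) \<Longrightarrow>
    Ck_at k (\<lambda>s. D n (C s) (map (\<lambda>v. v s) vs)) t"
proof (induction k arbitrary: n vs)
  case 0
  have U: "\<forall>\<^sub>F s in nhds t. C s \<in> U"
    using Ck_at_eventually_in[OF 0(1) _ t] D by (simp add: higher_derivs_def)
  have "\<forall>\<^sub>F s in nhds t. \<forall>v\<in>set vs. isCont v s" using 0 by (intro eventually_ball_finite) auto
  moreover have "\<forall>\<^sub>F s in nhds t. isCont C s" using 0 by simp
  ultimately have "\<forall>\<^sub>F s in nhds t. isCont (\<lambda>s. D n (C s) (map (\<lambda>v. v s) vs)) s"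
    using U by eventually_elim (intro higher_derivs_isCont[OF D], auto simp: 0)
  then show ?case by simp
next
  case (Suc k)
  have U: "\<forall>\<^sub>F s in nhds t. C s \<in> U"
    using Ck_at_eventually_in[OF Suc.prems(1) _ t] D by (simp add: higher_derivs_def)
  define d where "d v = (\<lambda>s. vector_derivative v (at s))" for v :: "real \<Rightarrow> 'a"
  have dC: "\<forall>\<^sub>F s in nhds t. (C has_vector_derivative d C s) (at s)" "Ck_at k (d C) t"
    using Ck_at_SucE[OF Suc.prems(1)] by (auto simp: d_def)
  have dv: "Ck_at k (d v) t" if "v \<in> set vs" for v
    using Ck_at_SucE(2)[OF Suc.prems(3)[OF that]] by (simp add: d_def)
  have "\<forall>\<^sub>F s in nhds t. \<forall>v\<in>set vs. (v has_vector_derivative d v s) (at s)"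
    using Ck_at_SucE(1)[OF Suc.prems(3)] by (intro eventually_ball_finite) (auto simp: d_def)
  with dC(1) U have "\<forall>\<^sub>F s in nhds t. ((\<lambda>s. D n (C s) (map (\<lambda>v. v s) vs)) has_vector_derivative
      D (Suc n) (C s) (map (\<lambda>v. v s) (d C # vs)) +
      (\<Sum>j<n. D n (C s) (map (\<lambda>v. v s) (vs[j := d (vs ! j)])))) (at s)"
  proof eventually_elim
    case (elim s)
    have "((\<lambda>s. D n (C s) (map (\<lambda>v. v s) vs)) has_vector_derivative
          D (Suc n) (C s) (d C s # map (\<lambda>v. v s) vs) +
          (\<Sum>j<n. D n (C s) ((map (\<lambda>v. v s) vs)[j := (map (\<lambda>v. d v s) vs) ! j]))) (at s)"
      using elim Suc.prems(2) by (intro higher_derivs_has_vector_derivative[OF D]) auto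
    then show ?case using Suc.prems(2) by (simp add: map_update)
  qed
  moreover have "Ck_at k (\<lambda>s. D (Suc n) (C s) (map (\<lambda>v. v s) (d C # vs)) +
      (\<Sum>j<n. D n (C s) (map (\<lambda>v. v s) (vs[j := d (vs ! j)])))) t"
  proof (intro Ck_at_add Ck_at_sum Suc.IH)
    show "Ck_at k v t" if "v \<in> set (d C # vs)" for v
      using that dC(2) Ck_at_Suc_imp[OF Suc.prems(3)] by auto
    show "Ck_at k v t" if "v \<in> set (vs[j := d (vs ! j)])" "j \<in> {..<n}" for v j
    proof -
      have "v \<in> insert (d (vs ! j)) (set vs)" using that set_update_subset_insert by fastforce
      then show ?thesis using that Suc.prems(2) dv Ck_at_Suc_imp[OF Suc.prems(3)] by auto
    qed
  qed (use Suc.prems Ck_at_Suc_imp in auto)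
  ultimately show ?case by (rule Ck_at_SucI)
qed

lemma Ck_at_smooth_on:
  assumes f: "smooth_on U f" and t: "C t \<in> U" and C: "Ck_at k C t"
  shows "Ck_at k (\<lambda>s. f (C s)) t"
proof -
  obtain D where D: "higher_derivs U D" "\<forall>x\<in>U. D 0 x [] = f x"
    using f unfolding smooth_on_iff_higher_derivs by blast
  have "\<forall>\<^sub>F s in nhds t. C s \<in> U" by (rule Ck_at_eventually_in[OF C smooth_on_open[OF f] t])
  then have "\<forall>\<^sub>F s in nhds t. D 0 (C s) (map (\<lambda>v. v s) []) = f (C s)"
    by (rule eventually_mono) (use D in auto)
  then show ?thesis
    using Ck_at_higher_derivs[OF D(1) t C, of "[]" 0] by (rule Ck_at_cong_imp) auto
qed

text \<open>No order of differentiability is lost, since the derivative of a smooth map belongs to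
  the same tower of derivatives; this lets \<open>Ck_at_ode\<close> gain one order per
  round.\<close>

lemma Ck_at_frechet_derivative:
  assumes f: "smooth_on U f" and t: "C t \<in> U" and C: "Ck_at k C t" and v: "Ck_at k v t"
  shows "Ck_at k (\<lambda>s. frechet_derivative f (at (C s)) (v s)) t"
proof -
  obtain D where D: "higher_derivs U D" "\<forall>x\<in>U. D 0 x [] = f x"
    using f unfolding smooth_on_iff_higher_derivs by blast
  note der = higher_derivs_has_derivative_0[OF D]
  have "\<forall>\<^sub>F s in nhds t. C s \<in> U" by (rule Ck_at_eventually_in[OF C smooth_on_open[OF f] t])
  then have "\<forall>\<^sub>F s in nhds t. D 1 (C s) (map (\<lambda>v. v s) [v]) = frechet_derivative f (at (C s)) (v s)"
    by (rule eventually_mono) (use frechet_derivative_at[OF der] in \<open>auto simp: fun_eq_iff\<close>)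
  then show ?thesis
    by (rule Ck_at_cong_imp) (rule Ck_at_higher_derivs[OF D(1) t C], use v in auto)
qed

lemma smooth_onI_Ck_at:
  fixes f :: "real \<Rightarrow> 'a::real_normed_vector"
  assumes S: "open S" and f: "\<And>k t. t \<in> S \<Longrightarrow> Ck_at k f t"
  shows "smooth_on S f"
proof -
  define F where "F k = ((\<lambda>g s. vector_derivative g (at s)) ^^ k) f" for k
  have Ck: "Ck_at j (F k) t" if "t \<in> S" for j k t
  proof -
    have "Ck_at (j + k) f t \<Longrightarrow> Ck_at j (F k) t" for j unfolding F_def
      by (induction k arbitrary: j) (auto, metis add_Suc Ck_at.simps(2))
    then show ?thesis using f that by blast
  qed
  have der: "(F k has_vector_derivative F (Suc k) t) (at t)" if "t \<in> S" for k t
    using eventually_nhds_x_imp_x[OF Ck_at_SucE(1)[OF Ck[OF that, of "Suc 0" k]]] by (simp add: F_def)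
  \<comment> \<open>A k-linear form on the real line is the product of its arguments times its value
    at (1, ..., 1), here the k-th derivative.\<close>
  define D where "D k x vs = prod_list vs *\<^sub>R F k x" for k and x :: real and vs
  have np: "prod_list (map norm vs) = norm (prod_list vs)" for vs :: "real list"
    by (induction vs) (auto simp: abs_mult)
  have "higher_derivs S D"
    unfolding higher_derivs_def
  proof (intro conjI allI ballI impI S)
    fix k t assume t: "t \<in> S"
    show "bounded_multilinear k (D k t)"
      unfolding bounded_multilinear_def
    proof (intro conjI allI impI)
      fix vs :: "real list" and i assume "length vs = k \<and> i < k"
      then have "prod_list (vs[i := v]) = v * prod_list (vs[i := 1])" for v
        by (simp add: upd_conv_take_nth_drop)
      then have "D k t (vs[i := v]) = v *\<^sub>R (prod_list (vs[i := 1]) *\<^sub>R F k t)" for v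
        by (metis D_def scaleR_scaleR)
      then show "linear (\<lambda>v. D k t (vs[i := v]))"
        by (simp only:) (rule bounded_linear.linear[OF bounded_linear_scaleR_left])
    qed (auto simp: D_def np intro!: exI[of _ "norm (F k t)"])
    fix e :: real assume "e > 0"
    then obtain d where d: "d > 0" "\<And>y. norm (y - t) < d \<Longrightarrow>
        norm (F k y - F k t - (y - t) *\<^sub>R F (Suc k) t) \<le> e * norm (y - t)"
      using der[OF t, of k] unfolding has_vector_derivative_def has_derivative_at_alt by blast
    have "norm (D k y vs - D k t vs - D (Suc k) t ((y - t) # vs)) \<le> e * norm (y - t) * prod_list (map norm vs)"
      if "norm (y - t) < d" for y vs
    proof -
      have "D k y vs - D k t vs - D (Suc k) t ((y - t) # vs)
          = prod_list vs *\<^sub>R (F k y - F k t - (y - t) *\<^sub>R F (Suc k) t)"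
        by (simp add: D_def algebra_simps)
      then show ?thesis using mult_left_mono[OF d(2)[OF that], of "norm (prod_list vs)"] by (simp add: np mult_ac)
    qed
    then show "\<exists>d>0. \<forall>y\<in>S. norm (y - t) < d \<longrightarrow> (\<forall>vs. length vs = k \<longrightarrow>
         norm (D k y vs - D k t vs - D (Suc k) t ((y - t) # vs)) \<le> e * norm (y - t) * prod_list (map norm vs))"
      using d(1) by blast
  qed
  moreover have "\<forall>x\<in>S. D 0 x [] = f x" by (simp add: D_def F_def)
  ultimately show ?thesis unfolding smooth_on_iff_higher_derivs using S by blast
qed

text \<open>The bootstrap argument: the right-hand side is as smooth as \<open>x\<close> itself.\<close>

lemma Ck_at_ode:
  assumes f: "smooth_on U f" and t: "C t \<in> U"
    and x: "\<forall>\<^sub>F s in nhds t. (x has_vector_derivative frechet_derivative f (at (C s)) (v s)) (at s)"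
    and C: "\<And>k. Ck_at k x t \<Longrightarrow> Ck_at k C t" and v: "\<And>k. Ck_at k v t"
  shows "Ck_at k x t"
proof (induction k)
  case 0
  from x have "\<forall>\<^sub>F s in nhds t. isCont x s"
    by (rule eventually_mono) (rule has_vector_derivative_continuous)
  then show ?case by simp
next
  case (Suc k)
  show ?case by (rule Ck_at_SucI[OF x Ck_at_frechet_derivative[OF f t C[OF Suc] v]])
qed

section \<open>Mollification of cocycles\<close>

lemma Ck_at_ident: "Ck_at k (\<lambda>s. s) t"
proof (cases k)
  case (Suc n)
  have "Ck_at n (\<lambda>s. 1 :: real) t" by simp
  then show ?thesis unfolding Suc
    by (rule Ck_at_SucI[rotated]) (auto intro!: always_eventually derivative_eq_intros)
qed (simp add: always_eventually)

lemma Ck_at_mult: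
  fixes f g :: "real \<Rightarrow> real"
  shows "Ck_at k f t \<Longrightarrow> Ck_at k g t \<Longrightarrow> Ck_at k (\<lambda>s. f s * g s) t"
proof (induction k arbitrary: f g)
  case 0
  then have "\<forall>\<^sub>F s in nhds t. isCont (\<lambda>s. f s * g s) s"
    unfolding Ck_at.simps by eventually_elim simp
  then show ?case by simp
next
  case (Suc k)
  have "\<forall>\<^sub>F s in nhds t. ((\<lambda>s. f s * g s) has_vector_derivative
      f s * vector_derivative g (at s) + vector_derivative f (at s) * g s) (at s)"
    using Ck_at_SucE(1)[OF Suc.prems(1)] Ck_at_SucE(1)[OF Suc.prems(2)]
    by eventually_elim (rule has_vector_derivative_mult)
  then show ?case
    by (rule Ck_at_SucI) (intro Ck_at_add Suc.IH Ck_at_SucE(2) Suc.prems Ck_at_Suc_imp)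
qed

text \<open>\<open>flat 0\<close> is the standard smooth function that is flat at 0. The powers of 1
  / s are included so that the span of the family is closed under differentiation.\<close>

definition flat :: "nat \<Rightarrow> real \<Rightarrow> real" where
  "flat n s = (if s > 0 then inverse s ^ n * exp (- inverse s) else 0)"

lemma flat_tendsto_0: "(flat n \<longlongrightarrow> 0) (at 0)"
proof -
  have "((\<lambda>s. inverse s ^ n / exp (inverse s)) \<longlongrightarrow> 0) (at_right (0::real))"
    by (rule filterlim_compose[OF tendsto_power_div_exp_0 filterlim_inverse_at_top_right])
  then have "(flat n \<longlongrightarrow> 0) (at_right 0)"
    by (rule Lim_transform_eventually)
       (auto simp: flat_def exp_minus divide_inverse eventually_at_filter)
  moreover have "(flat n \<longlongrightarrow> 0) (at_left 0)"
    by (rule Lim_transform_eventually[OF tendsto_const]) (auto simp: flat_def eventually_at_filter)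
  ultimately show ?thesis by (rule filterlim_split_at_real[rotated])
qed

lemma flat_has_vector_derivative:
  "(flat n has_vector_derivative (- real n * flat (n + 1) s + flat (n + 2) s)) (at s)"
proof -
  consider "s > 0" | "s < 0" | "s = 0" by linarith
  then show ?thesis
  proof cases
    case 1
    have "((\<lambda>s. inverse s ^ n * exp (- inverse s)) has_real_derivative
        (- real n * flat (n + 1) s + flat (n + 2) s)) (at s)"
      using 1 by (cases n)
        (auto intro!: derivative_eq_intros simp: flat_def power2_eq_square algebra_simps,
         metis One_nat_def mult.commute neq0_conv power_minus_mult)
    then have "((\<lambda>s. inverse s ^ n * exp (- inverse s)) has_vector_derivative
        (- real n * flat (n + 1) s + flat (n + 2) s)) (at s)"
      by (simp add: has_real_derivative_iff_has_vector_derivative)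
    then show ?thesis
      by (rule has_vector_derivative_transform_within_open[where S = "{0<..}"])
        (use 1 in \<open>auto simp: flat_def\<close>)
  next
    case 2
    have "((\<lambda>s. 0 :: real) has_vector_derivative 0) (at s)" by simp
    then have "(flat n has_vector_derivative 0) (at s)"
      by (rule has_vector_derivative_transform_within_open[where S = "{..<0}"])
        (use 2 in \<open>auto simp: flat_def\<close>)
    then show ?thesis using 2 by (simp add: flat_def)
  next
    case 3
    \<comment> \<open>The difference quotient of \<open>flat n\<close> at 0 is
      \<open>flat (Suc n)\<close>, whose limit is already known.\<close>
    have "((\<lambda>u. (flat n u - flat n 0) /\<^sub>R (u - 0)) \<longlongrightarrow> 0) (at 0)"
      by (rule Lim_transform_eventually[OF flat_tendsto_0[of "Suc n"]])
         (auto simp: flat_def eventually_at_filter)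
    then have "(flat n has_vector_derivative 0) (at 0)"
      unfolding has_vector_derivative_iff_quotient .
    then show ?thesis using 3 by (simp add: flat_def)
  qed
qed

lemma Ck_at_flat: "Ck_at k (flat n) t"
proof (induction k arbitrary: n)
  case 0
  have "isCont (flat n) s" for s
    using flat_has_vector_derivative has_vector_derivative_continuous by blast
  then show ?case by (simp add: always_eventually)
next
  case (Suc k)
  have "Ck_at k (\<lambda>s. - real n * flat (n + 1) s + flat (n + 2) s) t"
    by (intro Ck_at_add Ck_at_mult Ck_at_const Suc)
  then show ?case
    by (rule Ck_at_SucI[rotated]) (intro always_eventually allI flat_has_vector_derivative)
qed

text \<open>\<phi> is delivered together with all its derivatives, as a sequence, so that
  differentiation under the integral sign can be repeated by shifting the index.\<close>

lemma bump_function: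
  fixes r :: real
  assumes r: "r > 0"
  obtains \<phi> :: "nat \<Rightarrow> real \<Rightarrow> real"
  where "\<And>k s. (\<phi> k has_vector_derivative \<phi> (Suc k) s) (at s)" "\<And>s. \<bar>s\<bar> \<ge> r \<Longrightarrow> \<phi> 0 s = 0"
    "\<And>s. \<phi> 0 s \<ge> 0" "(\<phi> 0 has_integral 1) {-r..r}"
proof -
  \<comment> \<open>The factors vanish for s \<le> -r and for s \<ge> r respectively.\<close>
  define g where "g s = flat 0 (r + s) * flat 0 (r - s)" for s
  have sm: "smooth_on UNIV (flat 0)" by (rule smooth_onI_Ck_at) (auto intro: Ck_at_flat)
  have lin: "bounded_linear (\<lambda>s. c * s)" for c :: real by (rule bounded_linear_mult_right)
  have aff: "Ck_at k (\<lambda>s. r + c * s) t" for k c t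
    by (intro Ck_at_add Ck_at_const Ck_at_bounded_linear[OF lin] Ck_at_ident)
  have 1: "Ck_at k (\<lambda>s. flat 0 (r + c * s)) t" for k c t
    by (rule Ck_at_smooth_on[OF sm _ aff]) simp
  have gk: "Ck_at k g t" for k t
    using Ck_at_mult[OF 1[of k 1 t] 1[of k "-1" t]] by (simp add: g_def[abs_def])
  have cont: "continuous_on S g" for S
    using eventually_nhds_x_imp_x[OF Ck_at_isCont[OF gk[of 0]]]
    by (simp add: continuous_at_imp_continuous_on)
  define c where "c = integral {-r..r} g"
  have g0: "g s \<ge> 0" for s by (simp add: g_def flat_def)
  have "g 0 > 0" using r by (simp add: g_def flat_def)
  have "c \<noteq> 0"
  proof
    assume "c = 0"
    then have "(g has_integral 0) {-r..r}"
      using integrable_integral[OF integrable_continuous_real[OF cont[of "{-r..r}"]]] unfolding c_def by simp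
    then have "g 0 = 0"
      using has_integral_0_cbox_imp_0[of "-r" r g 0] cont g0 r by simp
    then show False using \<open>g 0 > 0\<close> by simp
  qed
  define \<phi> where "\<phi> k = (\<lambda>s. inverse c * ((\<lambda>g s. vector_derivative g (at s)) ^^ k) g s)" for k
  have Ck: "Ck_at j (((\<lambda>g s. vector_derivative g (at s)) ^^ k) g) t" for j k t
  proof -
    have "Ck_at (j + k) g t \<Longrightarrow> Ck_at j (((\<lambda>g s. vector_derivative g (at s)) ^^ k) g) t" for j
      by (induction k arbitrary: j) (auto, metis add_Suc Ck_at.simps(2))
    then show ?thesis using gk by blast
  qed
  have "c \<ge> 0" unfolding c_def by (rule integral_nonneg) (auto intro: integrable_continuous_real cont g0)
  show thesis
  proof (rule that[of \<phi>])
    show "(\<phi> k has_vector_derivative \<phi> (Suc k) s) (at s)" for k s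
      using bounded_linear.has_vector_derivative[OF bounded_linear_mult_right
          eventually_nhds_x_imp_x[OF Ck_at_SucE(1)[OF Ck[of "Suc 0" k s]]], of "inverse c"]
      by (simp add: \<phi>_def)
    show "\<phi> 0 s = 0" if "\<bar>s\<bar> \<ge> r" for s
      using that r by (auto simp: \<phi>_def g_def flat_def abs_if split: if_splits)
    show "\<phi> 0 s \<ge> 0" for s using g0 \<open>c \<ge> 0\<close> by (simp add: \<phi>_def)
    have "((\<lambda>s. inverse c * g s) has_integral inverse c * c) {-r..r}"
      unfolding c_def by (intro has_integral_mult_right integrable_integral integrable_continuous_real cont)
    then show "(\<phi> 0 has_integral 1) {-r..r}" using \<open>c \<noteq> 0\<close> by (simp add: \<phi>_def)
  qed
qed

text \<open>The parameter t sits in the smooth kernel and not in B, so B need only be continuous.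
  Differentiation replaces \<phi> k by \<phi> (Suc k), up to sign, and the induction on j treats all
  k at once.\<close>

lemma Ck_at_mollified:
  fixes B :: "real \<Rightarrow> 'a::banach"
  assumes \<phi>: "\<And>k s. (\<phi> k has_vector_derivative (\<phi> (Suc k) s :: real)) (at s)"
    and B: "continuous_on {a..b} B"
  shows "Ck_at j (\<lambda>t. integral {a..b} (\<lambda>u. \<phi> k (u - t) *\<^sub>R B u)) t"
proof -
  have \<phi>c: "continuous_on S (\<phi> k)" for k S
    using \<phi> has_vector_derivative_continuous by (blast intro: continuous_at_imp_continuous_on)
  have der: "((\<lambda>t. integral {a..b} (\<lambda>u. \<phi> k (u - t) *\<^sub>R B u)) has_vector_derivative
      - integral {a..b} (\<lambda>u. \<phi> (Suc k) (u - t) *\<^sub>R B u)) (at t)" for k t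
  proof -
    have "((\<lambda>t. integral (cbox a b) (\<lambda>u. \<phi> k (u - t) *\<^sub>R B u)) has_vector_derivative
       integral (cbox a b) (\<lambda>u. - (\<phi> (Suc k) (u - t) *\<^sub>R B u))) (at t within UNIV)"
    proof (rule leibniz_rule_vector_derivative[where U = UNIV])
      fix t u
      have "((\<lambda>t. u - t) has_vector_derivative -1) (at t)"
        by (auto intro!: derivative_eq_intros)
      from vector_diff_chain_at[OF this \<phi>[of k]]
      have "((\<lambda>t. \<phi> k (u - t)) has_vector_derivative - \<phi> (Suc k) (u - t)) (at t)"
        by (simp add: o_def)
      from bounded_linear.has_vector_derivative[OF bounded_linear_scaleR_left this]
      show "((\<lambda>t. \<phi> k (u - t) *\<^sub>R B u) has_vector_derivative - (\<phi> (Suc k) (u - t) *\<^sub>R B u)) (at t within UNIV)"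
        by simp
    next
      fix t
      show "(\<lambda>u. \<phi> k (u - t) *\<^sub>R B u) integrable_on cbox a b"
        unfolding box_real
        by (intro integrable_continuous_real continuous_intros B continuous_on_compose2[OF \<phi>c[of UNIV]]) auto
    next
      show "continuous_on (UNIV \<times> cbox a b) (\<lambda>(t, u). - (\<phi> (Suc k) (u - t) *\<^sub>R B u))"
        unfolding split_beta box_real
        by (intro continuous_intros continuous_on_compose2[OF \<phi>c[of UNIV]] continuous_on_compose2[OF B]) auto
    qed auto
    then show ?thesis by simp
  qed
  show ?thesis
  proof (induction j arbitrary: k)
    case 0
    have "isCont (\<lambda>t. integral {a..b} (\<lambda>u. \<phi> k (u - t) *\<^sub>R B u)) s" for s
      using der has_vector_derivative_continuous by blast
    then show ?case by (simp add: always_eventually)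
  next
    case (Suc j)
    have "Ck_at j (\<lambda>t. - integral {a..b} (\<lambda>u. \<phi> (Suc k) (u - t) *\<^sub>R B u)) t"
      by (rule Ck_at_bounded_linear[OF bounded_linear_minus[OF bounded_linear_ident] Suc])
    then show ?case by (rule Ck_at_SucI[rotated]) (intro always_eventually allI der)
  qed
qed

text \<open>A cocycle differs from its mollification \<open>t \<mapsto> \<integral>\<phi>(s) B(s + t) ds\<close> by the coboundary of
  \<open>v = \<integral>\<phi>(s) B(s) ds\<close>, up to a constant.\<close>

lemma cocycle_cohomologous_smooth:
  fixes B :: "real \<Rightarrow> 'a::banach" and T :: "real \<Rightarrow> 'a \<Rightarrow> 'a"
  assumes \<tau>: "\<tau> > 0" and B: "continuous_on {-\<tau>..\<tau>} B"
    and T: "\<And>s. \<bar>s\<bar> \<le> \<tau> / 2 \<Longrightarrow> bounded_linear (T s)"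
    and coc: "\<And>s t. \<bar>s\<bar> \<le> \<tau> / 2 \<Longrightarrow> \<bar>t\<bar> \<le> \<tau> / 2 \<Longrightarrow> B (s + t) = B s + T s (B t)"
    and M: "\<And>t. \<bar>t\<bar> \<le> \<tau> \<Longrightarrow> norm (B t) \<le> M"
  obtains v b where "norm v \<le> M" "\<And>k. Ck_at k b 0"
    "\<And>t. \<bar>t\<bar> \<le> \<tau> / 4 \<Longrightarrow> B t + T t v - v = b t"
proof -
  \<comment> \<open>Times s in the support of \<phi> 0 and times t with \<bar>t\<bar> \<le> \<tau> /
    4 then both lie in the range \<tau> / 2 of the cocycle law.\<close>
  define r where "r = \<tau> / 4"
  have r: "r > 0" using \<tau> by (simp add: r_def)
  obtain \<phi> :: "nat \<Rightarrow> real \<Rightarrow> real"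
    where \<phi>: "\<And>k s. (\<phi> k has_vector_derivative \<phi> (Suc k) s) (at s)" "\<And>s. \<bar>s\<bar> \<ge> r \<Longrightarrow> \<phi> 0 s = 0"
    "\<And>s. \<phi> 0 s \<ge> 0" "(\<phi> 0 has_integral 1) {-r..r}"
    using bump_function[OF r] by blast
  have \<phi>c: "continuous_on S (\<phi> k)" for k S
    using \<phi>(1) has_vector_derivative_continuous by (blast intro: continuous_at_imp_continuous_on)
  define v where "v = integral {-r..r} (\<lambda>s. \<phi> 0 s *\<^sub>R B s)"
  \<comment> \<open>The shift is moved from B to the kernel by u = s + t, and the interval
    {-\<tau>..\<tau>} is independent of t, as \<open>Ck_at_mollified\<close> requires.\<close>
  define b where "b t = integral {-\<tau>..\<tau>} (\<lambda>u. \<phi> 0 (u - t) *\<^sub>R B u) - v" for t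
  have int: "(\<lambda>s. \<phi> 0 s *\<^sub>R B (s + t)) integrable_on {-r..r}" if "\<bar>t\<bar> \<le> r" for t
    using that r by (intro integrable_continuous_real continuous_intros \<phi>c continuous_on_compose2[OF B])
      (auto simp: r_def)
  show thesis
  proof (rule that[of v b])
    have "norm v \<le> integral {-r..r} (\<lambda>s. \<phi> 0 s * M)"
      unfolding v_def
    proof (rule integral_norm_bound_integral)
      show "(\<lambda>s. \<phi> 0 s *\<^sub>R B s) integrable_on {-r..r}" using int[of 0] r by simp
      show "(\<lambda>s. \<phi> 0 s * M) integrable_on {-r..r}"
        using has_integral_mult_left[OF \<phi>(4)] by blast
      show "norm (\<phi> 0 s *\<^sub>R B s) \<le> \<phi> 0 s * M" if "s \<in> {-r..r}" for s
        using \<phi>(3)[of s] M[of s] that r by (auto simp: r_def intro!: mult_left_mono)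
    qed
    also have "\<dots> = M" using integral_unique[OF has_integral_mult_left[OF \<phi>(4)], of M] by simp
    finally show "norm v \<le> M" .
    show "Ck_at k b 0" for k
      using Ck_at_add[OF Ck_at_mollified[where \<phi> = \<phi> and k = 0, OF \<phi>(1) B] Ck_at_const[of k "- v"]]
      by (simp add: b_def[abs_def])
    fix t assume t: "\<bar>t\<bar> \<le> \<tau> / 4"
    \<comment> \<open>T t passes through the integral; this is where linearity of the action
      enters.\<close>
    have "T t v = integral {-r..r} (T t \<circ> (\<lambda>s. \<phi> 0 s *\<^sub>R B s))"
      unfolding v_def using int[of 0] r t by (subst integral_linear) (auto intro!: T)
    also have "\<dots> = integral {-r..r} (\<lambda>s. \<phi> 0 s *\<^sub>R B (s + t) - \<phi> 0 s *\<^sub>R B t)"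
    proof (rule integral_cong)
      fix s assume s: "s \<in> {-r..r}"
      have "T t (B s) = B (s + t) - B t" using coc[of t s] s t by (auto simp: r_def add.commute)
      then show "(T t \<circ> (\<lambda>s. \<phi> 0 s *\<^sub>R B s)) s = \<phi> 0 s *\<^sub>R B (s + t) - \<phi> 0 s *\<^sub>R B t"
        using linear_scale[OF bounded_linear.linear[OF T[of t]]] t \<tau> by (simp add: scaleR_diff_right)
    qed
    also have "\<dots> = integral {-r..r} (\<lambda>s. \<phi> 0 s *\<^sub>R B (s + t)) - integral {-r..r} (\<lambda>s. \<phi> 0 s *\<^sub>R B t)"
    proof (rule integral_diff)
      show "(\<lambda>s. \<phi> 0 s *\<^sub>R B (s + t)) integrable_on {-r..r}" using int t by (simp add: r_def)
      show "(\<lambda>s. \<phi> 0 s *\<^sub>R B t) integrable_on {-r..r}"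
        by (intro integrable_continuous_real continuous_intros \<phi>c)
    qed
    also have "integral {-r..r} (\<lambda>s. \<phi> 0 s *\<^sub>R B t) = B t"
      using integral_unique[OF has_integral_scaleR_left[OF \<phi>(4), of "B t"]] by simp
    also have "integral {-r..r} (\<lambda>s. \<phi> 0 s *\<^sub>R B (s + t)) = integral {-\<tau>..\<tau>} (\<lambda>u. \<phi> 0 (u - t) *\<^sub>R B u)"
    proof -
      have "((\<lambda>s. \<phi> 0 s *\<^sub>R B (s + t)) has_integral integral {-r..r} (\<lambda>s. \<phi> 0 s *\<^sub>R B (s + t))) (cbox (-r) r)"
        using int[of t] t by (simp add: r_def integrable_integral)
      from has_integral_affinity[OF this, of 1 "-t"]
      have "((\<lambda>u. \<phi> 0 (u - t) *\<^sub>R B u) has_integral integral {-r..r} (\<lambda>s. \<phi> 0 s *\<^sub>R B (s + t))) ((\<lambda>x. x + t) ` {-r..r})"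
        by simp
      then have "((\<lambda>u. \<phi> 0 (u - t) *\<^sub>R B u) has_integral integral {-r..r} (\<lambda>s. \<phi> 0 s *\<^sub>R B (s + t))) {-\<tau>..\<tau>}"
      proof (rule has_integral_on_superset)
        show "\<phi> 0 (u - t) *\<^sub>R B u = 0" if "u \<notin> (\<lambda>x. x + t) ` {-r..r}" for u
        proof -
          have "u - t \<notin> {-r..r}" using that image_eqI[of u "\<lambda>x. x + t" "u - t" "{-r..r}"] by auto
          then show ?thesis using \<phi>(2)[of "u - t"] r by (auto simp: abs_if)
        qed
        show "(\<lambda>x. x + t) ` {-r..r} \<subseteq> {-\<tau>..\<tau>}" using t r by (auto simp: r_def)
      qed
      then show ?thesis by (simp add: integral_unique)
    qed
    finally show "B t + T t v - v = b t" by (simp add: b_def)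
  qed
qed

section \<open>Local Lie groups\<close>

text \<open>Completeness in a form adapted to difference quotients: approximate limits for the
  tolerances 1 / (n + 1) are compared at a common point of the nontrivial filter, hence form a
  Cauchy sequence.\<close>

lemma limit_if_almost_constant:
  fixes f :: "'a \<Rightarrow> 'b::{real_normed_vector, complete_space}"
  assumes F: "F \<noteq> bot" and f: "\<And>e. e > 0 \<Longrightarrow> \<exists>L. \<forall>\<^sub>F t in F. norm (f t - L) \<le> e"
  shows "\<exists>l. (f \<longlongrightarrow> l) F"
proof -
  have "\<exists>L. \<forall>\<^sub>F t in F. norm (f t - L) \<le> inverse (real (Suc n))" for n
    by (rule f) simp
  then obtain L where L: "\<And>n. \<forall>\<^sub>F t in F. norm (f t - L n) \<le> inverse (real (Suc n))" by metis
  have LL: "norm (L m - L n) \<le> inverse (real (Suc m)) + inverse (real (Suc n))" for m n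
  proof -
    have "\<forall>\<^sub>F t in F. norm (L m - L n) \<le> inverse (real (Suc m)) + inverse (real (Suc n))"
      using L[of m] L[of n]
    proof eventually_elim
      case (elim t)
      then show ?case using norm_triangle_ineq4[of "f t - L n" "f t - L m"] by simp
    qed
    then show ?thesis using F by (simp add: eventually_const)
  qed
  have "Cauchy L"
  proof (rule CauchyI)
    fix e :: real assume "e > 0"
    then obtain N where N: "inverse (real (Suc N)) < e / 2" using reals_Archimedean[of "e / 2"] by auto
    have "norm (L m - L n) < e" if "m \<ge> N" "n \<ge> N" for m n
    proof -
      have "inverse (real (Suc m)) \<le> inverse (real (Suc N))" "inverse (real (Suc n)) \<le> inverse (real (Suc N))"
        using that by (auto intro!: le_imp_inverse_le)
      then show ?thesis using LL[of m n] N by linarith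
    qed
    then show "\<exists>M. \<forall>m\<ge>M. \<forall>n\<ge>M. norm (L m - L n) < e" by blast
  qed
  then obtain l where l: "L \<longlonglongrightarrow> l" using Cauchy_convergent_iff convergent_def by blast
  have "(f \<longlongrightarrow> l) F"
  proof (rule tendstoI)
    fix e :: real assume e: "e > 0"
    have "\<forall>\<^sub>F n in sequentially. norm (L n - l) < e / 2"
      using tendstoD[OF l, of "e / 2"] e by (simp add: dist_norm)
    moreover have "\<forall>\<^sub>F n in sequentially. inverse (real (Suc n)) < e / 2"
      using order_tendstoD(2)[OF LIMSEQ_inverse_real_of_nat, of "e / 2"] e by simp
    ultimately have "\<forall>\<^sub>F n in sequentially. norm (L n - l) < e / 2 \<and> inverse (real (Suc n)) < e / 2"
      by (rule eventually_conj)
    then obtain n where n: "norm (L n - l) < e / 2" "inverse (real (Suc n)) < e / 2"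
      by (auto simp: eventually_sequentially)
    show "\<forall>\<^sub>F t in F. dist (f t) l < e"
      using L[of n]
    proof eventually_elim
      case (elim t)
      then show ?case using n norm_triangle_ineq[of "f t - L n" "L n - l"] by (simp add: dist_norm)
    qed
  qed
  then show ?thesis ..
qed

text \<open>Models the multiplication of a Lie group in a chart that puts the unit at 0.\<close>

locale local_group =
  fixes m :: "'a::banach \<times> 'a \<Rightarrow> 'a" and U
  assumes smooth: "smooth_on U m" and zero: "(0, 0) \<in> U"
    and right_unit: "(x, 0) \<in> U \<Longrightarrow> m (x, 0) = x"
    and left_unit: "(0, x) \<in> U \<Longrightarrow> m (0, x) = x"
begin

lemma unit_unit: "m (0, 0) = 0"
  using right_unit zero by blast

text \<open>The unit laws force both partial derivatives of m at the origin to be the identity, so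
  its derivative there is addition; the rest is the strict estimate.\<close>

lemma approx_add:
  obtains r C where "r > 0" "C \<ge> 0" "\<And>x y. norm x < r \<Longrightarrow> norm y < r \<Longrightarrow> (x, y) \<in> U"
    "\<And>\<rho> x y x' y'. \<rho> < r \<Longrightarrow> norm x \<le> \<rho> \<Longrightarrow> norm y \<le> \<rho> \<Longrightarrow> norm x' \<le> \<rho> \<Longrightarrow> norm y' \<le> \<rho> \<Longrightarrow>
       norm (m (x, y) - m (x', y') - ((x - x') + (y - y'))) \<le> C * \<rho> * (norm (x - x') + norm (y - y'))"
proof -
  obtain C r A where r: "r > 0" and C: "C \<ge> 0" and A: "bounded_linear A"
    "(m has_derivative A) (at (0, 0))" and U: "ball (0, 0) r \<subseteq> U" and est:
    "\<And>\<rho> y z. \<rho> < r \<Longrightarrow> norm (y - (0, 0)) \<le> \<rho> \<Longrightarrow> norm (z - (0, 0)) \<le> \<rho> \<Longrightarrow>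
       norm (m y - m z - A (y - z)) \<le> C * \<rho> * norm (y - z)"
    using smooth_on_strict_estimate[OF smooth zero] by metis
  have U': "(x, y) \<in> U" if "norm x < r / 2" "norm y < r / 2" for x y
  proof -
    have "norm ((0, 0) - (x, y)) < r" using that norm_Pair_le[of "-x" "-y"] by simp
    then show ?thesis using U by (auto simp: dist_norm)
  qed
  have A1: "A (h, 0) = h" for h
  proof -
    have "((\<lambda>x. m (x, 0)) has_derivative (\<lambda>h. A (h, 0))) (at 0)"
      by (rule has_derivative_compose[of "\<lambda>x. (x, 0)", OF _ A(2)]) (auto intro!: derivative_eq_intros)
    then have "((\<lambda>x. x) has_derivative (\<lambda>h. A (h, 0))) (at 0)"
      by (rule has_derivative_transform_within_open[OF _ open_ball[of 0 "r / 2"]])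
        (use r U' right_unit in \<open>auto simp: dist_norm\<close>)
    then show ?thesis using has_derivative_unique[OF has_derivative_ident] by metis
  qed
  have A2: "A (0, h) = h" for h
  proof -
    have "((\<lambda>x. m (0, x)) has_derivative (\<lambda>h. A (0, h))) (at 0)"
      by (rule has_derivative_compose[of "\<lambda>x. (0, x)", OF _ A(2)]) (auto intro!: derivative_eq_intros)
    then have "((\<lambda>x. x) has_derivative (\<lambda>h. A (0, h))) (at 0)"
      by (rule has_derivative_transform_within_open[OF _ open_ball[of 0 "r / 2"]])
        (use r U' left_unit in \<open>auto simp: dist_norm\<close>)
    then show ?thesis using has_derivative_unique[OF has_derivative_ident] by metis
  qed
  have AA: "A (x, y) = x + y" for x y
    using linear_add[OF bounded_linear.linear[OF A(1)], of "(x, 0)" "(0, y)"] A1 A2 by simp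
  show thesis
  \<comment> \<open>A pair of vectors of norm at most \<rho> has norm at most 2 * \<rho>, whence the
    halved radius and the doubled constant.\<close>
  proof (rule that[of "r / 2" "2 * C"])
    fix \<rho> and x y x' y' :: 'a
    assume *: "\<rho> < r / 2" "norm x \<le> \<rho>" "norm y \<le> \<rho>" "norm x' \<le> \<rho>" "norm y' \<le> \<rho>"
    have "norm (m (x, y) - m (x', y') - A ((x, y) - (x', y'))) \<le> C * (2 * \<rho>) * norm ((x, y) - (x', y'))"
      using * norm_Pair_le[of x y] norm_Pair_le[of x' y']
      by (intro est) auto
    also have "\<dots> \<le> C * (2 * \<rho>) * (norm (x - x') + norm (y - y'))"
      using C order_trans[OF norm_ge_zero *(2)] norm_Pair_le[of "x - x'" "y - y'"]
      by (intro mult_left_mono) auto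
    finally show "norm (m (x, y) - m (x', y') - ((x - x') + (y - y'))) \<le> 2 * C * \<rho> * (norm (x - x') + norm (y - y'))"
      by (simp add: AA mult_ac)
  qed (use r C U' in auto)
qed

text \<open>For small \<open>h\<close>, the curve \<open>t \<mapsto> \<integral>\<^sub>0\<^sup>h a(t + s) ds\<close> is differentiable at \<open>0\<close>, and by the addition
  law it is close to \<open>h a(t)\<close> up to a constant.\<close>

lemma local_one_parameter_averaging:
  assumes \<epsilon>: "\<epsilon> > 0" and a: "\<And>t. \<bar>t\<bar> < \<epsilon> \<Longrightarrow> isCont a t" and a0: "a 0 = 0"
    and hom: "\<And>s t. \<bar>s\<bar> < \<epsilon> \<Longrightarrow> \<bar>t\<bar> < \<epsilon> \<Longrightarrow> a (s + t) = m (a s, a t)" and \<eta>: "\<eta> > (0::real)"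
  obtains h S where "h > 0" "(S has_vector_derivative a h) (at 0)"
    "\<forall>\<^sub>F t in at 0. norm (S t - S 0 - h *\<^sub>R a t) \<le> h * \<eta> * norm (a t)"
proof -
  obtain r C where r: "r > 0" and C: "C \<ge> 0" and
    U: "\<And>x y. norm x < r \<Longrightarrow> norm y < r \<Longrightarrow> (x, y) \<in> U" and
    est: "\<And>\<rho> x y x' y'. \<rho> < r \<Longrightarrow> norm x \<le> \<rho> \<Longrightarrow> norm y \<le> \<rho> \<Longrightarrow> norm x' \<le> \<rho> \<Longrightarrow> norm y' \<le> \<rho> \<Longrightarrow>
       norm (m (x, y) - m (x', y') - ((x - x') + (y - y'))) \<le> C * \<rho> * (norm (x - x') + norm (y - y'))"
    using approx_add by metis
  \<comment> \<open>Makes the error factor C * \<rho> at most \<eta>; C + 1 avoids division by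
    0.\<close>
  define \<rho> where "\<rho> = min (r / 2) (\<eta> / (C + 1))"
  have \<rho>: "\<rho> > 0" "\<rho> < r" using r \<eta> C by (auto simp: \<rho>_def)
  have "C * \<rho> \<le> C * (\<eta> / (C + 1))" using C by (intro mult_left_mono) (auto simp: \<rho>_def)
  also have "\<dots> \<le> \<eta>" using C \<eta> by (simp add: field_simps)
  finally have C\<rho>: "C * \<rho> \<le> \<eta>" .
  obtain d where d: "d > 0" "\<And>t. \<bar>t\<bar> < d \<Longrightarrow> norm (a t) < \<rho>"
    using a[of 0] \<epsilon> \<rho> a0 unfolding continuous_at_eps_delta by (force simp: dist_norm)
  \<comment> \<open>All times that occur below, including h + t and s + t, then have absolute value
    at most 2 * h, within both d and \<epsilon>.\<close>
  define h where "h = min d \<epsilon> / 4"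
  have h: "h > 0" "4 * h \<le> d" "4 * h \<le> \<epsilon>" using d \<epsilon> by (auto simp: h_def)
  have cont: "continuous_on T a" if "T \<subseteq> {-2*h..2*h}" for T
    using a that h by (intro continuous_at_imp_continuous_on) fastforce
  define J where "J u = integral {-2*h..u} a" for u
  define S where "S t = J (h + t) - J t" for t
  have J: "(J has_vector_derivative a u) (at u)" if "u \<in> {-2*h<..<2*h}" for u
  proof -
    have "(J has_vector_derivative a u) (at u within {-2*h..2*h})"
      unfolding J_def using that by (intro integral_has_vector_derivative cont) auto
    then show ?thesis using at_within_interior[of u "{-2*h..2*h}"] that by simp
  qed
  have S: "(S has_vector_derivative a h) (at 0)"
  proof -
    have 1: "((\<lambda>t. h + t) has_vector_derivative 1) (at 0)" by (auto intro!: derivative_eq_intros)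
    have "((\<lambda>t. J (h + t)) has_vector_derivative a h) (at 0)"
      using vector_diff_chain_at[OF 1, of J "a h"] J[of h] h by (simp add: o_def)
    then show ?thesis unfolding S_def using has_vector_derivative_diff[OF _ J[of 0]] h a0 by fastforce
  qed
  have ev: "norm (S t - S 0 - h *\<^sub>R a t) \<le> h * \<eta> * norm (a t)" if t: "\<bar>t\<bar> < h" for t
  proof -
    have S': "S t = integral {0..h} (\<lambda>s. a (s + t))" if t: "\<bar>t\<bar> < h" for t
    proof -
      have "J t + integral {t..h + t} a = J (h + t)"
        unfolding J_def using t h by (intro Henstock_Kurzweil_Integration.integral_combine integrable_continuous_real cont) auto
      moreover have "integral {t..h + t} a = integral {0..h} (\<lambda>s. a (s + t))"
      proof -
        have "(a has_integral integral {t..h + t} a) (cbox t (h + t))"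
          unfolding box_real using t h by (intro integrable_integral integrable_continuous_real cont) auto
        from has_integral_affinity[OF this, of 1 t]
        have "((\<lambda>s. a (s + t)) has_integral integral {t..h + t} a) {0..h}" by simp
        then show ?thesis by (simp add: integral_unique)
      qed
      ultimately show ?thesis by (simp add: S_def algebra_simps)
    qed
    have int: "(\<lambda>s. a (s + t)) integrable_on {0..h}" if "\<bar>t\<bar> < h" for t
      using that h by (intro integrable_continuous_real continuous_on_compose2[OF cont[OF order_refl]] continuous_intros) auto
    have "S t - S 0 - h *\<^sub>R a t = integral {0..h} (\<lambda>s. a (s + t) - a s - a t)"
      using S'[OF t] S'[of 0] int[OF t] int[of 0] h
      by (simp add: integral_diff integrable_diff integrable_const_ivl)
    also have "norm \<dots> \<le> integral {0..h} (\<lambda>s. \<eta> * norm (a t))"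
    proof (rule integral_norm_bound_integral)
      show "(\<lambda>s. a (s + t) - a s - a t) integrable_on {0..h}"
        using int[OF t] int[of 0] h by (intro integrable_diff integrable_const_ivl) auto
      show "(\<lambda>s. \<eta> * norm (a t)) integrable_on {0..h}" by (rule integrable_const_ivl)
      fix s assume s: "s \<in> {0..h}"
      have n: "norm (a s) < \<rho>" "norm (a t) < \<rho>" using d(2) s t h by auto
      have "a (s + t) = m (a t, a s)" using hom[of t s] s t h by (simp add: add.commute)
      moreover have "m (0, a s) = a s" using U[of 0 "a s"] n \<rho> by (intro left_unit) auto
      \<comment> \<open>Comparing m (a t, a s) with m (0, a s), that is with equal second arguments,
        leaves an error proportional to norm (a t) alone, which can be absorbed after division by
        t.\<close>
      ultimately have "norm (a (s + t) - a s - a t) \<le> C * \<rho> * norm (a t)"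
        using est[of \<rho> "a t" "a s" 0 "a s"] n \<rho> by simp
      also have "\<dots> \<le> \<eta> * norm (a t)" using C\<rho> by (rule mult_right_mono) simp
      finally show "norm (a (s + t) - a s - a t) \<le> \<eta> * norm (a t)" .
    qed
    also have "\<dots> = h * \<eta> * norm (a t)" using h by simp
    finally show ?thesis .
  qed
  show thesis
  proof (rule that[OF h(1) S])
    show "\<forall>\<^sub>F t in at 0. norm (S t - S 0 - h *\<^sub>R a t) \<le> h * \<eta> * norm (a t)"
      using ev h(1) by (auto simp: eventually_at dist_real_def)
  qed
qed

text \<open>Dividing the averaging estimate by h * t puts the quotient a t / t within \<eta> * (1 +
  norm (a t / t)) of the constant a h / h for t near 0. Since h depends on \<eta>, this provides
  approximate limits only, and completeness has to supply the limit.\<close>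

lemma local_one_parameter_differentiable:
  assumes \<epsilon>: "\<epsilon> > 0" and a: "\<And>t. \<bar>t\<bar> < \<epsilon> \<Longrightarrow> isCont a t" and a0: "a 0 = 0"
    and hom: "\<And>s t. \<bar>s\<bar> < \<epsilon> \<Longrightarrow> \<bar>t\<bar> < \<epsilon> \<Longrightarrow> a (s + t) = m (a s, a t)"
  obtains w where "(a has_vector_derivative w) (at 0)"
proof -
  have key: "\<exists>h>0. \<forall>\<^sub>F t in at 0. norm (a h - (h / t) *\<^sub>R a t) \<le> h * \<eta> * (1 + norm (a t /\<^sub>R t))"
    if \<eta>: "\<eta> > 0" for \<eta>
  proof -
    obtain h S where h: "h > 0" and S: "(S has_vector_derivative a h) (at 0)"
      and ev: "\<forall>\<^sub>F t in at 0. norm (S t - S 0 - h *\<^sub>R a t) \<le> h * \<eta> * norm (a t)"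
      by (rule local_one_parameter_averaging[where a = a, OF \<epsilon> _ a0 _ \<eta>]) (rule a hom that | assumption)+
    have "((\<lambda>t. (S t - S 0) /\<^sub>R (t - 0)) \<longlongrightarrow> a h) (at 0)"
      using S by (simp only: has_vector_derivative_iff_quotient)
    then have "\<forall>\<^sub>F t in at 0. norm ((S t - S 0) /\<^sub>R t - a h) < h * \<eta>"
      using tendstoD[of _ "a h" "at 0" "h * \<eta>"] h \<eta> by (simp add: dist_norm)
    moreover have "\<forall>\<^sub>F t in at (0::real). t \<noteq> 0" by (simp add: eventually_at_filter)
    ultimately have "\<forall>\<^sub>F t in at 0. norm (a h - (h / t) *\<^sub>R a t) \<le> h * \<eta> * (1 + norm (a t /\<^sub>R t))"
      using ev
    proof eventually_elim
      case (elim t)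
      have "(S t - S 0) /\<^sub>R t - (h / t) *\<^sub>R a t = (S t - S 0 - h *\<^sub>R a t) /\<^sub>R t"
        by (simp add: scaleR_diff_right divide_inverse mult.commute)
      then have "norm ((S t - S 0) /\<^sub>R t - (h / t) *\<^sub>R a t) = norm (S t - S 0 - h *\<^sub>R a t) / \<bar>t\<bar>"
        by (simp add: divide_inverse_commute)
      also have "\<dots> \<le> (h * \<eta> * norm (a t)) / \<bar>t\<bar>" using elim by (intro divide_right_mono) auto
      also have "\<dots> = h * \<eta> * norm (a t /\<^sub>R t)" by (simp add: divide_inverse_commute)
      finally have "norm ((S t - S 0) /\<^sub>R t - (h / t) *\<^sub>R a t) \<le> h * \<eta> * norm (a t /\<^sub>R t)" .
      moreover have "a h - (h / t) *\<^sub>R a t = ((S t - S 0) /\<^sub>R t - (h / t) *\<^sub>R a t) - ((S t - S 0) /\<^sub>R t - a h)"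
        by simp
      ultimately show ?case
        using elim(1) norm_triangle_ineq4[of "(S t - S 0) /\<^sub>R t - (h / t) *\<^sub>R a t" "(S t - S 0) /\<^sub>R t - a h"]
        by (simp add: algebra_simps)
    qed
    then show ?thesis using h by blast
  qed
  have key': "\<exists>L. \<forall>\<^sub>F t in at 0. norm (a t /\<^sub>R t - L) \<le> \<eta> * (1 + norm (a t /\<^sub>R t))" if "\<eta> > 0" for \<eta>
  proof -
    obtain h where h: "h > 0" "\<forall>\<^sub>F t in at 0. norm (a h - (h / t) *\<^sub>R a t) \<le> h * \<eta> * (1 + norm (a t /\<^sub>R t))"
      using key[OF \<open>\<eta> > 0\<close>] by blast
    have "\<forall>\<^sub>F t in at 0. norm (a t /\<^sub>R t - a h /\<^sub>R h) \<le> \<eta> * (1 + norm (a t /\<^sub>R t))"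
      using h(2)
    proof eventually_elim
      case (elim t)
      have "h *\<^sub>R (a t /\<^sub>R t - a h /\<^sub>R h) = - (a h - (h / t) *\<^sub>R a t)"
        using h by (simp add: scaleR_diff_right divide_inverse)
      then have "h * norm (a t /\<^sub>R t - a h /\<^sub>R h) = norm (a h - (h / t) *\<^sub>R a t)"
        using h(1) norm_scaleR[of h "a t /\<^sub>R t - a h /\<^sub>R h"] by (simp only: norm_minus_cancel abs_of_pos)
      then have "h * norm (a t /\<^sub>R t - a h /\<^sub>R h) \<le> h * (\<eta> * (1 + norm (a t /\<^sub>R t)))"
        using elim by simp
      then show ?case using h by simp
    qed
    then show ?thesis by blast
  qed
  \<comment> \<open>With \<eta> = 1 / 2 the quotient on the right is absorbed on the left, so it is
    bounded near 0; the error for smaller \<eta> then becomes uniformly small.\<close>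
  obtain L where "\<forall>\<^sub>F t in at 0. norm (a t /\<^sub>R t - L) \<le> (1/2) * (1 + norm (a t /\<^sub>R t))"
    using key'[of "1/2"] by auto
  then have bnd: "\<forall>\<^sub>F t in at 0. norm (a t /\<^sub>R t) \<le> 2 * norm L + 1"
  proof eventually_elim
    case (elim t)
    then show ?case using norm_triangle_ineq2[of "a t /\<^sub>R t" L] by simp
  qed
  have "\<exists>w. ((\<lambda>t. a t /\<^sub>R t) \<longlongrightarrow> w) (at 0)"
  proof (rule limit_if_almost_constant)
    fix e :: real assume e: "e > 0"
    define \<eta> where "\<eta> = e / (2 * norm L + 2)"
    have p: "2 * norm L + 2 > 0" using norm_ge_zero[of L] by linarith
    have \<eta>: "\<eta> > 0" unfolding \<eta>_def using e p by simp
    obtain L' where "\<forall>\<^sub>F t in at 0. norm (a t /\<^sub>R t - L') \<le> \<eta> * (1 + norm (a t /\<^sub>R t))"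
      using key'[OF \<eta>] by blast
    then have "\<forall>\<^sub>F t in at 0. norm (a t /\<^sub>R t - L') \<le> e"
      using bnd
    proof eventually_elim
      case (elim t)
      have "\<eta> * (1 + norm (a t /\<^sub>R t)) \<le> \<eta> * (2 * norm L + 2)"
        using elim(2) \<eta> by (intro mult_left_mono) auto
      also have "\<dots> = e" unfolding \<eta>_def using p by simp
      finally show ?case using elim(1) by simp
    qed
    then show "\<exists>L'. \<forall>\<^sub>F t in at 0. norm (a t /\<^sub>R t - L') \<le> e" by blast
  qed simp
  then obtain w where "((\<lambda>t. (a t - a 0) /\<^sub>R (t - 0)) \<longlongrightarrow> w) (at 0)" using a0 by auto
  then show thesis using that has_vector_derivative_iff_quotient by blast
qed

text \<open>The chain rule for s \<mapsto> m (x t, c (s - t)), where c is a small curve through the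
  unit. For a one-parameter group c is the group itself; for exp(b(t)) it depends on t.\<close>

lemma has_vector_derivative_left_translate:
  assumes U: "(x t, 0) \<in> U" and c: "c 0 = 0" "(c has_vector_derivative w) (at 0)"
    and x: "\<forall>\<^sub>F s in nhds t. x s = m (x t, c (s - t))"
  shows "(x has_vector_derivative frechet_derivative m (at (x t, 0)) (0, w)) (at t)"
proof -
  have m: "(m has_derivative frechet_derivative m (at (x t, 0))) (at (x t, 0))"
    using smooth_on_differentiable[OF smooth U] frechet_derivative_works by blast
  have 1: "((\<lambda>s. s - t) has_vector_derivative 1) (at t)" by (auto intro!: derivative_eq_intros)
  have c': "((\<lambda>s. c (s - t)) has_vector_derivative w) (at t)"
    using vector_diff_chain_at[OF 1, of c w] c(2) by (simp add: o_def)
  have "((\<lambda>s. (x t, c (s - t))) has_vector_derivative (0, w)) (at t)"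
    by (intro has_vector_derivative_Pair has_vector_derivative_const c')
  then have "((\<lambda>s. (x t, c (s - t))) has_derivative (\<lambda>h. h *\<^sub>R (0, w))) (at t)"
    by (simp only: has_vector_derivative_def)
  from has_derivative_compose[OF this, of m] m c(1)
  have "((\<lambda>s. m (x t, c (s - t))) has_derivative (\<lambda>h. frechet_derivative m (at (x t, 0)) (h *\<^sub>R (0, w)))) (at t)"
    by simp
  moreover have "frechet_derivative m (at (x t, 0)) (h *\<^sub>R (0, w)) = h *\<^sub>R frechet_derivative m (at (x t, 0)) (0, w)" for h
    by (rule linear_scale[OF has_derivative_linear[OF m]])
  ultimately have d: "((\<lambda>s. m (x t, c (s - t))) has_vector_derivative frechet_derivative m (at (x t, 0)) (0, w)) (at t)"
    by (simp only: has_vector_derivative_def)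
  obtain T where T: "open T" "t \<in> T" "\<And>s. s \<in> T \<Longrightarrow> x s = m (x t, c (s - t))"
    using x unfolding eventually_nhds by blast
  show ?thesis
    by (rule has_vector_derivative_transform_within_open[OF d T(1,2)]) (simp add: T(3))
qed

lemma local_one_parameter_Ck_at:
  assumes \<epsilon>: "\<epsilon> > 0" and a: "\<And>t. \<bar>t\<bar> < \<epsilon> \<Longrightarrow> isCont a t" and a0: "a 0 = 0"
    and hom: "\<And>s t. \<bar>s\<bar> < \<epsilon> \<Longrightarrow> \<bar>t\<bar> < \<epsilon> \<Longrightarrow> a (s + t) = m (a s, a t)"
  shows "Ck_at k a 0"
proof -
  obtain w where w: "(a has_vector_derivative w) (at 0)"
    by (rule local_one_parameter_differentiable[where a = a, OF \<epsilon> _ a0]) (rule a hom that | assumption)+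
  have ev: "\<forall>\<^sub>F t in nhds 0. \<bar>t\<bar> < \<epsilon>"
    using \<epsilon> by (auto simp: eventually_nhds_metric dist_real_def)
  have "((\<lambda>t. (a t, 0 :: 'a)) \<longlongrightarrow> (a 0, 0)) (nhds 0)"
    using a[of 0] \<epsilon> by (intro tendsto_intros) (simp add: continuous_at tendsto_at_iff_tendsto_nhds)
  then have "\<forall>\<^sub>F t in nhds 0. (a t, 0) \<in> U"
    using smooth_on_open[OF smooth] zero a0 by (auto dest: topological_tendstoD)
  then have "\<forall>\<^sub>F t in nhds 0. (a has_vector_derivative frechet_derivative m (at (a t, 0)) (0, w)) (at t)"
    using ev
  proof eventually_elim
    case (elim t)
    have "\<forall>\<^sub>F s in nhds t. \<bar>s - t\<bar> < \<epsilon>"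
      using \<epsilon> by (auto simp: eventually_nhds_metric dist_real_def)
    then have "\<forall>\<^sub>F s in nhds t. a s = m (a t, a (s - t))"
      by (rule eventually_mono) (use hom elim in force)
    then show ?case using elim a0 w by (intro has_vector_derivative_left_translate)
  qed
  then show ?thesis
    by (rule Ck_at_ode[OF smooth, where C = "\<lambda>t. (a t, 0)" and v = "\<lambda>_. (0, w)", rotated])
      (use zero a0 in \<open>auto intro: Ck_at_Pair\<close>)
qed

end

section \<open>The exponential map of an abelian local group\<close>

context local_group
begin

definition sq :: "'a \<Rightarrow> 'a" where "sq x = m (x, x)"

text \<open>The exponential map is obtained as the limit of \<open>v \<mapsto> sq\<^sup>k(v / 2\<^sup>k)\<close>.  The medial law comes
  from commutativity, the other assumptions from \<open>approx_add\<close>.\<close>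

context
  fixes r C :: real
  assumes r: "r > 0" and C: "C \<ge> 0" and U: "\<And>x y. norm x < r \<Longrightarrow> norm y < r \<Longrightarrow> (x, y) \<in> U"
    and est: "\<And>\<rho> x y x' y'. \<rho> < r \<Longrightarrow> norm x \<le> \<rho> \<Longrightarrow> norm y \<le> \<rho> \<Longrightarrow> norm x' \<le> \<rho> \<Longrightarrow> norm y' \<le> \<rho> \<Longrightarrow>
       norm (m (x, y) - m (x', y') - ((x - x') + (y - y'))) \<le> C * \<rho> * (norm (x - x') + norm (y - y'))"
    and medial: "\<And>x y. norm x < r \<Longrightarrow> norm y < r \<Longrightarrow> sq (m (x, y)) = m (sq x, sq y)"
begin

lemma sq_est:
  assumes "\<rho> < r" "norm x \<le> \<rho>" "norm y \<le> \<rho>"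
  shows "norm (sq x - sq y - 2 *\<^sub>R (x - y)) \<le> 2 * C * \<rho> * norm (x - y)"
  using est[of \<rho> x x y y] assms unfolding sq_def by (simp add: scaleR_2)

lemma sq_0: "sq 0 = 0" by (simp add: sq_def unit_unit)

lemma sq_funpow_0: "(sq ^^ k) 0 = 0" by (induction k) (simp_all add: sq_0)

text \<open>Near 0, squaring is doubling up to a relative error proportional to the radius. Along
  the orbit the radii grow geometrically to the order of \<rho>, so these errors add up to a
  multiple of \<rho> that does not depend on k.\<close>

lemma sq_funpow_est:
  assumes "\<rho> < r" "4 * C * \<rho> \<le> 1" "norm x \<le> \<rho> / 2 ^ k" "norm y \<le> \<rho> / 2 ^ k"
  shows "norm ((sq ^^ k) x - (sq ^^ k) y - 2 ^ k *\<^sub>R (x - y)) \<le> 4 * C * \<rho> * (2 ^ k * norm (x - y))"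
  using assms
proof (induction k arbitrary: \<rho> x y)
  case 0
  have "0 \<le> \<rho>" using order_trans[OF norm_ge_zero 0(3)] by simp
  then show ?case using C by simp
next
  case (Suc k)
  have \<rho>: "0 \<le> \<rho>" using order_trans[OF norm_ge_zero Suc.prems(3)] by (simp add: field_simps)
  have C\<rho>: "0 \<le> C * \<rho>" using C \<rho> by simp
  define K where "K = 4 * C * \<rho>"
  have K: "0 \<le> K" "K \<le> 1" using C\<rho> Suc.prems(2) by (auto simp: K_def)
  \<comment> \<open>Since \<rho> / 2 ^ Suc k equals (\<rho> / 2) / 2 ^ k, the hypothesis applies
    with \<rho> / 2 and half the error factor; the last squaring contributes the other half.\<close>
  have ih: "norm ((sq ^^ k) x - (sq ^^ k) y - 2 ^ k *\<^sub>R (x - y)) \<le> K / 2 * (2 ^ k * norm (x - y))"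
    if "norm x \<le> \<rho> / 2 ^ Suc k" "norm y \<le> \<rho> / 2 ^ Suc k" for x y
  proof -
    have "norm ((sq ^^ k) x - (sq ^^ k) y - 2 ^ k *\<^sub>R (x - y)) \<le> 4 * C * (\<rho> / 2) * (2 ^ k * norm (x - y))"
    proof (rule Suc.IH)
      show "\<rho> / 2 < r" using Suc.prems(1) \<rho> by linarith
      show "4 * C * (\<rho> / 2) \<le> 1" using Suc.prems(2) C\<rho> by simp
    qed (use that in simp_all)
    then show ?thesis by (simp add: K_def)
  qed
  have bd: "norm ((sq ^^ k) x) \<le> \<rho>" if x: "norm x \<le> \<rho> / 2 ^ Suc k" for x
  proof -
    have "norm ((sq ^^ k) x - 2 ^ k *\<^sub>R x) \<le> K / 2 * (2 ^ k * norm x)"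
      using ih[OF x, of 0] \<rho> sq_funpow_0 by simp
    also have "\<dots> \<le> 1 * (2 ^ k * norm x)" using K by (intro mult_right_mono) auto
    finally have "norm ((sq ^^ k) x) \<le> 2 * (2 ^ k * norm x)"
      using norm_triangle_ineq2[of "(sq ^^ k) x" "2 ^ k *\<^sub>R x"] by simp
    also have "\<dots> \<le> \<rho>" using x by (simp add: field_simps)
    finally show ?thesis .
  qed
  define a b where "a = (sq ^^ k) x" and "b = (sq ^^ k) y"
  have ab: "norm (a - b - 2 ^ k *\<^sub>R (x - y)) \<le> K / 2 * (2 ^ k * norm (x - y))"
    unfolding a_def b_def by (rule ih) (use Suc.prems in auto)
  also have "\<dots> \<le> 1 * (2 ^ k * norm (x - y))" using K by (intro mult_right_mono) auto
  finally have ab2: "norm (a - b) \<le> 2 * (2 ^ k * norm (x - y))"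
    using norm_triangle_ineq2[of "a - b" "2 ^ k *\<^sub>R (x - y)"] by simp
  have "norm (sq a - sq b - 2 *\<^sub>R (a - b)) \<le> 2 * C * \<rho> * norm (a - b)"
    using bd Suc.prems unfolding a_def b_def by (intro sq_est) auto
  also have "\<dots> \<le> 2 * C * \<rho> * (2 * (2 ^ k * norm (x - y)))"
    using ab2 C\<rho> by (intro mult_left_mono) auto
  finally have 1: "norm (sq a - sq b - 2 *\<^sub>R (a - b)) \<le> K * (2 ^ k * norm (x - y))"
    by (simp add: K_def)
  have 2: "norm (2 *\<^sub>R (a - b - 2 ^ k *\<^sub>R (x - y))) \<le> K * (2 ^ k * norm (x - y))"
    using ab by simp
  have eq: "sq a - sq b - 2 ^ Suc k *\<^sub>R (x - y) =
      (sq a - sq b - 2 *\<^sub>R (a - b)) + 2 *\<^sub>R (a - b - 2 ^ k *\<^sub>R (x - y))"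
    by (simp add: scaleR_diff_right)
  have "norm (sq a - sq b - 2 ^ Suc k *\<^sub>R (x - y))
      \<le> K * (2 ^ k * norm (x - y)) + K * (2 ^ k * norm (x - y))"
    unfolding eq by (rule norm_triangle_le[OF add_mono[OF 1 2]])
  then show ?case by (simp add: a_def b_def K_def mult_ac)
qed

text \<open>All intermediate squares have norm at most 2 * \<rho>, so the medial law applies at each
  of the k steps.\<close>

lemma sq_funpow_medial:
  assumes "2 * \<rho> < r" "4 * C * \<rho> \<le> 1" "norm x \<le> \<rho> / 2 ^ k" "norm y \<le> \<rho> / 2 ^ k"
  shows "(sq ^^ k) (m (x, y)) = m ((sq ^^ k) x, (sq ^^ k) y)"
proof -
  have \<rho>: "0 \<le> \<rho>" using order_trans[OF norm_ge_zero assms(3)] by (simp add: field_simps)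
  have bd: "norm ((sq ^^ j) x) < r" if x: "norm x \<le> \<rho> / 2 ^ k" and j: "j \<le> k" for x j
  proof -
    have "(2::real) ^ j \<le> 2 ^ k" using j by simp
    then have "\<rho> / 2 ^ k \<le> \<rho> / 2 ^ j" using \<rho> by (intro divide_left_mono) auto
    then have xj: "norm x \<le> \<rho> / 2 ^ j" using x by simp
    have "norm ((sq ^^ j) x - 2 ^ j *\<^sub>R x) \<le> 4 * C * \<rho> * (2 ^ j * norm x)"
      using sq_funpow_est[of \<rho> x j 0] assms xj \<rho> sq_funpow_0 by simp
    also have "\<dots> \<le> 1 * (2 ^ j * norm x)" using assms(2) by (intro mult_right_mono) auto
    finally have "norm ((sq ^^ j) x) \<le> 2 * (2 ^ j * norm x)"
      using norm_triangle_ineq2[of "(sq ^^ j) x" "2 ^ j *\<^sub>R x"] by simp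
    also have "\<dots> \<le> 2 * \<rho>" using xj by (simp add: field_simps)
    finally show ?thesis using assms by simp
  qed
  have "(sq ^^ j) (m (x, y)) = m ((sq ^^ j) x, (sq ^^ j) y)" if "j \<le> k" for j
    using that
  proof (induction j)
    case (Suc j)
    then show ?case using medial[of "(sq ^^ j) x" "(sq ^^ j) y"] bd[of x j] bd[of y j] assms by simp
  qed simp
  then show ?thesis by blast
qed

definition expn :: "nat \<Rightarrow> 'a \<Rightarrow> 'a" where "expn k v = (sq ^^ k) (v /\<^sub>R 2 ^ k)"

definition expm :: "'a \<Rightarrow> 'a" where "expm v = lim (\<lambda>k. expn k v)"

lemma expn_est:
  assumes "\<rho> < r" "4 * C * \<rho> \<le> 1" "norm v \<le> \<rho>" "norm w \<le> \<rho>"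
  shows "norm (expn k v - expn k w - (v - w)) \<le> 4 * C * \<rho> * norm (v - w)"
proof -
  have n: "norm (v /\<^sub>R 2 ^ k) \<le> \<rho> / 2 ^ k" if "norm v \<le> \<rho>" for v
    using that by (simp add: field_simps)
  have "2 ^ k *\<^sub>R (v /\<^sub>R 2 ^ k - w /\<^sub>R 2 ^ k) = v - w" by (simp add: scaleR_diff_right)
  moreover have "2 ^ k * norm (v /\<^sub>R 2 ^ k - w /\<^sub>R 2 ^ k) = norm (v - w)"
    by (simp add: scaleR_diff_right[symmetric] del: scaleR_diff_right)
  ultimately show ?thesis
    using sq_funpow_est[OF assms(1,2) n n, OF assms(3,4)] by (simp add: expn_def)
qed

text \<open>For z = v / 2 ^ Suc k, consecutive approximations are \<open>(sq ^^ k) (sq z)\<close>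
  and \<open>(sq ^^ k) (2 *\<^sub>R z)\<close>. The arguments differ by a quadratic term of order
  4^(-k), and k-fold squaring magnifies distances by about 2 ^ k, so the differences are dominated
  by a geometric series.\<close>

lemma expn_tendsto:
  assumes \<rho>: "2 * \<rho> < r" "8 * C * \<rho> \<le> 1" "norm v \<le> \<rho>"
  shows "(\<lambda>k. expn k v) \<longlonglongrightarrow> expm v"
proof -
  have \<rho>0: "0 \<le> \<rho>" using order_trans[OF norm_ge_zero \<rho>(3)] .
  have diff: "norm (expn (Suc k) v - expn k v) \<le> \<rho> * (1 / 2) ^ k" for k
  proof -
    define z where "z = v /\<^sub>R 2 ^ Suc k"
    have z: "norm z \<le> \<rho> / 2 ^ Suc k" using \<rho>(3) by (simp add: z_def field_simps)
    also have "\<dots> \<le> \<rho> / 1" using \<rho>0 by (intro divide_left_mono) (auto simp del: power_Suc)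
    finally have z\<rho>: "norm z \<le> \<rho>" by simp
    \<comment> \<open>\<open>sq_est\<close> is used with the radius norm z instead of \<rho>, which
      makes the bound quadratic in z.\<close>
    have "norm (sq z - sq 0 - 2 *\<^sub>R (z - 0)) \<le> 2 * C * norm z * norm (z - 0)"
      using z\<rho> \<rho> \<rho>0 by (intro sq_est) auto
    then have s: "norm (sq z - 2 *\<^sub>R z) \<le> 2 * C * norm z * norm z" by (simp add: sq_0)
    have "C * norm z \<le> C * \<rho>" using z\<rho> C by (rule mult_left_mono)
    then have "2 * C * norm z * norm z \<le> 1 / 4 * norm z" using \<rho>(2) by (intro mult_right_mono) auto
    then have s': "norm (sq z - 2 *\<^sub>R z) \<le> 1 / 4 * norm z" using s by linarith
    then have "norm (sq z) \<le> 4 * norm z"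
      using norm_triangle_ineq2[of "sq z" "2 *\<^sub>R z"] norm_ge_zero[of z] norm_scaleR[of 2 z] by linarith
    also have "\<dots> \<le> 4 * (\<rho> / 2 ^ Suc k)" using z by (rule mult_left_mono) simp
    finally have sz: "norm (sq z) \<le> 2 * \<rho> / 2 ^ k" by simp
    have vz: "v /\<^sub>R 2 ^ k = 2 *\<^sub>R z" by (simp add: z_def)
    have z2: "norm (2 *\<^sub>R z) \<le> 2 * \<rho> / 2 ^ k" using z \<rho>0 by (simp add: field_simps)
    \<comment> \<open>Both arguments lie in the ball of radius 2 * \<rho> / 2 ^ k; this doubling of
      \<rho> accounts for the 8 in the hypothesis.\<close>
    have "norm ((sq ^^ k) (sq z) - (sq ^^ k) (2 *\<^sub>R z) - 2 ^ k *\<^sub>R (sq z - 2 *\<^sub>R z))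
        \<le> 4 * C * (2 * \<rho>) * (2 ^ k * norm (sq z - 2 *\<^sub>R z))"
      using \<rho> by (intro sq_funpow_est sz z2) auto
    also have "\<dots> \<le> 1 * (2 ^ k * norm (sq z - 2 *\<^sub>R z))"
      using \<rho>(2) by (intro mult_right_mono) auto
    finally have "norm ((sq ^^ k) (sq z) - (sq ^^ k) (2 *\<^sub>R z)) \<le> 2 * (2 ^ k * norm (sq z - 2 *\<^sub>R z))"
      using norm_triangle_ineq2[of "(sq ^^ k) (sq z) - (sq ^^ k) (2 *\<^sub>R z)" "2 ^ k *\<^sub>R (sq z - 2 *\<^sub>R z)"] by simp
    also have "\<dots> \<le> 2 * (2 ^ k * (2 * C * norm z * norm z))" using s by (intro mult_left_mono) auto
    also have "\<dots> \<le> 2 * (2 ^ k * (2 * C * (\<rho> / 2 ^ Suc k) * (\<rho> / 2 ^ Suc k)))"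
      using z C \<rho>0 by (intro mult_left_mono mult_mono) auto
    also have "\<dots> = (C * \<rho>) * (\<rho> * (1 / 2) ^ k)" by (simp add: power_divide field_simps)
    also have "\<dots> \<le> 1 * (\<rho> * (1 / 2) ^ k)" using \<rho>(2) \<rho>0 by (intro mult_right_mono) auto
    finally show ?thesis
      unfolding expn_def vz z_def[symmetric] by (simp add: funpow_Suc_right del: funpow.simps)
  qed
  have "summable (\<lambda>k. expn (Suc k) v - expn k v)"
  proof (rule summable_comparison_test')
    show "summable (\<lambda>k. \<rho> * (1 / 2) ^ k :: real)" by (intro summable_mult summable_geometric) simp
  qed (use diff in blast)
  from summable_LIMSEQ[OF this] have "convergent (\<lambda>n. \<Sum>k<n. expn (Suc k) v - expn k v)"
    by (rule convergentI)
  moreover have "(\<Sum>k<n. expn (Suc k) v - expn k v) = expn n v - expn 0 v" for n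
    by (induction n) auto
  ultimately have "convergent (\<lambda>n. expn n v - expn 0 v)" by simp
  then have "convergent (\<lambda>n. (expn n v - expn 0 v) + expn 0 v)" by (intro convergent_add convergent_const)
  then show ?thesis unfolding expm_def by (simp add: convergent_LIMSEQ_iff)
qed

lemma expm_est:
  assumes "2 * \<rho> < r" "8 * C * \<rho> \<le> 1" "norm v \<le> \<rho>" "norm w \<le> \<rho>"
  shows "norm (expm v - expm w - (v - w)) \<le> 4 * C * \<rho> * norm (v - w)"
proof (rule LIMSEQ_le_const2)
  show "(\<lambda>k. norm (expn k v - expn k w - (v - w))) \<longlonglongrightarrow> norm (expm v - expm w - (v - w))"
    using assms by (intro tendsto_intros expn_tendsto)
  have "0 \<le> \<rho>" using order_trans[OF norm_ge_zero assms(3)] .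
  then have "\<rho> < r" "4 * C * \<rho> \<le> 1" using assms(1,2) C mult_nonneg_nonneg[of C \<rho>] by (linarith, linarith)
  then show "\<exists>N. \<forall>n\<ge>N. norm (expn n v - expn n w - (v - w)) \<le> 4 * C * \<rho> * norm (v - w)"
    using expn_est assms by blast
qed

lemma expm_0: "expm 0 = 0"
  unfolding expm_def expn_def by (simp add: sq_funpow_0)

text \<open>For x = v / 2 ^ k and y = w / 2 ^ k, k-fold squaring sends m (x, y) to the product of
  the approximations, by the medial law, and x + y to the approximation at v + w. As m (x, y) and x
  + y differ by order 4^(-k) and squaring magnifies by about 2 ^ k, the gap vanishes in the
  limit.\<close>

lemma expm_add:
  assumes \<rho>: "4 * \<rho> < r" "16 * C * \<rho> \<le> 1" "norm v \<le> \<rho>" "norm w \<le> \<rho>"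
  shows "expm (v + w) = m (expm v, expm w)"
proof -
  have \<rho>0: "0 \<le> \<rho>" using order_trans[OF norm_ge_zero \<rho>(3)] .
  have C\<rho>: "0 \<le> C * \<rho>" using C \<rho>0 by simp
  have d: "norm (m (expn k v, expn k w) - expn k (v + w)) \<le> \<rho> * (1 / 2) ^ k" for k
  proof -
    define x y t where "x = v /\<^sub>R 2 ^ k" and "y = w /\<^sub>R 2 ^ k" and "t = \<rho> / 2 ^ k"
    have x: "norm x \<le> t" and y: "norm y \<le> t" using \<rho>(3,4) by (simp_all add: x_def y_def t_def field_simps)
    have "t \<le> \<rho> / 1" unfolding t_def using \<rho>0 by (intro divide_left_mono) auto
    then have t: "0 \<le> t" "t \<le> \<rho>" using \<rho>0 by (auto simp: t_def)
    have Ct: "0 \<le> C * t" "C * t \<le> C * \<rho>" using C t by (auto intro: mult_left_mono)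
    have "norm (m (x, y) - m (0, 0) - ((x - 0) + (y - 0))) \<le> C * t * (norm (x - 0) + norm (y - 0))"
      using x y t \<rho> \<rho>0 by (intro est) auto
    then have "norm (m (x, y) - (x + y)) \<le> C * t * (norm x + norm y)" by (simp add: unit_unit)
    also have "\<dots> \<le> C * t * (2 * t)" using x y Ct by (intro mult_left_mono) auto
    finally have q: "norm (m (x, y) - (x + y)) \<le> 2 * (C * t) * t" by simp
    also have "\<dots> \<le> 1 * t" using Ct \<rho>(2) t by (intro mult_right_mono) auto
    finally have "norm (m (x, y)) \<le> 4 * t"
      using norm_triangle_ineq2[of "m (x, y)" "x + y"] norm_triangle_ineq[of x y] x y t by linarith
    \<comment> \<open>The radius 4 * \<rho> here and in the next bound accounts for the constants 4
      and 16 in the hypotheses.\<close>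
    then have n1: "norm (m (x, y)) \<le> 4 * \<rho> / 2 ^ k" by (simp add: t_def)
    have n2: "norm (x + y) \<le> 4 * \<rho> / 2 ^ k"
      using norm_triangle_ineq[of x y] x y t by (simp add: t_def)
    have "norm ((sq ^^ k) (m (x, y)) - (sq ^^ k) (x + y) - 2 ^ k *\<^sub>R (m (x, y) - (x + y)))
        \<le> 4 * C * (4 * \<rho>) * (2 ^ k * norm (m (x, y) - (x + y)))"
      using \<rho> by (intro sq_funpow_est n1 n2) auto
    also have "\<dots> \<le> 1 * (2 ^ k * norm (m (x, y) - (x + y)))"
      using \<rho>(2) by (intro mult_right_mono) auto
    finally have "norm ((sq ^^ k) (m (x, y)) - (sq ^^ k) (x + y)) \<le> 2 * (2 ^ k * norm (m (x, y) - (x + y)))"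
      using norm_triangle_ineq2[of "(sq ^^ k) (m (x, y)) - (sq ^^ k) (x + y)" "2 ^ k *\<^sub>R (m (x, y) - (x + y))"] by simp
    also have "\<dots> \<le> 2 * (2 ^ k * (2 * (C * t) * t))" using q by (intro mult_left_mono) auto
    also have "\<dots> = 4 * (C * t) * \<rho>" by (simp add: t_def)
    also have "\<dots> = (4 * (C * \<rho>)) * (\<rho> * (1 / 2) ^ k)" by (simp add: t_def power_divide)
    also have "\<dots> \<le> 1 * (\<rho> * (1 / 2) ^ k)" using C\<rho> \<rho>(2) \<rho>0 by (intro mult_right_mono) auto
    finally have "norm ((sq ^^ k) (m (x, y)) - (sq ^^ k) (x + y)) \<le> \<rho> * (1 / 2) ^ k" by simp
    moreover have "(sq ^^ k) (m (x, y)) = m (expn k v, expn k w)"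
      unfolding expn_def x_def[symmetric] y_def[symmetric]
      using \<rho> C\<rho> \<rho>0 x y by (intro sq_funpow_medial[of \<rho>]) (auto simp: t_def)
    moreover have "(sq ^^ k) (x + y) = expn k (v + w)"
      by (simp add: expn_def x_def y_def scaleR_add_right)
    ultimately show ?thesis by simp
  qed
  have "(\<lambda>k. \<rho> * (1 / 2) ^ k) \<longlonglongrightarrow> \<rho> * 0"
    by (intro tendsto_intros LIMSEQ_power_zero) simp
  then have "(\<lambda>k. \<rho> * (1 / 2) ^ k) \<longlonglongrightarrow> 0" by simp
  then have "(\<lambda>k. m (expn k v, expn k w) - expn k (v + w)) \<longlonglongrightarrow> 0"
    by (rule Lim_null_comparison[rotated]) (use d in auto)
  moreover have "(\<lambda>k. m (expn k v, expn k w) - expn k (v + w)) \<longlonglongrightarrow> m (expm v, expm w) - expm (v + w)"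
  proof (intro tendsto_diff)
    have small: "norm (expm v) < r" if "norm v \<le> \<rho>" for v
    proof -
      have "norm (expm v - expm 0 - (v - 0)) \<le> 4 * C * \<rho> * norm (v - 0)"
        using \<rho> C\<rho> \<rho>0 that by (intro expm_est) auto
      also have "\<dots> \<le> 1 * norm (v - 0)" using \<rho>(2) C\<rho> by (intro mult_right_mono) auto
      finally have "norm (expm v) \<le> 2 * norm v"
        using norm_triangle_ineq2[of "expm v" v] by (simp add: expm_0)
      then show ?thesis using that \<rho> \<rho>0 by simp
    qed
    then have "(expm v, expm w) \<in> U" using U \<rho> by blast
    then have "isCont m (expm v, expm w)"
      using smooth_on_differentiable[OF smooth] differentiable_imp_continuous_within by blast
    then show "(\<lambda>k. m (expn k v, expn k w)) \<longlonglongrightarrow> m (expm v, expm w)"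
      by (rule isCont_tendsto_compose)
        (use \<rho> C\<rho> \<rho>0 in \<open>auto intro!: tendsto_Pair expn_tendsto[of \<rho>]\<close>)
    show "(\<lambda>k. expn k (v + w)) \<longlonglongrightarrow> expm (v + w)"
      using \<rho> norm_triangle_ineq[of v w] by (intro expn_tendsto[of "2 * \<rho>"]) auto
  qed
  ultimately show ?thesis using LIMSEQ_unique by fastforce
qed

end

end

text \<open>All that is retained of the exponential map: additivity, and closeness to the identity
  at a rate proportional to the radius. The bound K * R \<le> 1 / 4 gives e - id the Lipschitz
  constant 1 / 2 on the ball of radius 2 * R, and 4 * R bounds the norm of e there.\<close>

locale local_exp = local_group +
  fixes e :: "'a \<Rightarrow> 'a" and K R :: real
  assumes R: "R > 0" and K: "K \<ge> 0" "K * R \<le> 1 / 4" and e_0: "e 0 = 0"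
    and e_est: "\<And>\<rho> v w. \<rho> \<le> 2 * R \<Longrightarrow> norm v \<le> \<rho> \<Longrightarrow> norm w \<le> \<rho> \<Longrightarrow>
      norm (e v - e w - (v - w)) \<le> K * \<rho> * norm (v - w)"
    and e_add: "\<And>v w. norm v \<le> R \<Longrightarrow> norm w \<le> R \<Longrightarrow> e (v + w) = m (e v, e w)"
    and ball_U: "\<And>x y. norm x \<le> 4 * R \<Longrightarrow> norm y \<le> 4 * R \<Longrightarrow> (x, y) \<in> U"

lemma (in local_group) local_exp_exists:
  assumes d: "d > 0"
    and medial: "\<And>x y. norm x < d \<Longrightarrow> norm y < d \<Longrightarrow> m (m (x, y), m (x, y)) = m (m (x, x), m (y, y))"
  obtains e K R where "local_exp m U e K R" "R \<le> d"
proof -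
  obtain r0 C where r0: "r0 > 0" and C: "C \<ge> 0" and
    U0: "\<And>x y. norm x < r0 \<Longrightarrow> norm y < r0 \<Longrightarrow> (x, y) \<in> U" and
    est0: "\<And>\<rho> x y x' y'. \<rho> < r0 \<Longrightarrow> norm x \<le> \<rho> \<Longrightarrow> norm y \<le> \<rho> \<Longrightarrow> norm x' \<le> \<rho> \<Longrightarrow> norm y' \<le> \<rho> \<Longrightarrow>
       norm (m (x, y) - m (x', y') - ((x - x') + (y - y'))) \<le> C * \<rho> * (norm (x - x') + norm (y - y'))"
    using approx_add by metis
  define r where "r = min r0 d"
  have r: "r > 0" using r0 d by (simp add: r_def)
  have U: "\<And>x y. norm x < r \<Longrightarrow> norm y < r \<Longrightarrow> (x, y) \<in> U" using U0 by (simp add: r_def)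
  have est: "\<And>\<rho> x y x' y'. \<rho> < r \<Longrightarrow> norm x \<le> \<rho> \<Longrightarrow> norm y \<le> \<rho> \<Longrightarrow> norm x' \<le> \<rho> \<Longrightarrow> norm y' \<le> \<rho> \<Longrightarrow>
       norm (m (x, y) - m (x', y') - ((x - x') + (y - y'))) \<le> C * \<rho> * (norm (x - x') + norm (y - y'))"
    using est0 by (simp add: r_def)
  have med: "\<And>x y. norm x < r \<Longrightarrow> norm y < r \<Longrightarrow> sq (m (x, y)) = m (sq x, sq y)"
    using medial by (simp add: sq_def r_def)
  \<comment> \<open>\<open>expm_est\<close> is used up to the radius 2 * R and
    \<open>expm_add\<close> up to R; both lead to the condition 16 * C * R \<le> 1. The summand 1 in
    the denominator covers C = 0.\<close>
  define R where "R = min (r / 8) (1 / (16 * C + 1))"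
  have R: "R > 0" "8 * R \<le> r" using r C by (auto simp: R_def)
  have "16 * C * R \<le> 16 * C * (1 / (16 * C + 1))" using C by (intro mult_left_mono) (auto simp: R_def)
  also have "\<dots> \<le> 1" using C by simp
  finally have CR: "16 * C * R \<le> 1" .
  have "local_exp m U expm (4 * C) R"
  proof unfold_locales
    show "R > 0" by (fact R)
    show "0 \<le> 4 * C" "4 * C * R \<le> 1 / 4" using C CR by auto
    show "expm 0 = 0" by (rule expm_0) (use r C U est med in blast)+
    show "norm (expm v - expm w - (v - w)) \<le> 4 * C * \<rho> * norm (v - w)"
      if "\<rho> \<le> 2 * R" "norm v \<le> \<rho>" "norm w \<le> \<rho>" for \<rho> v w
    proof (rule expm_est[where r = r])
      show "2 * \<rho> < r" using that R by simp
      have "C * \<rho> \<le> C * (2 * R)" using that C by (intro mult_left_mono) auto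
      then show "8 * C * \<rho> \<le> 1" using CR by linarith
    qed (use r C U est med that in blast)+
    show "expm (v + w) = m (expm v, expm w)" if "norm v \<le> R" "norm w \<le> R" for v w
      by (rule expm_add[where r = r and C = C and \<rho> = R]) (use r C U est med that R CR in \<open>simp; fail | blast\<close>)+
    show "(x, y) \<in> U" if "norm x \<le> 4 * R" "norm y \<le> 4 * R" for x y
      using U R that by simp
  qed
  moreover have "R \<le> d" using R by (simp add: r_def)
  ultimately show thesis using that by blast
qed

context local_exp
begin

lemma e_bound: "norm v \<le> 2 * R \<Longrightarrow> norm (e v) \<le> 2 * norm v"
proof -
  assume v: "norm v \<le> 2 * R"
  have "norm (e v - e 0 - (v - 0)) \<le> K * (2 * R) * norm (v - 0)" using v R by (intro e_est) auto
  also have "\<dots> \<le> 1 * norm (v - 0)" using K by (intro mult_right_mono) auto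
  finally show ?thesis using norm_triangle_ineq2[of "e v" v] by (simp add: e_0)
qed

lemma e_inverse_bound: "norm v \<le> 2 * R \<Longrightarrow> norm w \<le> 2 * R \<Longrightarrow> norm (v - w) \<le> 2 * norm (e v - e w)"
proof -
  assume v: "norm v \<le> 2 * R" "norm w \<le> 2 * R"
  have "norm (e v - e w - (v - w)) \<le> K * (2 * R) * norm (v - w)" using v by (intro e_est) auto
  also have "\<dots> \<le> 1 / 2 * norm (v - w)" using K by (intro mult_right_mono) auto
  finally show ?thesis using norm_triangle_ineq2[of "v - w" "e v - e w"] by (simp add: norm_minus_commute)
qed

text \<open>The equation e v = x is the fixed point equation v = x - (e v - v), and e v - v is
  Lipschitz in v with constant 1 / 2.\<close>

lemma e_surj:
  assumes x: "norm x \<le> R" shows "\<exists>v. norm v \<le> 2 * R \<and> e v = x"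
proof -
  have est: "norm (e v - e w - (v - w)) \<le> 1 / 2 * norm (v - w)" if "norm v \<le> 2 * R" "norm w \<le> 2 * R" for v w
  proof -
    have "norm (e v - e w - (v - w)) \<le> K * (2 * R) * norm (v - w)" using that by (intro e_est) auto
    also have "\<dots> \<le> 1 / 2 * norm (v - w)" using K by (intro mult_right_mono) auto
    finally show ?thesis .
  qed
  have "\<exists>!v\<in>cball 0 (2 * R). x - (e v - v) = v"
  proof (rule Banach_fix[where c = "1/2"])
    show "(\<lambda>v. x - (e v - v)) ` cball 0 (2 * R) \<subseteq> cball 0 (2 * R)"
    proof clarsimp
      fix v :: 'a assume v: "norm v \<le> 2 * R"
      have "norm (e v - v) \<le> R" using est[OF v, of 0] v R by (simp add: e_0)
      then show "norm (x - (e v - v)) \<le> 2 * R" using norm_triangle_ineq4[of x "e v - v"] x by simp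
    qed
    fix v w :: 'a assume "v \<in> cball 0 (2 * R)" "w \<in> cball 0 (2 * R)"
    then have "norm (e v - e w - (v - w)) \<le> 1 / 2 * norm (v - w)" by (intro est) auto
    moreover have "(x - (e v - v)) - (x - (e w - w)) = - (e v - e w - (v - w))" by simp
    ultimately show "dist (x - (e v - v)) (x - (e w - w)) \<le> 1 / 2 * dist v w"
      unfolding dist_norm by (metis norm_minus_cancel)
  qed (use R in \<open>auto simp: complete_eq_closed\<close>)
  then show ?thesis by auto
qed

definition logm :: "'a \<Rightarrow> 'a" where "logm x = (SOME v. norm v \<le> 2 * R \<and> e v = x)"

lemma logm: "norm x \<le> R \<Longrightarrow> norm (logm x) \<le> 2 * R" "norm x \<le> R \<Longrightarrow> e (logm x) = x"
  using someI_ex[OF e_surj] unfolding logm_def by blast+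

lemma logm_bound: "norm x \<le> R \<Longrightarrow> norm (logm x) \<le> 2 * norm x"
  using e_inverse_bound[OF logm(1), of x 0] R logm(2) by (simp add: e_0)

lemma logm_lipschitz: "norm x \<le> R \<Longrightarrow> norm y \<le> R \<Longrightarrow> norm (logm x - logm y) \<le> 2 * norm (x - y)"
  using e_inverse_bound[OF logm(1) logm(1), of x y] logm(2) by simp

text \<open>The error rate K * \<rho> tends to 0 with the radius. Away from 0,
  \<open>Ck_at_e\<close> reduces to this case by additivity.\<close>

lemma e_has_derivative: "(e has_derivative (\<lambda>h. h)) (at 0)"
  unfolding has_derivative_at_alt
proof (intro conjI allI impI)
  fix \<eta> :: real assume \<eta>: "\<eta> > 0"
  define d where "d = min R (\<eta> / (K + 1))"
  have d: "d > 0" using R \<eta> K by (simp add: d_def)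
  have "norm (e y - e 0 - (y - 0)) \<le> \<eta> * norm (y - 0)" if y: "norm (y - 0) < d" for y
  proof -
    have "norm (e y - e 0 - (y - 0)) \<le> K * norm y * norm (y - 0)"
      using y R by (intro e_est) (auto simp: d_def)
    also have "K * norm y \<le> (K + 1) * (\<eta> / (K + 1))" using y K by (intro mult_mono) (auto simp: d_def)
    also have "\<dots> = \<eta>" using K by simp
    finally show ?thesis by (simp add: mult_right_mono)
  qed
  then show "\<exists>d>0. \<forall>y. norm (y - 0) < d \<longrightarrow> norm (e y - e 0 - (y - 0)) \<le> \<eta> * norm (y - 0)"
    using d by blast
qed simp

text \<open>A local homomorphism that is differentiable at the unit is linear in logarithmic coordinates:
  there it is additive, hence equal to \<open>2\<^sup>k\<close> times its value at \<open>v / 2\<^sup>k\<close>.\<close>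

lemma local_hom_e:
  assumes p0: "p 0 = 0" and T: "(p has_derivative T) (at 0)"
    and small: "\<And>x. norm x \<le> d \<Longrightarrow> norm (p x) \<le> R / 2"
    and hom: "\<And>x y. norm x \<le> d \<Longrightarrow> norm y \<le> d \<Longrightarrow> p (m (x, y)) = m (p x, p y)"
    and v: "norm v \<le> R" "2 * norm v \<le> d"
  shows "norm (T v) \<le> R" "p (e v) = e (T v)"
proof -
  define u where "u v = logm (p (e v))" for v
  have sm: "norm (e v) \<le> d" "norm (p (e v)) \<le> R / 2" if "norm v \<le> R" "2 * norm v \<le> d" for v
    using that e_bound[of v] R small by (auto intro: order_trans)
  have u: "norm (u v) \<le> R" "e (u v) = p (e v)" if "norm v \<le> R" "2 * norm v \<le> d" for v
    using sm[OF that] logm_bound[of "p (e v)"] logm(2)[of "p (e v)"] R by (auto simp: u_def)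
  \<comment> \<open>Both sides lie in the ball of radius 2 * R and have the same image under e,
    which is injective there.\<close>
  have dbl: "u v = 2 *\<^sub>R u ((1/2) *\<^sub>R v)" if v: "norm v \<le> R" "2 * norm v \<le> d" for v
  proof -
    define w where "w = (1/2) *\<^sub>R v"
    have "norm w = norm v / 2" by (simp add: w_def)
    then have w: "norm w \<le> R" "2 * norm w \<le> d" using v norm_ge_zero[of v] by linarith+
    have vw: "v = w + w" by (simp add: w_def scaleR_left_distrib[symmetric])
    have "e (u w + u w) = m (e (u w), e (u w))" using u[OF w] by (intro e_add)
    also have "\<dots> = p (m (e w, e w))" using u[OF w] sm[OF w] by (simp add: hom)
    also have "\<dots> = p (e v)" using e_add[OF w(1) w(1)] vw by simp
    finally have "e (u w + u w) = e (u v)" using u[OF v] by simp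
    moreover have "norm (u w + u w) \<le> 2 * R" "norm (u v) \<le> 2 * R"
      using norm_triangle_ineq[of "u w" "u w"] u[OF w] u[OF v] R by auto
    ultimately show ?thesis using e_inverse_bound[of "u w + u w" "u v"] by (simp add: scaleR_2 w_def)
  qed
  have uk: "u v = 2 ^ k *\<^sub>R u ((1/2) ^ k *\<^sub>R v)" for k
  proof (induction k)
    case (Suc k)
    have c: "0 \<le> (1/2 :: real) ^ k" "(1/2 :: real) ^ k \<le> 1" by (simp_all add: power_le_one)
    have "(1/2) ^ k * norm v \<le> 1 * norm v" using c by (intro mult_right_mono) auto
    then have "u ((1/2) ^ k *\<^sub>R v) = 2 *\<^sub>R u ((1/2) *\<^sub>R ((1/2) ^ k *\<^sub>R v))"
      using v by (intro dbl) auto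
    then show ?case using Suc by (simp add: mult.commute)
  qed simp
  have "((\<lambda>t. t *\<^sub>R v) has_vector_derivative v) (at 0)" by (auto intro!: derivative_eq_intros)
  then have 1: "((\<lambda>t. t *\<^sub>R v) has_derivative (\<lambda>h. h *\<^sub>R v)) (at 0)" by (simp add: has_vector_derivative_def)
  have "((\<lambda>t. e (t *\<^sub>R v)) has_derivative (\<lambda>h. h *\<^sub>R v)) (at 0)"
    using has_derivative_compose[OF 1, of e "\<lambda>h. h"] e_has_derivative by simp
  from has_derivative_compose[OF this, of p T] T
  have "((\<lambda>t. p (e (t *\<^sub>R v))) has_derivative (\<lambda>h. h *\<^sub>R T v)) (at 0)"
    using linear_scale[OF has_derivative_linear[OF T]] by (simp add: e_0)
  then have "((\<lambda>t. (p (e (t *\<^sub>R v)) - p (e (0 *\<^sub>R v))) /\<^sub>R (t - 0)) \<longlongrightarrow> T v) (at 0)"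
    by (simp only: has_vector_derivative_def[symmetric] has_vector_derivative_iff_quotient)
  then have q: "((\<lambda>t. p (e (t *\<^sub>R v)) /\<^sub>R t) \<longlongrightarrow> T v) (at 0)" by (simp add: e_0 p0)
  \<comment> \<open>2 ^ k times y k is the difference quotient of t \<mapsto> p (e (t v)) at t = 1 /
    2 ^ k, so it tends to T v.\<close>
  define y where "y k = p (e ((1/2) ^ k *\<^sub>R v))" for k
  have lim: "filterlim (\<lambda>k. (1/2 :: real) ^ k) (at 0) sequentially"
    by (rule filterlim_atI) (auto intro: LIMSEQ_power_zero)
  from filterlim_compose[OF q this] have y: "(\<lambda>k. 2 ^ k *\<^sub>R y k) \<longlonglongrightarrow> T v"
    by (simp add: y_def power_one_over)
  have "(\<lambda>k. (1/2) ^ k *\<^sub>R (2 ^ k *\<^sub>R y k)) \<longlonglongrightarrow> 0 *\<^sub>R T v"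
    by (intro tendsto_scaleR y LIMSEQ_power_zero) simp
  then have y0: "y \<longlonglongrightarrow> 0" by (simp add: power_one_over)
  have "(\<lambda>k. 4 * K * norm (2 ^ k *\<^sub>R y k) * norm (y k)) \<longlonglongrightarrow> 4 * K * norm (T v) * norm (0 :: 'a)"
    by (intro tendsto_intros y y0)
  then have "(\<lambda>k. 4 * K * norm (2 ^ k *\<^sub>R y k) * norm (y k)) \<longlonglongrightarrow> 0" by simp
  \<comment> \<open>Write z = v / 2 ^ k. By doubling, u v is 2 ^ k times u z, and y k = e (u z)
    differs from u z by a quadratic term. The factor 2 ^ k uses up one of its two factors: a
    convergent sequence times the null sequence y remains.\<close>
  then have "(\<lambda>k. 2 ^ k *\<^sub>R y k - u v) \<longlonglongrightarrow> 0"
  proof (rule Lim_null_comparison[rotated], intro always_eventually allI)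
    fix k
    define z where "z = (1/2) ^ k *\<^sub>R v"
    have c: "0 \<le> (1/2 :: real) ^ k" "(1/2 :: real) ^ k \<le> 1" by (simp_all add: power_le_one)
    have "(1/2) ^ k * norm v \<le> 1 * norm v" using c by (intro mult_right_mono) auto
    then have z: "norm z \<le> R" "2 * norm z \<le> d" using v by (auto simp: z_def)
    have yk: "y k = e (u z)" using u[OF z] by (simp add: y_def z_def)
    have "norm (e (u z) - e 0 - (u z - 0)) \<le> K * norm (u z) * norm (u z - 0)"
      using u[OF z] R by (intro e_est) auto
    then have "norm (y k - u z) \<le> K * norm (u z) * norm (u z)" by (simp add: yk e_0)
    also have "\<dots> \<le> K * (2 * norm (y k)) * (2 * norm (y k))"
    proof -
      have "norm (u z) \<le> 2 * norm (y k)"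
        using e_inverse_bound[of "u z" 0] u[OF z] R by (simp add: e_0 yk)
      then show ?thesis using K by (intro mult_mono) auto
    qed
    finally have "2 ^ k * norm (y k - u z) \<le> 2 ^ k * (K * (2 * norm (y k)) * (2 * norm (y k)))"
      by (rule mult_left_mono) simp
    moreover have "2 ^ k *\<^sub>R y k - u v = 2 ^ k *\<^sub>R (y k - u z)" using uk[of k] by (simp add: z_def scaleR_diff_right)
    ultimately show "norm (2 ^ k *\<^sub>R y k - u v) \<le> 4 * K * norm (2 ^ k *\<^sub>R y k) * norm (y k)"
      by (simp add: mult_ac)
  qed
  from tendsto_diff[OF y this] have "(\<lambda>k. u v) \<longlonglongrightarrow> T v" by simp
  then have "u v = T v" by (simp add: LIMSEQ_const_iff)
  then show "norm (T v) \<le> R" "p (e v) = e (T v)" using u[OF v] by auto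
qed

text \<open>By additivity e (b s) is the product of e (b t) and e (b s - b t), and the latter has at
  s = t the velocity of b, as e has derivative the identity at 0. So t \<mapsto> e (b t) solves a
  differential equation with smooth right-hand side, and the bootstrap applies.\<close>

lemma Ck_at_e:
  assumes b: "\<And>k. Ck_at k b 0" and b0: "b 0 = 0"
  shows "Ck_at k (\<lambda>t. e (b t)) 0"
proof -
  have "isCont b 0" using Ck_at_isCont[OF b] by (auto dest: eventually_nhds_x_imp_x)
  then have "(b \<longlongrightarrow> b 0) (nhds 0)" by (simp add: continuous_at tendsto_at_iff_tendsto_nhds)
  then have small: "\<forall>\<^sub>F t in nhds 0. norm (b t) < R / 2"
    using R tendstoD[of b "b 0" "nhds 0" "R / 2"] by (simp add: b0)
  then have "\<forall>\<^sub>F t in nhds 0. \<forall>\<^sub>F s in nhds t. norm (b s) < R / 2" by (simp add: eventually_eventually)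
  then have der: "\<forall>\<^sub>F t in nhds 0. ((\<lambda>t. e (b t)) has_vector_derivative
      frechet_derivative m (at (e (b t), 0)) (0, vector_derivative b (at t))) (at t)"
    using small Ck_at_SucE(1)[OF b]
  proof eventually_elim
    case (elim t)
    define c where "c u = e (b (t + u) - b t)" for u
    show ?case
    proof (rule has_vector_derivative_left_translate[where c = c])
      show "(e (b t), 0) \<in> U" using e_bound[of "b t"] elim(2) R by (intro ball_U) auto
      show "c 0 = 0" by (simp add: c_def e_0)
      have 1: "((\<lambda>u. t + u) has_vector_derivative 1) (at 0)" by (auto intro!: derivative_eq_intros)
      have "((\<lambda>u. b (t + u)) has_vector_derivative vector_derivative b (at t)) (at 0)"
        using vector_diff_chain_at[OF 1, of b "vector_derivative b (at t)"] elim(3) by (simp add: o_def)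
      then have "((\<lambda>u. b (t + u) - b t) has_vector_derivative vector_derivative b (at t)) (at 0)"
        by (auto intro!: derivative_eq_intros)
      then have "((\<lambda>u. b (t + u) - b t) has_derivative (\<lambda>h. h *\<^sub>R vector_derivative b (at t))) (at 0)"
        by (simp add: has_vector_derivative_def)
      from has_derivative_compose[OF this, of e "\<lambda>h. h"] e_has_derivative
      show "(c has_vector_derivative vector_derivative b (at t)) (at 0)"
        by (simp add: has_vector_derivative_def c_def[abs_def])
      show "\<forall>\<^sub>F s in nhds t. e (b s) = m (e (b t), c (s - t))"
        using elim(1)
      proof (rule eventually_mono)
        fix s assume "norm (b s) < R / 2"
        then have "norm (b s - b t) \<le> R" using elim(2) norm_triangle_ineq4[of "b s" "b t"] by simp
        then show "e (b s) = m (e (b t), c (s - t))"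
          using e_add[of "b t" "b s - b t"] elim(2) R by (simp add: c_def)
      qed
    qed
  qed
  show ?thesis
  proof (rule Ck_at_ode[where C = "\<lambda>t. (e (b t), 0)" and v = "\<lambda>t. (0, vector_derivative b (at t))",
        OF smooth _ der])
    show "(e (b 0), 0) \<in> U" using zero by (simp add: b0 e_0)
    show "Ck_at k (\<lambda>t. (e (b t), 0)) 0" if "Ck_at k (\<lambda>t. e (b t)) 0" for k
      using that by (intro Ck_at_Pair) auto
    show "Ck_at k (\<lambda>t. (0, vector_derivative b (at t))) 0" for k
      using Ck_at_SucE(2)[OF b] by (intro Ck_at_Pair) auto
  qed
qed

end

section \<open>Charts\<close>

lemma chart_inv_right:
  assumes "x \<in> snd c ` fst c" shows "snd c (chart_inv c x) = x" "chart_inv c x \<in> fst c"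
  using assms f_inv_into_f inv_into_into by metis+

lemma chart_openin: "banach_manifold M \<Longrightarrow> c \<in> charts M \<Longrightarrow> openin (mtop M) (fst c)"
  and chart_open_image: "banach_manifold M \<Longrightarrow> c \<in> charts M \<Longrightarrow> open (snd c ` fst c)"
  and chart_homeomorphic: "banach_manifold M \<Longrightarrow> c \<in> charts M \<Longrightarrow>
    homeomorphic_map (subtopology (mtop M) (fst c)) (top_of_set (snd c ` fst c)) (snd c)"
  by (auto simp: banach_manifold_def)

lemma chart_inj: "banach_manifold M \<Longrightarrow> c \<in> charts M \<Longrightarrow> inj_on (snd c) (fst c)"
  using homeomorphic_imp_injective_map[OF chart_homeomorphic] chart_openin[THEN openin_subset]
  by (metis topspace_subtopology_subset)

lemma chart_subset: "banach_manifold M \<Longrightarrow> c \<in> charts M \<Longrightarrow> fst c \<subseteq> topspace (mtop M)"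
  by (simp add: chart_openin openin_subset)

lemma chart_exists:
  assumes "banach_manifold M" "p \<in> topspace (mtop M)"
  obtains c where "c \<in> charts M" "p \<in> fst c"
  using assms unfolding banach_manifold_def by blast

lemma chart_tendsto:
  assumes M: "banach_manifold M" and c: "c \<in> charts M" and p: "p \<in> fst c"
    and \<gamma>: "limitin (mtop M) \<gamma> p F"
  shows "((\<lambda>t. snd c (\<gamma> t)) \<longlongrightarrow> snd c p) F"
proof (rule topological_tendstoI)
  fix V assume V: "open V" "snd c p \<in> V"
  have "continuous_map (subtopology (mtop M) (fst c)) (top_of_set (snd c ` fst c)) (snd c)"
    by (rule homeomorphic_imp_continuous_map[OF chart_homeomorphic[OF M c]])
  then have "continuous_map (subtopology (mtop M) (fst c)) euclidean (snd c)"
    by (simp add: continuous_map_in_subtopology)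
  then have "openin (subtopology (mtop M) (fst c)) {q \<in> topspace (subtopology (mtop M) (fst c)). snd c q \<in> V}"
    using V by (intro openin_continuous_map_preimage) auto
  then have "openin (mtop M) {q \<in> topspace (subtopology (mtop M) (fst c)). snd c q \<in> V}"
    using chart_openin[OF M c] openin_trans_full by blast
  moreover have "p \<in> {q \<in> topspace (subtopology (mtop M) (fst c)). snd c q \<in> V}"
    using p V chart_subset[OF M c] by auto
  ultimately have "\<forall>\<^sub>F t in F. \<gamma> t \<in> {q \<in> topspace (subtopology (mtop M) (fst c)). snd c q \<in> V}"
    using limitinD[OF \<gamma>] by blast
  then show "\<forall>\<^sub>F t in F. snd c (\<gamma> t) \<in> V" by (rule eventually_mono) simp
qed

lemma chart_inv_limitin:
  assumes M: "banach_manifold M" and c: "c \<in> charts M" and x: "x \<in> snd c ` fst c"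
  shows "limitin (mtop M) (chart_inv c) (chart_inv c x) (nhds x)"
  unfolding limitin_def
proof (intro conjI allI impI)
  show "chart_inv c x \<in> topspace (mtop M)"
    using chart_inv_right(2)[OF x] chart_subset[OF M c] by blast
  fix W assume W: "openin (mtop M) W \<and> chart_inv c x \<in> W"
  have "openin (subtopology (mtop M) (fst c)) (fst c \<inter> W)"
    using W by (simp add: openin_subtopology_Int2)
  then have "openin (top_of_set (snd c ` fst c)) (snd c ` (fst c \<inter> W))"
    using homeomorphic_imp_open_map[OF chart_homeomorphic[OF M c]] by (simp add: open_map_def)
  then have "open (snd c ` (fst c \<inter> W))" using chart_open_image[OF M c] openin_open_trans by blast
  moreover have "x \<in> snd c ` (fst c \<inter> W)"
    using chart_inv_right[OF x] W by (metis IntI image_eqI)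
  ultimately have "\<forall>\<^sub>F y in nhds x. y \<in> snd c ` (fst c \<inter> W)" by (simp add: eventually_nhds_in_open)
  then show "\<forall>\<^sub>F y in nhds x. chart_inv c y \<in> W"
    by (rule eventually_mono) (use chart_inj[OF M c] in auto)
qed

lemma smooth_map_id: "banach_manifold M \<Longrightarrow> smooth_map M M (\<lambda>x. x)"
  unfolding smooth_map_def banach_manifold_def by (auto simp: o_def vimage_def)

lemma smooth_map_limitin:
  "smooth_map M M' f \<Longrightarrow> limitin (mtop M) \<gamma> p F \<Longrightarrow> limitin (mtop M') (\<lambda>t. f (\<gamma> t)) (f p) F"
  using continuous_map_limit[of "mtop M" "mtop M'" f \<gamma> p F] by (simp add: smooth_map_def o_def)

lemma smooth_map_differentiable:
  assumes "smooth_map M M' f" "c \<in> charts M" "d \<in> charts M'" "p \<in> fst c" "f p \<in> fst d"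
  shows "(snd d \<circ> f \<circ> chart_inv c) differentiable (at (snd c p))"
  using assms unfolding smooth_map_def by (intro smooth_on_differentiable) auto

lemma smooth_map_has_derivative:
  assumes "smooth_map M M' f" "c \<in> charts M" "d \<in> charts M'" "p \<in> fst c" "f p \<in> fst d"
  shows "((snd d \<circ> f \<circ> chart_inv c) has_derivative
    frechet_derivative (snd d \<circ> f \<circ> chart_inv c) (at (snd c p))) (at (snd c p))"
  using smooth_map_differentiable[OF assms] by (simp add: frechet_derivative_works)

text \<open>Relative to S because of curves on [0,1]. The parameter of \<gamma> may also run through
  a model space, as it does for left translates of an inverse chart.\<close>

lemma chart_chain:
  assumes t: "t \<in> S" and c: "inj_on (snd c) (fst c)" and \<gamma>: "\<forall>\<^sub>F u in at t within S. \<gamma> u \<in> fst c" "\<gamma> t \<in> fst c"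
    and A: "((snd c \<circ> \<gamma>) has_derivative A) (at t within S)"
    and B: "((h \<circ> chart_inv c) has_derivative B) (at (snd c (\<gamma> t)))"
  shows "((h \<circ> \<gamma>) has_derivative (\<lambda>v. B (A v))) (at t within S)"
proof -
  have "((\<lambda>u. (h \<circ> chart_inv c) ((snd c \<circ> \<gamma>) u)) has_derivative (\<lambda>v. B (A v))) (at t within S)"
    by (rule has_derivative_compose[OF A]) (use B in \<open>simp add: o_def\<close>)
  moreover have "\<forall>\<^sub>F u in at t within S. (h \<circ> chart_inv c) ((snd c \<circ> \<gamma>) u) = (h \<circ> \<gamma>) u"
    using \<gamma>(1) by (rule eventually_mono) (use c in simp)
  ultimately show ?thesis
    by (rule has_derivative_transform_eventually) (use c \<gamma>(2) t in auto)
qed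

lemma chart_chain_vector:
  assumes t: "t \<in> S" and c: "inj_on (snd c) (fst c)" and \<gamma>: "\<forall>\<^sub>F u in at t within S. \<gamma> u \<in> fst c" "\<gamma> t \<in> fst c"
    and A: "((snd c \<circ> \<gamma>) has_vector_derivative v) (at t within S)"
    and B: "((h \<circ> chart_inv c) has_derivative B) (at (snd c (\<gamma> t)))"
  shows "((h \<circ> \<gamma>) has_vector_derivative B v) (at t within S)"
  using chart_chain[OF t c \<gamma> A[unfolded has_vector_derivative_def] B]
    linear_scale[OF has_derivative_linear[OF B]]
  by (simp add: has_vector_derivative_def)

lemma Ck_at_smooth_map:
  assumes f: "smooth_map M M' f" and cM: "inj_on (snd c) (fst c)" "c \<in> charts M" and d: "d \<in> charts M'"
    and \<gamma>: "\<forall>\<^sub>F u in nhds t. \<gamma> u \<in> fst c" and ft: "f (\<gamma> t) \<in> fst d"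
    and Ck: "Ck_at k (\<lambda>u. snd c (\<gamma> u)) t"
  shows "Ck_at k (\<lambda>u. snd d (f (\<gamma> u))) t"
proof -
  have t: "\<gamma> t \<in> fst c" using eventually_nhds_x_imp_x[OF \<gamma>] .
  have "smooth_on (snd c ` (fst c \<inter> f -` fst d)) (snd d \<circ> f \<circ> chart_inv c)"
    using f cM d by (simp add: smooth_map_def)
  then have "Ck_at k (\<lambda>u. (snd d \<circ> f \<circ> chart_inv c) (snd c (\<gamma> u))) t"
    by (rule Ck_at_smooth_on) (use t ft Ck in auto)
  with _ show ?thesis
  proof (rule Ck_at_cong_imp)
    show "\<forall>\<^sub>F u in nhds t. (snd d \<circ> f \<circ> chart_inv c) (snd c (\<gamma> u)) = snd d (f (\<gamma> u))"
      using \<gamma> by (rule eventually_mono) (use cM in simp)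
  qed
qed

section \<open>Product charts\<close>

definition prod_chart :: "('m, 'e) chart \<Rightarrow> ('n, 'f) chart \<Rightarrow> ('m \<times> 'n, 'e \<times> 'f) chart" where
  "prod_chart c d = (fst c \<times> fst d, map_prod (snd c) (snd d))"

lemma fst_prod_chart: "fst (prod_chart c d) = fst c \<times> fst d"
  and snd_prod_chart: "snd (prod_chart c d) (p, q) = (snd c p, snd d q)"
  by (simp_all add: prod_chart_def)

lemma charts_prod_manifold: "charts (prod_manifold M M') = {prod_chart c d |c d. c \<in> charts M \<and> d \<in> charts M'}"
  by (simp add: prod_manifold_def prod_chart_def)

lemma mtop_prod_manifold: "mtop (prod_manifold M M') = prod_topology (mtop M) (mtop M')"
  by (simp add: prod_manifold_def)

lemma inj_on_prod_chart:
  "inj_on (snd c) (fst c) \<Longrightarrow> inj_on (snd d) (fst d) \<Longrightarrow>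
   inj_on (snd (prod_chart c d)) (fst (prod_chart c d))"
  by (simp add: prod_chart_def map_prod_inj_on)

lemma chart_inv_prod_chart:
  assumes "inj_on (snd c) (fst c)" "inj_on (snd d) (fst d)" "x \<in> snd c ` fst c" "y \<in> snd d ` fst d"
  shows "chart_inv (prod_chart c d) (x, y) = (chart_inv c x, chart_inv d y)"
proof -
  have "snd (prod_chart c d) (chart_inv c x, chart_inv d y) = (x, y)"
    "(chart_inv c x, chart_inv d y) \<in> fst (prod_chart c d)"
    using chart_inv_right[OF assms(3)] chart_inv_right[OF assms(4)]
    by (simp_all add: snd_prod_chart fst_prod_chart)
  then show ?thesis using inv_into_f_eq[OF inj_on_prod_chart[OF assms(1,2)]] by blast
qed

text \<open>In a product chart, freezing the first argument is composition with the affine map y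
  \<mapsto> (snd c0 p, y).\<close>

lemma smooth_map_Pair_left:
  assumes f: "smooth_map (prod_manifold M M') M'' (\<lambda>(x, y). f x y)"
    and M: "banach_manifold M" and M': "banach_manifold M'" and p: "p \<in> topspace (mtop M)"
  shows "smooth_map M' M'' (f p)"
  unfolding smooth_map_def
proof (intro conjI ballI)
  have "continuous_map (mtop M') (mtop M'') ((\<lambda>(x, y). f x y) \<circ> (\<lambda>y. (p, y)))"
    using f p unfolding smooth_map_def mtop_prod_manifold
    by (intro continuous_map_compose[where X' = "prod_topology (mtop M) (mtop M')"]) (auto simp: continuous_map_pairwise o_def)
  then show "continuous_map (mtop M') (mtop M'') (f p)" by (simp add: o_def)
  fix c d assume c: "c \<in> charts M'" and d: "d \<in> charts M''"
  obtain c0 where c0: "c0 \<in> charts M" "p \<in> fst c0" using chart_exists[OF M p] .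
  let ?E = "prod_chart c0 c"
  let ?V = "snd ?E ` (fst ?E \<inter> (\<lambda>(x, y). f x y) -` fst d)"
  have "smooth_on ?V (snd d \<circ> (\<lambda>(x, y). f x y) \<circ> chart_inv ?E)"
    using f c d c0 unfolding smooth_map_def charts_prod_manifold by blast
  from smooth_on_affine[OF this bounded_linear_Pair[OF bounded_linear_zero bounded_linear_ident], of "(snd c0 p, 0)" 0]
  have "smooth_on {y. (snd c0 p, y) \<in> ?V} (\<lambda>y. (snd d \<circ> (\<lambda>(x, y). f x y) \<circ> chart_inv ?E) (snd c0 p, y))"
    by simp
  then show "smooth_on (snd c ` (fst c \<inter> f p -` fst d)) (snd d \<circ> f p \<circ> chart_inv c)"
  proof (rule smooth_on_cong)
    show "{y. (snd c0 p, y) \<in> ?V} = snd c ` (fst c \<inter> f p -` fst d)"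
    proof (intro equalityI subsetI)
      fix y assume "y \<in> {y. (snd c0 p, y) \<in> ?V}"
      then obtain p' q where "p' \<in> fst c0" "q \<in> fst c" "f p' q \<in> fst d" "snd c0 p = snd c0 p'" "y = snd c q"
        by (auto simp: prod_chart_def)
      then show "y \<in> snd c ` (fst c \<inter> f p -` fst d)"
        using inj_onD[OF chart_inj[OF M c0(1)], of p p'] c0(2) by auto
    next
      fix y assume "y \<in> snd c ` (fst c \<inter> f p -` fst d)"
      then obtain q where q: "q \<in> fst c" "f p q \<in> fst d" "y = snd c q" by auto
      then have "(p, q) \<in> fst ?E \<inter> (\<lambda>(x, y). f x y) -` fst d" "snd ?E (p, q) = (snd c0 p, y)"
        using c0 by (auto simp: prod_chart_def)
      then show "y \<in> {y. (snd c0 p, y) \<in> ?V}" by (metis image_eqI mem_Collect_eq)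
    qed
    fix y assume "y \<in> {y. (snd c0 p, y) \<in> ?V}"
    then have "y \<in> snd c ` fst c" by (auto simp: prod_chart_def)
    then show "(snd d \<circ> (\<lambda>(x, y). f x y) \<circ> chart_inv ?E) (snd c0 p, y) = (snd d \<circ> f p \<circ> chart_inv c) y"
      using chart_inv_prod_chart[OF chart_inj[OF M c0(1)] chart_inj[OF M' c], of "snd c0 p" y] c0
        chart_inj[OF M c0(1)] by simp
  qed
qed

section \<open>Banach--Lie groups in a chart around the unit\<close>

lemma banach_lie_group_left_mult:
  assumes "banach_lie_group L M" "p \<in> carrier L"
  shows "smooth_map M M (\<lambda>y. p \<otimes>\<^bsub>L\<^esub> y)"
  using assms unfolding banach_lie_group_def by (intro smooth_map_Pair_left[of M M M]) auto

locale banach_lie_chart = group L for L :: "('l, 'x) monoid_scheme" (structure) +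
  fixes M :: "('l, 'e::banach) manifold" and c
  assumes lie: "banach_lie_group L M" and c: "c \<in> charts M" and one_c: "\<one> \<in> fst c"
begin

lemma manifold: "banach_manifold M" and topspace: "topspace (mtop M) = carrier L"
  and smooth_mult: "smooth_map (prod_manifold M M) M (\<lambda>(x, y). x \<otimes> y)"
  and smooth_inv: "smooth_map M M (\<lambda>x. inv x)"
  using lie by (auto simp: banach_lie_group_def)

lemma c_carrier: "p \<in> fst c \<Longrightarrow> p \<in> carrier L"
  using chart_subset[OF manifold c] topspace by blast

definition coord :: "'l \<Rightarrow> 'e" where "coord p = snd c p - snd c \<one>"

definition point :: "'e \<Rightarrow> 'l" where "point x = chart_inv c (x + snd c \<one>)"

definition mul :: "'e \<times> 'e \<Rightarrow> 'e" where "mul = (\<lambda>(x, y). coord (point x \<otimes> point y))"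

definition dom :: "('e \<times> 'e) set" where
  "dom = {(coord p, coord q) |p q. p \<in> fst c \<and> q \<in> fst c \<and> p \<otimes> q \<in> fst c}"

lemma point_coord: "p \<in> fst c \<Longrightarrow> point (coord p) = p"
  using chart_inj[OF manifold c] by (simp add: point_def coord_def)

lemma coord_one: "coord \<one> = 0" by (simp add: coord_def)

lemma point_0: "point 0 = \<one>" using point_coord[OF one_c] by (simp add: coord_one)

lemma mul_coord: "p \<in> fst c \<Longrightarrow> q \<in> fst c \<Longrightarrow> mul (coord p, coord q) = coord (p \<otimes> q)"
  by (simp add: mul_def point_coord)

lemma domE:
  assumes "(x, y) \<in> dom"
  shows "point x \<in> fst c" "point y \<in> fst c" "point x \<otimes> point y \<in> fst c"
    "point (mul (x, y)) = point x \<otimes> point y" "coord (point x \<otimes> point y) = mul (x, y)"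
    "coord (point x) = x"
  using assms by (auto simp: dom_def point_coord mul_coord)

lemma smooth_mul: "smooth_on dom mul"
proof -
  let ?E = "prod_chart c c"
  let ?e = "snd c \<one>"
  let ?V = "snd ?E ` (fst ?E \<inter> (\<lambda>(x, y). x \<otimes> y) -` fst c)"
  have "?E \<in> charts (prod_manifold M M)" using c unfolding charts_prod_manifold by blast
  then have "smooth_on ?V (snd c \<circ> (\<lambda>(x, y). x \<otimes> y) \<circ> chart_inv ?E)"
    using smooth_mult c unfolding smooth_map_def by blast
  from smooth_on_affine[OF this bounded_linear_ident, of "(?e, ?e)" ?e]
  have "smooth_on {z. z + (?e, ?e) \<in> ?V} (\<lambda>z. (snd c \<circ> (\<lambda>(x, y). x \<otimes> y) \<circ> chart_inv ?E) (z + (?e, ?e)) - ?e)" .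
  then show ?thesis
  proof (rule smooth_on_cong)
    show eq: "{z. z + (?e, ?e) \<in> ?V} = dom"
    proof (intro equalityI subsetI)
      fix z assume "z \<in> {z. z + (?e, ?e) \<in> ?V}"
      then obtain p q where pq: "p \<in> fst c" "q \<in> fst c" "p \<otimes> q \<in> fst c" "z + (?e, ?e) = (snd c p, snd c q)"
        by (auto simp: prod_chart_def)
      then have "z = (snd c p, snd c q) - (?e, ?e)" by (metis add_diff_cancel)
      then have "z = (coord p, coord q)" by (simp add: coord_def)
      then show "z \<in> dom" using pq unfolding dom_def by blast
    next
      fix z assume "z \<in> dom"
      then obtain p q where pq: "p \<in> fst c" "q \<in> fst c" "p \<otimes> q \<in> fst c" "z = (coord p, coord q)"
        by (auto simp: dom_def)
      then have "z + (?e, ?e) = snd ?E (p, q)" "(p, q) \<in> fst ?E \<inter> (\<lambda>(x, y). x \<otimes> y) -` fst c"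
        by (auto simp: coord_def prod_chart_def)
      then show "z \<in> {z. z + (?e, ?e) \<in> ?V}" by auto
    qed
    fix z assume "z \<in> {z. z + (?e, ?e) \<in> ?V}"
    then have "z \<in> dom" using eq by blast
    then obtain p q where pq: "p \<in> fst c" "q \<in> fst c" "p \<otimes> q \<in> fst c" "z = (coord p, coord q)"
      by (auto simp: dom_def)
    have "chart_inv ?E (snd c p, snd c q) = (p, q)"
      using pq chart_inv_prod_chart[OF chart_inj[OF manifold c] chart_inj[OF manifold c], of "snd c p" "snd c q"]
        chart_inj[OF manifold c] by simp
    then show "(snd c \<circ> (\<lambda>(x, y). x \<otimes> y) \<circ> chart_inv ?E) (z + (?e, ?e)) - ?e = mul z"
      using pq by (simp add: mul_coord) (simp add: coord_def)
  qed
qed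

sublocale local_group mul dom
proof
  show "smooth_on dom mul" by (rule smooth_mul)
  show "(0, 0) \<in> dom" unfolding dom_def using one_c coord_one by force
  show "mul (x, 0) = x" if "(x, 0) \<in> dom" for x
    using domE[OF that] c_carrier by (simp add: point_0)
  show "mul (0, x) = x" if "(0, x) \<in> dom" for x
    using that mul_coord[OF one_c] coord_one c_carrier unfolding dom_def
    by (auto simp: mul_def point_0 point_coord)
qed

lemma coord_tendsto: "limitin (mtop M) \<gamma> p F \<Longrightarrow> p \<in> fst c \<Longrightarrow> ((\<lambda>t. coord (\<gamma> t)) \<longlongrightarrow> coord p) F"
  unfolding coord_def by (intro tendsto_intros chart_tendsto[OF manifold c])

lemma eventually_c: "limitin (mtop M) \<gamma> p F \<Longrightarrow> p \<in> fst c \<Longrightarrow> \<forall>\<^sub>F t in F. \<gamma> t \<in> fst c"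
  using chart_openin[OF manifold c] limitinD by fastforce

lemma smooth_map_left_mult: "p \<in> carrier L \<Longrightarrow> smooth_map M M (\<lambda>y. p \<otimes> y)"
  by (rule banach_lie_group_left_mult[OF lie])

lemma Ck_at_coord_iff: "Ck_at k (\<lambda>u. snd c (\<gamma> u)) t \<longleftrightarrow> Ck_at k (\<lambda>u. coord (\<gamma> u)) t"
proof
  assume "Ck_at k (\<lambda>u. snd c (\<gamma> u)) t"
  from Ck_at_add[OF this Ck_at_const[of k "- snd c \<one>"]]
  show "Ck_at k (\<lambda>u. coord (\<gamma> u)) t" by (simp add: coord_def)
next
  assume "Ck_at k (\<lambda>u. coord (\<gamma> u)) t"
  from Ck_at_add[OF this Ck_at_const[of k "snd c \<one>"]]
  show "Ck_at k (\<lambda>u. snd c (\<gamma> u)) t" by (simp add: coord_def)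
qed

text \<open>Carries regularity from time 0 to time t. For a one-parameter subgroup, \<gamma> is the
  subgroup itself; for a cocycle it is the image of the cocycle under a fixed automorphism.\<close>

lemma Ck_at_left_translate:
  assumes p: "p \<in> carrier L" and \<gamma>: "\<forall>\<^sub>F u in nhds 0. \<gamma> u \<in> fst c" "Ck_at k (\<lambda>u. snd c (\<gamma> u)) 0"
    and d: "d \<in> charts M" "\<alpha> t \<in> fst d" and \<alpha>: "\<And>u. \<alpha> (t + u) = p \<otimes> \<gamma> u"
  shows "Ck_at k (\<lambda>s. snd d (\<alpha> s)) t"
proof -
  have "Ck_at k (\<lambda>u. snd d (p \<otimes> \<gamma> u)) 0"
    using \<alpha>[of 0] d by (intro Ck_at_smooth_map[OF smooth_map_left_mult[OF p] chart_inj[OF manifold c] c d(1) \<gamma>(1) _ \<gamma>(2)]) simp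
  then have "Ck_at k (\<lambda>s. snd d (p \<otimes> \<gamma> (s - t))) t"
    using Ck_at_shift[of k "\<lambda>u. snd d (p \<otimes> \<gamma> u)" t t] by simp
  then show ?thesis using \<alpha>[of "_ - t"] by simp
qed

lemma continuous_hom_Ck_at_0:
  assumes \<alpha>: "\<And>s t. \<alpha> (s + t) = \<alpha> s \<otimes> \<alpha> t" "continuous_map euclideanreal (mtop M) \<alpha>"
  shows "Ck_at k (\<lambda>t. snd c (\<alpha> t)) 0"
proof -
  have lim: "limitin (mtop M) \<alpha> (\<alpha> t) (nhds t)" for t
    using continuous_map_limit[OF \<alpha>(2), of "\<lambda>s. s" t "nhds t"] by (simp add: o_def filterlim_ident)
  have car: "\<alpha> t \<in> carrier L" for t
    using continuous_map_image_subset_topspace[OF \<alpha>(2)] topspace by auto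
  have "\<alpha> 0 \<otimes> \<alpha> 0 = \<alpha> 0" using \<alpha>(1)[of 0 0] by simp
  then have \<alpha>0: "\<alpha> 0 = \<one>" using car by (metis l_cancel_one')
  have "\<forall>\<^sub>F t in nhds 0. \<alpha> t \<in> fst c" using lim[of 0] one_c by (intro eventually_c[of \<alpha> \<one>]) (auto simp: \<alpha>0)
  then obtain e where e: "e > 0" "\<And>t. \<bar>t\<bar> < e \<Longrightarrow> \<alpha> t \<in> fst c"
    by (auto simp: eventually_nhds_metric dist_real_def)
  have "Ck_at k (\<lambda>t. coord (\<alpha> t)) 0"
  proof (rule local_one_parameter_Ck_at[where \<epsilon> = "e / 2"])
    show "e / 2 > 0" using e by simp
    show "isCont (\<lambda>t. coord (\<alpha> t)) t" if "\<bar>t\<bar> < e / 2" for t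
    proof -
      have "((\<lambda>t. coord (\<alpha> t)) \<longlongrightarrow> coord (\<alpha> t)) (nhds t)"
        using e(2)[of t] that by (intro coord_tendsto lim) simp
      then show ?thesis unfolding isCont_def by (rule tendsto_mono[rotated]) (simp add: at_within_def)
    qed
    show "coord (\<alpha> 0) = 0" by (simp add: \<alpha>0 coord_one)
    show "coord (\<alpha> (s + t)) = mul (coord (\<alpha> s), coord (\<alpha> t))" if "\<bar>s\<bar> < e / 2" "\<bar>t\<bar> < e / 2" for s t
      using e(2)[of s] e(2)[of t] that by (simp add: mul_coord \<alpha>(1))
  qed
  then show ?thesis by (simp add: Ck_at_coord_iff)
qed

text \<open>In an abelian group (xy)(xy) = (xx)(yy). The radius d is such that products of small
  elements can be multiplied once more within the chart.\<close>

lemma medial_law: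
  assumes "comm_group L"
  obtains d where "d > 0" "\<And>x y. norm x < d \<Longrightarrow> norm y < d \<Longrightarrow> (x, y) \<in> dom"
    "\<And>x y. norm x < d \<Longrightarrow> norm y < d \<Longrightarrow> mul (mul (x, y), mul (x, y)) = mul (mul (x, x), mul (y, y))"
proof -
  interpret comm_group L by fact
  obtain r C where r: "r > 0" and U: "\<And>x y. norm x < r \<Longrightarrow> norm y < r \<Longrightarrow> (x, y) \<in> dom"
    using approx_add by metis
  have "isCont mul (0, 0)"
    using smooth_on_differentiable[OF smooth_mul zero] differentiable_imp_continuous_within by blast
  then obtain d0 where d0: "d0 > 0" "\<And>z. norm (z - (0, 0)) < d0 \<Longrightarrow> norm (mul z) < r"
    using r unit_unit unfolding continuous_at_eps_delta by (force simp: dist_norm)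
  define d where "d = min r (d0 / 2)"
  have d: "d > 0" using r d0 by (simp add: d_def)
  have small: "norm (mul (x, y)) < r" if "norm x < d" "norm y < d" for x y
    using d0(2)[of "(x, y)"] norm_Pair_le[of x y] that by (simp add: d_def)
  have Ud: "(x, y) \<in> dom" if "norm x < d" "norm y < d" for x y using U that by (simp add: d_def)
  show thesis
  proof (rule that[of d])
    fix x y :: 'e assume xy: "norm x < d" "norm y < d"
    have x: "point x \<in> carrier L" "point y \<in> carrier L" using domE[OF Ud[OF xy]] c_carrier by auto
    have "mul (mul (x, y), mul (x, y)) = coord ((point x \<otimes> point y) \<otimes> (point x \<otimes> point y))"
      using domE(5)[OF U[OF small small], OF xy xy] domE(4)[OF Ud] xy by simp
    also have "(point x \<otimes> point y) \<otimes> (point x \<otimes> point y) = (point x \<otimes> point x) \<otimes> (point y \<otimes> point y)"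
      using x by (simp add: m_ac)
    also have "coord ((point x \<otimes> point x) \<otimes> (point y \<otimes> point y)) = mul (mul (x, x), mul (y, y))"
      using domE(5)[OF U[OF small small], of x x y y] domE(4)[OF Ud] xy by simp
    finally show "mul (mul (x, y), mul (x, y)) = mul (mul (x, x), mul (y, y))" .
  qed (use d Ud in auto)
qed

text \<open>The curve \<open>c\<^sub>1 c\<^sub>2\<^sup>-\<^sup>1\<close> has the same velocity at \<open>s\<close> as the constant curve
  \<open>(c\<^sub>1(s) c\<^sub>2(s)\<^sup>-\<^sup>1 c\<^sub>2) c\<^sub>2\<^sup>-\<^sup>1\<close>.\<close>

lemma left_logarithmic_derivative_unique:
  assumes cont: "continuous_map (top_of_set {0..1}) (mtop M) c1" "continuous_map (top_of_set {0..1}) (mtop M) c2"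
    and init: "c1 0 = c2 0"
    and der1: "\<And>s d. s \<in> {0..1} \<Longrightarrow> d \<in> charts_at M (c1 s) \<Longrightarrow> ((snd d \<circ> c1) has_vector_derivative
       frechet_derivative (snd d \<circ> (\<lambda>y. c1 s \<otimes> y) \<circ> chart_inv c) (at (snd c \<one>)) (w s)) (at s within {0..1})"
    and der2: "\<And>s d. s \<in> {0..1} \<Longrightarrow> d \<in> charts_at M (c2 s) \<Longrightarrow> ((snd d \<circ> c2) has_vector_derivative
       frechet_derivative (snd d \<circ> (\<lambda>y. c2 s \<otimes> y) \<circ> chart_inv c) (at (snd c \<one>)) (w s)) (at s within {0..1})"
    and t: "t \<in> {0..1::real}"
  shows "c1 t = c2 t"
proof -
  have car: "c1 s \<in> carrier L" "c2 s \<in> carrier L" if "s \<in> {0..1}" for s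
    using continuous_map_image_subset_topspace[OF cont(1)] continuous_map_image_subset_topspace[OF cont(2)]
      that topspace by auto
  have lim: "limitin (mtop M) g (g s) (at s within {0..1})"
    if "s \<in> {0..1}" "continuous_map (top_of_set {0..1}) (mtop M) g" for s and g :: "real \<Rightarrow> 'l"
  proof -
    have "limitin (top_of_set {0..1}) (\<lambda>s. s) s (at s within {0..1})"
      using that(1) by (auto simp: limitin_subtopology eventually_at_filter tendsto_ident_at)
    from continuous_map_limit[OF that(2) this] show ?thesis by (simp add: o_def)
  qed
  have ex: "\<exists>d. d \<in> charts M \<and> p \<in> fst d" if "p \<in> carrier L" for p
    using chart_exists[OF manifold] that topspace by metis
  have evc: "\<forall>\<^sub>F u in at s within {0..1}. g u \<in> fst d"
    if "s \<in> {0..1}" "continuous_map (top_of_set {0..1}) (mtop M) g" "d \<in> charts M" "g s \<in> fst d"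
    for s d and g :: "real \<Rightarrow> 'l"
    using limitinD[OF lim[OF that(1,2)] chart_openin[OF manifold that(3)] that(4)] .
  define z where "z u = c1 u \<otimes> inv (c2 u)" for u
  have cont_inv: "continuous_map (top_of_set {0..1}) (mtop M) (\<lambda>u. inv (c2 u))"
    using continuous_map_compose[OF cont(2), of "mtop M" "\<lambda>x. inv x"] smooth_inv
    by (simp add: smooth_map_def o_def)
  have cont_pair: "continuous_map (top_of_set {0..1}) (prod_topology (mtop M) (mtop M)) (\<lambda>u. (c1 u, inv (c2 u)))"
    using cont(1) cont_inv by (simp add: continuous_map_pairwise o_def)
  have cont_z: "continuous_map (top_of_set {0..1}) (mtop M) z"
    using continuous_map_compose[OF cont_pair, of "mtop M" "\<lambda>(x, y). x \<otimes> y"] smooth_mult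
    by (simp add: smooth_map_def mtop_prod_manifold o_def z_def[abs_def])
  have der_z: "((snd d \<circ> z) has_vector_derivative 0) (at s within {0..1})"
    if s: "s \<in> {0..1}" and d: "d \<in> charts M" "z s \<in> fst d" for s d
  proof -
    obtain e1 where e1: "e1 \<in> charts M" "c1 s \<in> fst e1" using ex car s by blast
    obtain e2 where e2: "e2 \<in> charts M" "c2 s \<in> fst e2" using ex car s by blast
    obtain e3 where e3: "e3 \<in> charts M" "inv (c2 s) \<in> fst e3" using ex car s by blast
    \<comment> \<open>The left translation that carries c2 s to c1 s; it turns left multiplication
      by c2 s into left multiplication by c1 s.\<close>
    define f where "f y = (c1 s \<otimes> inv (c2 s)) \<otimes> y" for y
    have f: "smooth_map M M f" unfolding f_def[abs_def] using car s by (intro smooth_map_left_mult) auto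
    have f_c2: "f (c2 s \<otimes> y) = c1 s \<otimes> y" if "y \<in> carrier L" for y
      using car[OF s] that by (simp add: f_def m_assoc) (simp add: m_assoc[symmetric])
    have fs: "f (c2 s) = c1 s" using f_c2[of \<one>] car[OF s] by simp
    define F where "F = frechet_derivative (snd e1 \<circ> f \<circ> chart_inv e2) (at (snd e2 (c2 s)))"
    have F: "((snd e1 \<circ> f \<circ> chart_inv e2) has_derivative F) (at (snd e2 (c2 s)))"
      unfolding F_def using e1 e2 fs by (intro smooth_map_has_derivative[OF f]) auto
    define D1 where "D1 = frechet_derivative (snd e1 \<circ> (\<lambda>y. c1 s \<otimes> y) \<circ> chart_inv c) (at (snd c \<one>))"
    define D2 where "D2 = frechet_derivative (snd e2 \<circ> (\<lambda>y. c2 s \<otimes> y) \<circ> chart_inv c) (at (snd c \<one>))"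
    have D1: "((snd e1 \<circ> (\<lambda>y. c1 s \<otimes> y) \<circ> chart_inv c) has_derivative D1) (at (snd c \<one>))"
      unfolding D1_def using e1 one_c car[OF s] c
      by (intro smooth_map_has_derivative[OF smooth_map_left_mult]) auto
    have D2: "((snd e2 \<circ> (\<lambda>y. c2 s \<otimes> y) \<circ> chart_inv c) has_derivative D2) (at (snd c \<one>))"
      unfolding D2_def using e2 one_c car[OF s] c
      by (intro smooth_map_has_derivative[OF smooth_map_left_mult]) auto
    have limc: "limitin (mtop M) (chart_inv c) \<one> (nhds (snd c \<one>))"
      using chart_inv_limitin[OF manifold c, of "snd c \<one>"] one_c chart_inj[OF manifold c] by simp
    have evcar: "\<forall>\<^sub>F x in nhds (snd c \<one>). chart_inv c x \<in> carrier L"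
      using limitinD[OF limc, of "carrier L"] topspace openin_topspace[of "mtop M"] by simp
    have inv1: "chart_inv c (snd c \<one>) = \<one>" using one_c chart_inj[OF manifold c] by simp
    have der_f: "((snd e1 \<circ> f \<circ> ((\<lambda>y. c2 s \<otimes> y) \<circ> chart_inv c)) has_derivative (\<lambda>v. F (D2 v))) (at (snd c \<one>))"
    proof (rule chart_chain[where h = "snd e1 \<circ> f" and \<gamma> = "(\<lambda>y. c2 s \<otimes> y) \<circ> chart_inv c"
          and A = D2 and B = F, OF UNIV_I chart_inj[OF manifold e2(1)]])
      have "limitin (mtop M) (\<lambda>x. c2 s \<otimes> chart_inv c x) (c2 s \<otimes> \<one>) (nhds (snd c \<one>))"
        using smooth_map_limitin[OF smooth_map_left_mult limc] car[OF s] by simp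
      then have "limitin (mtop M) (\<lambda>x. c2 s \<otimes> chart_inv c x) (c2 s) (nhds (snd c \<one>))"
        using car[OF s] by simp
      from limitinD[OF this chart_openin[OF manifold e2(1)] e2(2)]
      show "\<forall>\<^sub>F u in at (snd c \<one>). ((\<lambda>y. c2 s \<otimes> y) \<circ> chart_inv c) u \<in> fst e2"
        by (simp add: eventually_at_filter eventually_mono)
      show "((\<lambda>y. c2 s \<otimes> y) \<circ> chart_inv c) (snd c \<one>) \<in> fst e2" using inv1 e2 car[OF s] by simp
      show "((snd e2 \<circ> ((\<lambda>y. c2 s \<otimes> y) \<circ> chart_inv c)) has_derivative D2) (at (snd c \<one>))"
        using D2 by (simp add: o_assoc)
      show "((snd e1 \<circ> f \<circ> chart_inv e2) has_derivative F) (at (snd e2 (((\<lambda>y. c2 s \<otimes> y) \<circ> chart_inv c) (snd c \<one>))))"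
        using F inv1 car[OF s] by simp
    qed
    obtain V where V: "open V" "snd c \<one> \<in> V" "\<And>x. x \<in> V \<Longrightarrow> chart_inv c x \<in> carrier L"
      using evcar unfolding eventually_nhds by blast
    have "((snd e1 \<circ> (\<lambda>y. c1 s \<otimes> y) \<circ> chart_inv c) has_derivative (\<lambda>v. F (D2 v))) (at (snd c \<one>))"
      by (rule has_derivative_transform_within_open[OF der_f V(1,2)]) (simp add: f_c2 V(3))
    \<comment> \<open>Two derivatives of the same map y \<mapsto> c1 s \<otimes> y = f (c2 s
      \<otimes> y). It follows that u \<mapsto> f (c2 u) has the velocity of c1 at s.\<close>
    then have FD: "F (D2 v) = D1 v" for v using has_derivative_unique[OF D1] by metis
    have d1: "((snd e1 \<circ> c1) has_vector_derivative D1 (w s)) (at s within {0..1})"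
      unfolding D1_def using e1 by (intro der1 s) (simp add: charts_at_def)
    have d2: "((snd e2 \<circ> c2) has_vector_derivative D2 (w s)) (at s within {0..1})"
      unfolding D2_def using e2 by (intro der2 s) (simp add: charts_at_def)
    have d1': "((snd e1 \<circ> f \<circ> c2) has_vector_derivative D1 (w s)) (at s within {0..1})"
      using chart_chain_vector[OF s chart_inj[OF manifold e2(1)] evc[OF s cont(2) e2] e2(2) d2 F] by (simp add: FD o_def)
    have "((snd e3 \<circ> (\<lambda>x. inv x) \<circ> chart_inv e2) has_derivative
        frechet_derivative (snd e3 \<circ> (\<lambda>x. inv x) \<circ> chart_inv e2) (at (snd e2 (c2 s)))) (at (snd e2 (c2 s)))"
      using e2 e3 by (intro smooth_map_has_derivative[OF smooth_inv]) auto
    from chart_chain_vector[OF s chart_inj[OF manifold e2(1)] evc[OF s cont(2) e2] e2(2) d2 this]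
    obtain v where d3: "((snd e3 \<circ> (\<lambda>u. inv (c2 u))) has_vector_derivative v) (at s within {0..1})"
      by (auto simp: o_def)
    let ?E = "prod_chart e1 e3"
    have E: "?E \<in> charts (prod_manifold M M)" using e1 e3 unfolding charts_prod_manifold by blast
    have Einj: "inj_on (snd ?E) (fst ?E)"
      by (intro inj_on_prod_chart chart_inj[OF manifold] e1 e3)
    define B where "B = frechet_derivative (snd d \<circ> (\<lambda>(x, y). x \<otimes> y) \<circ> chart_inv ?E) (at (snd ?E (c1 s, inv (c2 s))))"
    have B: "((snd d \<circ> (\<lambda>(x, y). x \<otimes> y) \<circ> chart_inv ?E) has_derivative B) (at (snd ?E (c1 s, inv (c2 s))))"
      unfolding B_def using e1 e3 d
      by (intro smooth_map_has_derivative[OF smooth_mult E]) (auto simp: fst_prod_chart z_def)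
    have "((snd d \<circ> (\<lambda>(x, y). x \<otimes> y) \<circ> (\<lambda>u. (c1 u, inv (c2 u)))) has_vector_derivative B (D1 (w s), v)) (at s within {0..1})"
    proof (rule chart_chain_vector[OF s Einj])
      show "\<forall>\<^sub>F u in at s within {0..1}. (c1 u, inv (c2 u)) \<in> fst ?E"
        using evc[OF s cont(1) e1] evc[OF s cont_inv e3] by eventually_elim (simp add: fst_prod_chart)
      show "(c1 s, inv (c2 s)) \<in> fst ?E" using e1 e3 by (simp add: fst_prod_chart)
      show "((snd ?E \<circ> (\<lambda>u. (c1 u, inv (c2 u)))) has_vector_derivative (D1 (w s), v)) (at s within {0..1})"
        using has_vector_derivative_Pair[OF d1 d3] by (simp add: o_def snd_prod_chart)
    qed (rule B)
    then have dz: "((snd d \<circ> z) has_vector_derivative B (D1 (w s), v)) (at s within {0..1})"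
      by (simp add: o_def z_def)
    \<comment> \<open>The same derivative B at the same point and in the same direction, but now
      along a curve whose product is constant.\<close>
    have "((snd d \<circ> (\<lambda>(x, y). x \<otimes> y) \<circ> (\<lambda>u. (f (c2 u), inv (c2 u)))) has_vector_derivative B (D1 (w s), v)) (at s within {0..1})"
    proof (rule chart_chain_vector[OF s Einj])
      have cont_f: "continuous_map (top_of_set {0..1}) (mtop M) (\<lambda>u. f (c2 u))"
        using continuous_map_compose[OF cont(2), of "mtop M" f] f by (simp add: smooth_map_def o_def)
      show "\<forall>\<^sub>F u in at s within {0..1}. (f (c2 u), inv (c2 u)) \<in> fst ?E"
        using evc[OF s cont_f e1(1)] evc[OF s cont_inv e3] e1(2) fs
        by (auto simp: fst_prod_chart elim: eventually_elim2)
      show "(f (c2 s), inv (c2 s)) \<in> fst ?E" using e1 e3 fs by (simp add: fst_prod_chart)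
      show "((snd ?E \<circ> (\<lambda>u. (f (c2 u), inv (c2 u)))) has_vector_derivative (D1 (w s), v)) (at s within {0..1})"
        using has_vector_derivative_Pair[OF d1' d3] by (simp add: o_def snd_prod_chart)
      show "((snd d \<circ> (\<lambda>(x, y). x \<otimes> y) \<circ> chart_inv ?E) has_derivative B) (at (snd ?E (f (c2 s), inv (c2 s))))"
        using B fs by simp
    qed
    then have "((\<lambda>u. snd d (z s)) has_vector_derivative B (D1 (w s), v)) (at s within {0..1})"
    proof (rule has_vector_derivative_transform[OF s, rotated])
      fix u assume "u \<in> {0..1::real}"
      then have "f (c2 u) \<otimes> inv (c2 u) = z s" using car[OF s] car[of u] by (simp add: f_def z_def m_assoc)
      then show "snd d (z s) = (snd d \<circ> (\<lambda>(x, y). x \<otimes> y) \<circ> (\<lambda>u. (f (c2 u), inv (c2 u)))) u" by simp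
    qed
    then have "B (D1 (w s), v) = 0"
      by (rule vector_derivative_unique_within[rotated, OF _ has_vector_derivative_const])
        (use s in \<open>simp add: trivial_limit_within\<close>)
    then show ?thesis using dz by simp
  qed
  \<comment> \<open>The vanishing derivative gives constancy only while z stays in one chart;
    connectedness of [0,1] then makes it global.\<close>
  have local_const: "\<forall>\<^sub>F b in at s within {0..1}. z s = z b" if s: "s \<in> {0..1}" for s
  proof -
    have "z s \<in> carrier L" using car[OF s] by (simp add: z_def)
    then obtain d where d: "d \<in> charts M" "z s \<in> fst d" using ex by blast
    obtain \<epsilon> where \<epsilon>: "\<epsilon> > 0" "\<And>u. u \<in> {0..1} \<Longrightarrow> dist u s < \<epsilon> \<Longrightarrow> z u \<in> fst d"
      using evc[OF s cont_z d] d(2) unfolding eventually_at by (metis)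
    have "\<exists>k. \<forall>u\<in>{0..1} \<inter> ball s \<epsilon>. (snd d \<circ> z) u = k"
    proof (rule has_derivative_zero_constant)
      show "convex ({0..1} \<inter> ball s \<epsilon>)" by (intro convex_Int) auto
      fix u assume u: "u \<in> {0..1} \<inter> ball s \<epsilon>"
      then have "((snd d \<circ> z) has_vector_derivative 0) (at u within {0..1})"
        using \<epsilon>(2)[of u] by (intro der_z d) (auto simp: dist_commute)
      then show "((snd d \<circ> z) has_derivative (\<lambda>h. 0)) (at u within {0..1} \<inter> ball s \<epsilon>)"
        by (auto simp: has_vector_derivative_def intro: has_derivative_subset)
    qed
    then have "z s = z u" if "u \<in> {0..1}" "dist u s < \<epsilon>" for u
      using \<epsilon> that s inj_onD[OF chart_inj[OF manifold d(1)], of "z s" "z u"] d(2)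
      by (auto simp: dist_commute)
    then show ?thesis using \<epsilon>(1) by (auto simp: eventually_at)
  qed
  have "z 0 = z t" using t local_const by (intro connected_local_const[of "{0..1}"]) auto
  then have "c1 t \<otimes> inv (c2 t) = \<one>" using init car[of 0] by (simp add: z_def)
  then show ?thesis using car[OF t] by (metis inv_equality inv_inv inv_closed)
qed

end

section \<open>The semidirect product\<close>

lemma limitin_compose: "limitin X f l F \<Longrightarrow> filterlim g F F' \<Longrightarrow> limitin X (\<lambda>t. f (g t)) l F'"
  unfolding limitin_def using eventually_compose_filterlim by blast

lemma has_derivative_prod_chart:
  assumes f: "((snd d1 \<circ> f1 \<circ> chart_inv c1) has_derivative A1) (at (snd c1 p))" "p \<in> fst c1"
      "inj_on (snd c1) (fst c1)" "open (snd c1 ` fst c1)"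
    and g: "((snd d2 \<circ> f2 \<circ> chart_inv c2) has_derivative A2) (at (snd c2 q))" "q \<in> fst c2"
      "inj_on (snd c2) (fst c2)" "open (snd c2 ` fst c2)"
  shows "((snd (prod_chart d1 d2) \<circ> (\<lambda>y. (f1 (fst y), f2 (snd y))) \<circ> chart_inv (prod_chart c1 c2)) has_derivative
    (\<lambda>v. (A1 (fst v), A2 (snd v)))) (at (snd (prod_chart c1 c2) (p, q)))"
proof -
  let ?z = "(snd c1 p, snd c2 q)"
  have "((\<lambda>z. ((snd d1 \<circ> f1 \<circ> chart_inv c1) (fst z), (snd d2 \<circ> f2 \<circ> chart_inv c2) (snd z))) has_derivative
    (\<lambda>v. (A1 (fst v), A2 (snd v)))) (at ?z)"
  proof (intro has_derivative_Pair)
    have 1: "(fst has_derivative fst) (at ?z)"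
      and 2: "(snd has_derivative snd) (at ?z)"
      by (auto intro!: bounded_linear_imp_has_derivative bounded_linear_fst bounded_linear_snd)
    show "((\<lambda>z. (snd d1 \<circ> f1 \<circ> chart_inv c1) (fst z)) has_derivative (\<lambda>v. A1 (fst v))) (at ?z)"
      by (rule has_derivative_compose[OF 1]) (use f in \<open>simp add: o_def\<close>)
    show "((\<lambda>z. (snd d2 \<circ> f2 \<circ> chart_inv c2) (snd z)) has_derivative (\<lambda>v. A2 (snd v))) (at ?z)"
      by (rule has_derivative_compose[OF 2]) (use g in \<open>simp add: o_def\<close>)
  qed
  moreover have "open ((snd c1 ` fst c1) \<times> (snd c2 ` fst c2))" using f g by (intro open_Times)
  moreover have "?z \<in> (snd c1 ` fst c1) \<times> (snd c2 ` fst c2)" using f g by simp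
  ultimately have "((snd (prod_chart d1 d2) \<circ> (\<lambda>y. (f1 (fst y), f2 (snd y))) \<circ> chart_inv (prod_chart c1 c2)) has_derivative
    (\<lambda>v. (A1 (fst v), A2 (snd v)))) (at ?z)"
  proof (rule has_derivative_transform_within_open)
    fix z assume "z \<in> (snd c1 ` fst c1) \<times> (snd c2 ` fst c2)"
    then have "chart_inv (prod_chart c1 c2) z = (chart_inv c1 (fst z), chart_inv c2 (snd z))"
      using chart_inv_prod_chart[OF f(3) g(3), of "fst z" "snd z"] by (cases z) auto
    then show "((snd d1 \<circ> f1 \<circ> chart_inv c1) (fst z), (snd d2 \<circ> f2 \<circ> chart_inv c2) (snd z))
      = (snd (prod_chart d1 d2) \<circ> (\<lambda>y. (f1 (fst y), f2 (snd y))) \<circ> chart_inv (prod_chart c1 c2)) z"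
      by (simp add: snd_prod_chart)
  qed
  then show ?thesis by (simp add: snd_prod_chart)
qed

lemma charts_at_prod_manifold:
  "charts_at (prod_manifold M M') (p, q) = {prod_chart c d |c d. c \<in> charts_at M p \<and> d \<in> charts_at M' q}"
  unfolding charts_at_def charts_prod_manifold by (auto simp: fst_prod_chart; blast)

lemma (in banach_lie_chart) point_limitin: "limitin (mtop M) point \<one> (nhds 0)"
proof -
  have "limitin (mtop M) (chart_inv c) \<one> (nhds (snd c \<one>))"
    using chart_inv_limitin[OF manifold c, of "snd c \<one>"] one_c chart_inj[OF manifold c] by simp
  moreover have "filterlim (\<lambda>x. x + snd c \<one>) (nhds (snd c \<one>)) (nhds 0)"
    using tendsto_add[OF filterlim_ident[of "nhds (0 :: 'e)"] tendsto_const[of "snd c \<one>"]] by simp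
  ultimately show ?thesis unfolding point_def by (rule limitin_compose)
qed

lemma (in banach_lie_chart) mult_limitin:
  assumes "limitin (mtop M) x p F" "limitin (mtop M) y q F"
  shows "limitin (mtop M) (\<lambda>t. x t \<otimes> y t) (p \<otimes> q) F"
proof -
  have "limitin (mtop (prod_manifold M M)) (\<lambda>t. (x t, y t)) (p, q) F"
    using assms by (simp add: mtop_prod_manifold limitin_pairwise o_def)
  from smooth_map_limitin[OF smooth_mult this] show ?thesis by simp
qed

locale lie_semidirect =
  G: banach_lie_chart G MG cG + N: banach_lie_chart N MN cN
  for G :: "('g, 'x) monoid_scheme" and MG :: "('g, 'eg::banach) manifold" and cG
    and N :: "('n, 'y) monoid_scheme" and MN :: "('n, 'en::banach) manifold" and cN +
  fixes \<pi> :: "'g \<Rightarrow> 'n \<Rightarrow> 'n"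
  assumes hom: "\<pi> \<in> hom G (lie_aut_group N MN)"
    and action: "continuous_map (prod_topology (mtop MG) (mtop MN)) (mtop MN) (\<lambda>(g, n). \<pi> g n)"
    and comm: "comm_group N"
begin

section \<open>The group H and its action\<close>

abbreviation "H \<equiv> semidirect_product N G \<pi>"
abbreviation "MH \<equiv> prod_manifold MN MG"

lemma \<pi>_auto:
  assumes "g \<in> carrier G" shows "\<pi> g \<in> auto N" "smooth_map MN MN (\<pi> g)"
  using hom_in_carrier[OF hom assms] by (auto simp: lie_aut_group_def)

lemma \<pi>_closed [simp]: "g \<in> carrier G \<Longrightarrow> n \<in> carrier N \<Longrightarrow> \<pi> g n \<in> carrier N"
  using \<pi>_auto(1) by (auto simp: auto_def hom_def)

lemma \<pi>_mult: "g \<in> carrier G \<Longrightarrow> n \<in> carrier N \<Longrightarrow> n' \<in> carrier N \<Longrightarrow> \<pi> g (n \<otimes>\<^bsub>N\<^esub> n') = \<pi> g n \<otimes>\<^bsub>N\<^esub> \<pi> g n'"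
  using \<pi>_auto(1) by (auto simp: auto_def hom_def)

lemma \<pi>_one: "g \<in> carrier G \<Longrightarrow> \<pi> g \<one>\<^bsub>N\<^esub> = \<one>\<^bsub>N\<^esub>"
  using \<pi>_mult[of g "\<one>\<^bsub>N\<^esub>" "\<one>\<^bsub>N\<^esub>"] \<pi>_closed[of g "\<one>\<^bsub>N\<^esub>"] by (metis N.l_cancel_one' N.one_closed N.r_one)

lemma \<pi>_compose: "g \<in> carrier G \<Longrightarrow> h \<in> carrier G \<Longrightarrow> n \<in> carrier N \<Longrightarrow> \<pi> (g \<otimes>\<^bsub>G\<^esub> h) n = \<pi> g (\<pi> h n)"
proof -
  assume g: "g \<in> carrier G" and h: "h \<in> carrier G" and n: "n \<in> carrier N"
  have "\<pi> (g \<otimes>\<^bsub>G\<^esub> h) = \<pi> g \<otimes>\<^bsub>lie_aut_group N MN\<^esub> \<pi> h" using hom_mult[OF hom g h] .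
  also have "\<dots> = compose (carrier N) (\<pi> g) (\<pi> h)"
    using \<pi>_auto(1)[OF g] \<pi>_auto(1)[OF h] by (simp add: lie_aut_group_def AutoGroup_def BijGroup_def auto_def)
  finally show ?thesis using n by (simp add: compose_def)
qed

text \<open>The automorphism at the unit is idempotent by multiplicativity and injective, hence the
  identity on N.\<close>

lemma \<pi>_unit: "n \<in> carrier N \<Longrightarrow> \<pi> \<one>\<^bsub>G\<^esub> n = n"
proof -
  assume n: "n \<in> carrier N"
  have "bij_betw (\<pi> \<one>\<^bsub>G\<^esub>) (carrier N) (carrier N)"
    using \<pi>_auto(1)[OF G.one_closed] by (auto simp: auto_def Bij_def)
  then have "inj_on (\<pi> \<one>\<^bsub>G\<^esub>) (carrier N)" by (rule bij_betw_imp_inj_on)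
  moreover have "\<pi> \<one>\<^bsub>G\<^esub> (\<pi> \<one>\<^bsub>G\<^esub> n) = \<pi> \<one>\<^bsub>G\<^esub> n" using \<pi>_compose[of "\<one>\<^bsub>G\<^esub>" "\<one>\<^bsub>G\<^esub>" n] n by simp
  ultimately show ?thesis using n by (simp add: inj_on_def)
qed

lemma H_simps [simp]:
  "carrier H = carrier N \<times> carrier G" "\<one>\<^bsub>H\<^esub> = (\<one>\<^bsub>N\<^esub>, \<one>\<^bsub>G\<^esub>)"
  "x \<otimes>\<^bsub>H\<^esub> y = (fst x \<otimes>\<^bsub>N\<^esub> \<pi> (snd x) (fst y), snd x \<otimes>\<^bsub>G\<^esub> snd y)"
  by (simp_all add: semidirect_product_def split_beta)

lemma group_H: "group H"
proof (rule groupI)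
  fix x assume "x \<in> carrier H"
  then obtain n g where x: "x = (n, g)" "n \<in> carrier N" "g \<in> carrier G" by auto
  show "\<exists>y\<in>carrier H. y \<otimes>\<^bsub>H\<^esub> x = \<one>\<^bsub>H\<^esub>"
    using x by (intro bexI[of _ "(inv\<^bsub>N\<^esub> (\<pi> (inv\<^bsub>G\<^esub> g) n), inv\<^bsub>G\<^esub> g)"]) auto
  show "\<one>\<^bsub>H\<^esub> \<otimes>\<^bsub>H\<^esub> x = x" using x by (simp add: \<pi>_unit)
qed (auto simp: \<pi>_mult \<pi>_compose N.m_assoc G.m_assoc)

sublocale H: group H by (rule group_H)

lemma action_limitin:
  assumes "limitin (mtop MG) x g F" "limitin (mtop MN) y n F"
  shows "limitin (mtop MN) (\<lambda>t. \<pi> (x t) (y t)) (\<pi> g n) F"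
proof -
  have "limitin (prod_topology (mtop MG) (mtop MN)) (\<lambda>t. (x t, y t)) (g, n) F"
    using assms by (simp add: limitin_pairwise o_def)
  from continuous_map_limit[OF action this] show ?thesis by (simp add: o_def)
qed

text \<open>A continuous one-parameter subgroup of \<open>H\<close> consists of a continuous one-parameter subgroup
  \<open>\<alpha>\<close> of \<open>G\<close> and a continuous cocycle \<open>\<beta>\<close> with values in \<open>N\<close>; conjugation by \<open>(n, 1)\<close> adds a
  coboundary to the latter.\<close>

abbreviation twist :: "(real \<Rightarrow> 'g) \<Rightarrow> (real \<Rightarrow> 'n) \<Rightarrow> 'n \<Rightarrow> real \<Rightarrow> 'n" where
  "twist \<alpha> \<beta> n t \<equiv> n \<otimes>\<^bsub>N\<^esub> \<beta> t \<otimes>\<^bsub>N\<^esub> \<pi> (\<alpha> t) (inv\<^bsub>N\<^esub> n)"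

context
  fixes \<alpha> :: "real \<Rightarrow> 'g" and \<beta> :: "real \<Rightarrow> 'n"
  assumes \<alpha>_add: "\<And>s t. \<alpha> (s + t) = \<alpha> s \<otimes>\<^bsub>G\<^esub> \<alpha> t"
    and \<alpha>_cont: "continuous_map euclideanreal (mtop MG) \<alpha>"
    and \<beta>_add: "\<And>s t. \<beta> (s + t) = \<beta> s \<otimes>\<^bsub>N\<^esub> \<pi> (\<alpha> s) (\<beta> t)"
    and \<beta>_cont: "continuous_map euclideanreal (mtop MN) \<beta>"
begin

section \<open>Smoothing the cocycle\<close>

lemma \<alpha>_carrier: "\<alpha> t \<in> carrier G" and \<beta>_carrier: "\<beta> t \<in> carrier N"
  using continuous_map_image_subset_topspace[OF \<alpha>_cont] continuous_map_image_subset_topspace[OF \<beta>_cont]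
    G.topspace N.topspace by auto

lemma \<alpha>_0: "\<alpha> 0 = \<one>\<^bsub>G\<^esub>"
  using \<alpha>_add[of 0 0] \<alpha>_carrier by (metis G.l_cancel_one' add_0)

lemma \<beta>_0: "\<beta> 0 = \<one>\<^bsub>N\<^esub>"
  using \<beta>_add[of 0 0] \<beta>_carrier[of 0] by (simp add: \<alpha>_0 \<pi>_unit)

lemma \<alpha>_limitin: "limitin (mtop MG) \<alpha> (\<alpha> t) (nhds t)"
  using continuous_map_limit[OF \<alpha>_cont, of "\<lambda>s. s" t "nhds t"] by (simp add: o_def filterlim_ident)

lemma \<beta>_limitin: "limitin (mtop MN) \<beta> (\<beta> t) (nhds t)"
  using continuous_map_limit[OF \<beta>_cont, of "\<lambda>s. s" t "nhds t"] by (simp add: o_def filterlim_ident)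

text \<open>Near time 0 everything is moved to logarithmic coordinates, where
  \<open>cocycle_cohomologous_smooth\<close> applies, and the outcome is mapped back by e.\<close>

lemma cocycle_smoothing_at_0:
  obtains n where "n \<in> carrier N"
    "\<And>k. Ck_at k (\<lambda>t. snd cN (twist \<alpha> \<beta> n t)) 0"
proof -
  obtain d where d: "d > 0" "\<And>x y. norm x < d \<Longrightarrow> norm y < d \<Longrightarrow> (x, y) \<in> N.dom"
    and medial: "\<And>x y. norm x < d \<Longrightarrow> norm y < d \<Longrightarrow>
      N.mul (N.mul (x, y), N.mul (x, y)) = N.mul (N.mul (x, x), N.mul (y, y))"
    using N.medial_law[OF comm] by blast
  obtain e K R where le: "local_exp N.mul N.dom e K R"
    using N.local_exp_exists[OF d(1) medial] by blast
  interpret E: local_exp N.mul N.dom e K R by (rule le)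
  define p where "p t x = N.coord (\<pi> (\<alpha> t) (N.point x))" for t x
  \<comment> \<open>Joint continuity of the action yields one radius \<delta> that serves all
    automorphisms \<pi> (\<alpha> t) with \<bar>t\<bar> \<le> \<delta>; continuity of each single
    automorphism would give a radius depending on t.\<close>
  have "limitin (mtop MN) (\<lambda>z. \<pi> (\<alpha> (fst z)) (N.point (snd z))) (\<pi> (\<alpha> 0) \<one>\<^bsub>N\<^esub>) (nhds (0, 0))"
    using tendsto_fst[OF filterlim_ident, of "(0 :: real, 0 :: 'en)"]
      tendsto_snd[OF filterlim_ident, of "(0 :: real, 0 :: 'en)"]
    by (intro action_limitin limitin_compose[OF \<alpha>_limitin] limitin_compose[OF N.point_limitin]) simp_all
  then have L: "limitin (mtop MN) (\<lambda>z. \<pi> (\<alpha> (fst z)) (N.point (snd z))) \<one>\<^bsub>N\<^esub> (nhds (0, 0))"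
    by (simp add: \<pi>_one \<alpha>_carrier)
  have "\<forall>\<^sub>F z in nhds (0, 0). norm (p (fst z) (snd z)) < R / 2"
    using tendstoD[OF N.coord_tendsto[OF L N.one_c], of "R / 2"] E.R
    by (simp add: N.coord_one p_def)
  from eventually_conj[OF N.eventually_c[OF L N.one_c] this]
  obtain d1 where d1: "d1 > 0" "\<And>z. dist z (0, 0) < d1 \<Longrightarrow>
      \<pi> (\<alpha> (fst z)) (N.point (snd z)) \<in> fst cN \<and> norm (p (fst z) (snd z)) < R / 2"
    unfolding eventually_nhds_metric by blast
  define \<delta> where "\<delta> = min (d1 / 2) d / 2"
  have \<delta>: "\<delta> > 0" "\<delta> < d" using d1(1) d(1) by (auto simp: \<delta>_def)
  have small: "\<pi> (\<alpha> t) (N.point x) \<in> fst cN" "norm (p t x) < R / 2" if "\<bar>t\<bar> \<le> \<delta>" "norm x \<le> \<delta>" for t x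
  proof -
    have "norm (t, x) \<le> \<bar>t\<bar> + norm x" using norm_Pair_le[of t x] by simp
    then have "dist (t, x) (0, 0) < d1" using that d1(1) by (simp add: dist_norm \<delta>_def)
    then show "\<pi> (\<alpha> t) (N.point x) \<in> fst cN" "norm (p t x) < R / 2" using d1(2)[of "(t, x)"] by auto
  qed
  \<comment> \<open>A common bound for B and v. Sums of two such vectors still fit into the ball of
    radius R, and 2 * M \<le> \<delta> keeps e v in the domain of the local homomorphism p
    t.\<close>
  define M where "M = min (R / 2) (\<delta> / 2)"
  have M: "M > 0" "2 * M \<le> R" "2 * M \<le> \<delta>" using E.R \<delta> by (auto simp: M_def)
  have "\<exists>T. (p t has_derivative T) (at 0)" for t
  proof -
    have "((snd cN \<circ> \<pi> (\<alpha> t) \<circ> chart_inv cN) has_derivative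
        frechet_derivative (snd cN \<circ> \<pi> (\<alpha> t) \<circ> chart_inv cN) (at (snd cN \<one>\<^bsub>N\<^esub>))) (at (snd cN \<one>\<^bsub>N\<^esub>))"
      using N.one_c by (intro smooth_map_has_derivative[OF \<pi>_auto(2)[OF \<alpha>_carrier] N.c N.c]) (simp_all add: \<pi>_one \<alpha>_carrier)
    then obtain D where D: "((snd cN \<circ> \<pi> (\<alpha> t) \<circ> chart_inv cN) has_derivative D) (at (0 + snd cN \<one>\<^bsub>N\<^esub>))" by auto
    have "((\<lambda>x. x + snd cN \<one>\<^bsub>N\<^esub>) has_derivative (\<lambda>h. h)) (at 0)" by (auto intro!: derivative_eq_intros)
    from has_derivative_diff[OF has_derivative_compose[OF this D] has_derivative_const[of "snd cN \<one>\<^bsub>N\<^esub>"]]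
    show ?thesis unfolding p_def[abs_def] N.coord_def N.point_def by (auto simp: o_def)
  qed
  then obtain T where T: "\<And>t. (p t has_derivative T t) (at 0)" by metis
  have pT: "norm (T t v) \<le> R" "p t (e v) = e (T t v)" if t: "\<bar>t\<bar> \<le> \<delta>" and v: "norm v \<le> M" for t v
  proof -
    have p0: "p t 0 = 0" by (simp add: p_def N.point_0 \<pi>_one \<alpha>_carrier N.coord_one)
    have hom: "p t (N.mul (x, y)) = N.mul (p t x, p t y)" if "norm x \<le> \<delta>" "norm y \<le> \<delta>" for x y
    proof -
      have "(x, y) \<in> N.dom" using d(2) that \<delta> by simp
      note xy = N.domE[OF this]
      have "p t (N.mul (x, y)) = N.coord (\<pi> (\<alpha> t) (N.point x) \<otimes>\<^bsub>N\<^esub> \<pi> (\<alpha> t) (N.point y))"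
        using xy N.c_carrier by (simp add: p_def \<pi>_mult \<alpha>_carrier)
      also have "\<dots> = N.mul (p t x, p t y)"
        unfolding p_def by (rule N.mul_coord[symmetric]) (use small t that in auto)
      finally show ?thesis .
    qed
    show "norm (T t v) \<le> R" "p t (e v) = e (T t v)"
      using E.local_hom_e[where v = v and d = \<delta>, OF p0 T _ hom] small(2)[OF t] v M by (auto simp: less_imp_le)
  qed
  have "\<forall>\<^sub>F t in nhds 0. norm (N.coord (\<beta> t)) < M / 2"
    using tendstoD[OF N.coord_tendsto[OF \<beta>_limitin[of 0]], of "M / 2"] M N.one_c
    by (simp add: \<beta>_0 N.coord_one)
  moreover have "\<forall>\<^sub>F t in nhds 0. \<beta> t \<in> fst cN"
    using N.eventually_c[OF \<beta>_limitin[of 0]] N.one_c by (simp add: \<beta>_0)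
  ultimately have "\<forall>\<^sub>F t in nhds 0. norm (N.coord (\<beta> t)) < M / 2 \<and> \<beta> t \<in> fst cN" by (rule eventually_conj)
  then obtain d2 where d2: "d2 > 0" "\<And>t. \<bar>t\<bar> < d2 \<Longrightarrow> norm (N.coord (\<beta> t)) < M / 2 \<and> \<beta> t \<in> fst cN"
    unfolding eventually_nhds_metric by (auto simp: dist_real_def)
  define \<tau> where "\<tau> = min d2 \<delta> / 2"
  have \<tau>: "\<tau> > 0" "\<tau> < d2" "\<tau> \<le> \<delta>" using d2(1) \<delta> by (auto simp: \<tau>_def)
  have \<beta>c: "\<beta> t \<in> fst cN" "norm (N.coord (\<beta> t)) < M / 2" if "\<bar>t\<bar> \<le> \<tau>" for t using d2(2)[of t] that \<tau> by auto
  define B where "B t = E.logm (N.coord (\<beta> t))" for t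
  \<comment> \<open>\<open>logm\<close> at most doubles norms, which is why the coordinates of
    \<beta> t were kept below M / 2.\<close>
  have B: "norm (B t) \<le> M" "e (B t) = N.coord (\<beta> t)" if "\<bar>t\<bar> \<le> \<tau>" for t
    using \<beta>c[OF that] E.logm_bound[of "N.coord (\<beta> t)"] E.logm(2)[of "N.coord (\<beta> t)"] M by (auto simp: B_def)
  have contB: "continuous_on {-\<tau>..\<tau>} B"
    unfolding continuous_on_def
  proof
    fix t assume t: "t \<in> {-\<tau>..\<tau>}"
    have "((\<lambda>s. N.coord (\<beta> s)) \<longlongrightarrow> N.coord (\<beta> t)) (nhds t)"
      using \<beta>c[of t] t by (intro N.coord_tendsto \<beta>_limitin) auto
    then have "((\<lambda>s. N.coord (\<beta> s)) \<longlongrightarrow> N.coord (\<beta> t)) (at t within {-\<tau>..\<tau>})"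
      by (rule tendsto_mono[rotated]) (simp add: at_within_def)
    from tendsto_mult[OF tendsto_const tendsto_norm[OF tendsto_diff[OF this tendsto_const]], of 2 "N.coord (\<beta> t)"]
    have "((\<lambda>s. 2 * norm (N.coord (\<beta> s) - N.coord (\<beta> t))) \<longlongrightarrow> 0) (at t within {-\<tau>..\<tau>})" by simp
    moreover have "\<forall>\<^sub>F s in at t within {-\<tau>..\<tau>}. norm (B s - B t) \<le> 2 * norm (N.coord (\<beta> s) - N.coord (\<beta> t))"
    proof -
      have "norm (B s - B t) \<le> 2 * norm (N.coord (\<beta> s) - N.coord (\<beta> t))" if "s \<in> {-\<tau>..\<tau>}" for s
      proof -
        have "norm (N.coord (\<beta> u)) \<le> R" if "u \<in> {-\<tau>..\<tau>}" for u
        proof -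
          have "\<bar>u\<bar> \<le> \<tau>" using that by (simp add: abs_le_iff)
          then show ?thesis using \<beta>c(2)[of u] M by linarith
        qed
        then show ?thesis unfolding B_def using that t by (intro E.logm_lipschitz) auto
      qed
      then show ?thesis by (simp add: eventually_at_filter)
    qed
    ultimately have "((\<lambda>s. B s - B t) \<longlongrightarrow> 0) (at t within {-\<tau>..\<tau>})" by (rule Lim_null_comparison[rotated])
    then show "(B \<longlongrightarrow> B t) (at t within {-\<tau>..\<tau>})" by (simp add: Lim_null[symmetric])
  qed
  \<comment> \<open>Under e, products in N become sums and p s becomes T s; injectivity of e on the
    ball of radius 2 * R then removes e from both sides.\<close>
  have coc: "B (s + t) = B s + T s (B t)" if "\<bar>s\<bar> \<le> \<tau> / 2" "\<bar>t\<bar> \<le> \<tau> / 2" for s t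
  proof -
    have st: "\<bar>s\<bar> \<le> \<tau>" "\<bar>t\<bar> \<le> \<tau>" "\<bar>s + t\<bar> \<le> \<tau>" "\<bar>s\<bar> \<le> \<delta>" using that \<tau> by auto
    have Ts: "norm (T s (B t)) \<le> R" "p s (e (B t)) = e (T s (B t))" using pT[OF st(4) B(1)[OF st(2)]] by auto
    have bt: "N.point (N.coord (\<beta> t)) = \<beta> t" using N.point_coord[OF \<beta>c(1)[OF st(2)]] .
    have xt: "norm (N.coord (\<beta> t)) \<le> \<delta>" using \<beta>c(2)[OF st(2)] M by linarith
    have in_c: "\<pi> (\<alpha> s) (\<beta> t) \<in> fst cN" using small(1)[OF st(4) xt] bt by simp
    have "e (B (s + t)) = N.coord (\<beta> s \<otimes>\<^bsub>N\<^esub> \<pi> (\<alpha> s) (\<beta> t))" using B(2)[OF st(3)] \<beta>_add by simp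
    also have "\<dots> = N.mul (N.coord (\<beta> s), N.coord (\<pi> (\<alpha> s) (\<beta> t)))"
      using N.mul_coord[OF \<beta>c(1)[OF st(1)] in_c] by simp
    also have "N.coord (\<pi> (\<alpha> s) (\<beta> t)) = p s (e (B t))" using B(2)[OF st(2)] bt by (simp add: p_def)
    also have "N.mul (N.coord (\<beta> s), p s (e (B t))) = e (B s + T s (B t))"
      using E.e_add[of "B s" "T s (B t)"] B[OF st(1)] Ts M by simp
    finally have "e (B (s + t)) = e (B s + T s (B t))" .
    moreover have "norm (B s + T s (B t)) \<le> 2 * R"
      using norm_triangle_ineq[of "B s" "T s (B t)"] B(1)[OF st(1)] Ts M by linarith
    moreover have "norm (B (s + t)) \<le> 2 * R" using B(1)[OF st(3)] M by linarith
    ultimately show ?thesis using E.e_inverse_bound[of "B (s + t)" "B s + T s (B t)"] by simp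
  qed
  obtain v b where v: "norm v \<le> M" and b: "\<And>k. Ck_at k b 0"
    and bt: "\<And>t. \<bar>t\<bar> \<le> \<tau> / 4 \<Longrightarrow> B t + T t v - v = b t"
    using cocycle_cohomologous_smooth[OF \<tau>(1) contB has_derivative_bounded_linear[OF T] coc B(1)] by blast
  \<comment> \<open>The inverse of n is then the point exp v, and \<open>twist\<close> becomes exp
    (- v + B t + T t v) = exp (b t).\<close>
  define n where "n = N.point (e (- v))"
  have dom: "(e x, e y) \<in> N.dom" if "norm x \<le> R" "norm y \<le> R" for x y
  proof -
    have "norm (e x) \<le> 4 * R" if "norm x \<le> R" for x
      using E.e_bound[of x] that E.R by linarith
    then show ?thesis using that by (intro E.ball_U)
  qed
  have vR: "norm v \<le> R" using v M by simp
  have nv: "n \<otimes>\<^bsub>N\<^esub> N.point (e v) = \<one>\<^bsub>N\<^esub>"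
    using N.domE(4)[OF dom[of "- v" v]] E.e_add[of "- v" v] vR by (simp add: n_def E.e_0 N.point_0)
  have ncar: "n \<in> carrier N" "N.point (e v) \<in> carrier N"
    using N.domE(1,2)[OF dom[of "- v" v]] vR N.c_carrier by (auto simp: n_def)
  have inv_n: "inv\<^bsub>N\<^esub> n = N.point (e v)" using nv ncar by (metis N.inv_equality N.inv_comm)
  have key: "twist \<alpha> \<beta> n t \<in> fst cN \<and>
      N.coord (twist \<alpha> \<beta> n t) = e (b t) \<and> norm (b t) \<le> 2 * R"
    if t: "\<bar>t\<bar> \<le> \<tau> / 4" for t
  proof -
    have t': "\<bar>t\<bar> \<le> \<tau>" "\<bar>t\<bar> \<le> \<delta>" using t \<tau> by auto
    note Tv = pT[OF t'(2) v]
    have Bt: "norm (B t) \<le> R" using B(1)[OF t'(1)] M by linarith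
    have Bv: "norm (- v + B t) \<le> R" using norm_triangle_ineq[of "- v" "B t"] B(1)[OF t'(1)] v M by simp
    have "\<beta> t = N.point (e (B t))" using B(2)[OF t'(1)] N.point_coord[OF \<beta>c(1)[OF t'(1)]] by simp
    then have 1: "n \<otimes>\<^bsub>N\<^esub> \<beta> t = N.point (e (- v + B t))"
      using N.domE(4)[OF dom[of "- v" "B t"]] E.e_add[of "- v" "B t"] vR Bt by (simp add: n_def)
    have "norm (e v) \<le> \<delta>" using E.e_bound[of v] v vR M E.R by linarith
    then have "\<pi> (\<alpha> t) (N.point (e v)) \<in> fst cN" using small(1) t' by blast
    then have 2: "\<pi> (\<alpha> t) (inv\<^bsub>N\<^esub> n) = N.point (e (T t v))"
      using Tv(2) N.point_coord by (metis inv_n p_def)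
    have eq: "- v + B t + T t v = b t" using bt[OF t] by (simp add: algebra_simps)
    have dm: "(e (- v + B t), e (T t v)) \<in> N.dom" using dom[OF Bv Tv(1)] .
    show ?thesis
      unfolding 1 2 using N.domE(3,5)[OF dm] E.e_add[OF Bv Tv(1)] eq
        norm_triangle_ineq[of "- v + B t" "T t v"] Bv Tv(1) by simp
  qed
  \<comment> \<open>\<open>Ck_at_e\<close> requires b 0 = 0. This follows from injectivity of e,
    because the twisted curve is at the unit at time 0.\<close>
  have "N.coord (twist \<alpha> \<beta> n 0) = 0"
    using ncar(1) by (simp add: \<beta>_0 \<alpha>_0 \<pi>_unit N.coord_one)
  then have "e (b 0) = e 0" "norm (b 0) \<le> 2 * R" using key[of 0] \<tau> by (auto simp: E.e_0)
  then have b0: "b 0 = 0" using E.e_inverse_bound[of "b 0" 0] E.R by simp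
  have "\<forall>\<^sub>F t in nhds 0. \<bar>t\<bar> < \<tau> / 4"
    unfolding eventually_nhds_metric using \<tau>(1) by (intro exI[of _ "\<tau> / 4"]) (simp add: dist_real_def)
  then have "\<forall>\<^sub>F t in nhds 0. e (b t) = N.coord (twist \<alpha> \<beta> n t)"
    by (rule eventually_mono) (use key in simp)
  then have "Ck_at k (\<lambda>t. N.coord (twist \<alpha> \<beta> n t)) 0" for k
    by (rule Ck_at_cong_imp) (rule E.Ck_at_e[OF b b0])
  then show thesis using that ncar(1) by (simp add: N.Ck_at_coord_iff)
qed

text \<open>The twisted curve is again a cocycle, so near t it is a left translate of its image
  under \<pi> (\<alpha> t) near time 0. In this image t is fixed, so smoothness of each single
  automorphism is what counts, and the dependence of \<pi> (\<alpha> t) on t never has to be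
  differentiated.\<close>

lemma cocycle_smoothing:
  obtains n where "n \<in> carrier N"
    "\<And>t. limitin (mtop MN) (\<lambda>t. twist \<alpha> \<beta> n t)
       (twist \<alpha> \<beta> n t) (nhds t)"
    "\<And>k d t. d \<in> charts MN \<Longrightarrow> twist \<alpha> \<beta> n t \<in> fst d \<Longrightarrow>
       Ck_at k (\<lambda>t. snd d (twist \<alpha> \<beta> n t)) t"
proof -
  obtain n where n: "n \<in> carrier N"
    and Ck0: "\<And>k. Ck_at k (\<lambda>t. snd cN (twist \<alpha> \<beta> n t)) 0"
    using cocycle_smoothing_at_0 by blast
  define \<delta> where "\<delta> t = twist \<alpha> \<beta> n t" for t
  have car: "\<delta> t \<in> carrier N" for t using n \<alpha>_carrier \<beta>_carrier by (simp add: \<delta>_def)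
  have \<delta>0: "\<delta> 0 = \<one>\<^bsub>N\<^esub>" using n by (simp add: \<delta>_def \<alpha>_0 \<beta>_0 \<pi>_unit)
  have lim: "limitin (mtop MN) \<delta> (\<delta> t) (nhds t)" for t
    unfolding \<delta>_def using n N.topspace
    by (intro N.mult_limitin action_limitin \<alpha>_limitin \<beta>_limitin) simp_all
  have add: "\<delta> (s + t) = \<delta> s \<otimes>\<^bsub>N\<^esub> \<pi> (\<alpha> s) (\<delta> t)" for s t
  proof -
    have ss: "\<alpha> s \<in> carrier G" "\<alpha> t \<in> carrier G" "\<beta> s \<in> carrier N" "\<beta> t \<in> carrier N"
      by (simp_all add: \<alpha>_carrier \<beta>_carrier)
    have "\<pi> (\<alpha> s) (inv\<^bsub>N\<^esub> n) \<otimes>\<^bsub>N\<^esub> \<pi> (\<alpha> s) n = \<one>\<^bsub>N\<^esub>"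
      using \<pi>_mult[of "\<alpha> s" "inv\<^bsub>N\<^esub> n" n] n ss by (simp add: \<pi>_one)
    then have c: "\<pi> (\<alpha> s) (inv\<^bsub>N\<^esub> n) \<otimes>\<^bsub>N\<^esub> (\<pi> (\<alpha> s) n \<otimes>\<^bsub>N\<^esub> z) = z" if "z \<in> carrier N" for z
      using that n ss by (simp add: N.m_assoc[symmetric])
    show ?thesis
      using n ss by (simp add: \<delta>_def \<alpha>_add \<beta>_add \<pi>_mult \<pi>_compose N.m_assoc c)
  qed
  show thesis
  proof (rule that[OF n, folded \<delta>_def])
    show "limitin (mtop MN) \<delta> (\<delta> t) (nhds t)" for t by (rule lim)
    fix k d t assume d: "d \<in> charts MN" "\<delta> t \<in> fst d"
    show "Ck_at k (\<lambda>t. snd d (\<delta> t)) t"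
    proof (rule N.Ck_at_left_translate[OF car[of t], where \<gamma> = "\<lambda>u. \<pi> (\<alpha> t) (\<delta> u)"])
      have ev: "\<forall>\<^sub>F u in nhds 0. \<delta> u \<in> fst cN" using lim[of 0] N.one_c by (intro N.eventually_c) (simp_all add: \<delta>0)
      have "limitin (mtop MN) (\<lambda>u. \<pi> (\<alpha> t) (\<delta> u)) (\<pi> (\<alpha> t) (\<delta> 0)) (nhds 0)"
        by (rule smooth_map_limitin[OF \<pi>_auto(2)[OF \<alpha>_carrier] lim])
      then show "\<forall>\<^sub>F u in nhds 0. \<pi> (\<alpha> t) (\<delta> u) \<in> fst cN"
        using N.one_c by (intro N.eventually_c) (simp_all add: \<delta>0 \<pi>_one \<alpha>_carrier)
      show "Ck_at k (\<lambda>u. snd cN (\<pi> (\<alpha> t) (\<delta> u))) 0"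
        using Ck0[folded \<delta>_def, of k] N.one_c
        by (intro Ck_at_smooth_map[OF \<pi>_auto(2)[OF \<alpha>_carrier] chart_inj[OF N.manifold N.c] N.c N.c ev])
          (simp_all add: \<delta>0 \<pi>_one \<alpha>_carrier)
    qed (use d add in auto)
  qed
qed

end

end

section \<open>The exponential function of the semidirect product\<close>

context lie_semidirect
begin

lemma chart_MH:
  assumes "c \<in> charts MH"
  shows "inj_on (snd c) (fst c)" "openin (mtop MH) (fst c)"
proof -
  obtain c1 c2 where c: "c = prod_chart c1 c2" "c1 \<in> charts MN" "c2 \<in> charts MG"
    using assms unfolding charts_prod_manifold by blast
  show "inj_on (snd c) (fst c)"
    unfolding c(1) by (intro inj_on_prod_chart chart_inj[OF N.manifold] chart_inj[OF G.manifold] c)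
  show "openin (mtop MH) (fst c)"
    using chart_openin[OF N.manifold c(2)] chart_openin[OF G.manifold c(3)]
    by (simp add: c(1) fst_prod_chart mtop_prod_manifold openin_prod_Times_iff)
qed

lemma transition_MH:
  assumes "c \<in> charts_at MH p" "d \<in> charts_at MH p"
  shows "((snd d \<circ> chart_inv c) has_derivative frechet_derivative (snd d \<circ> chart_inv c) (at (snd c p))) (at (snd c p))"
proof -
  obtain n g where p: "p = (n, g)" by (cases p)
  obtain c1 c2 where c: "c = prod_chart c1 c2" "c1 \<in> charts MN" "n \<in> fst c1" "c2 \<in> charts MG" "g \<in> fst c2"
    using assms(1) unfolding p charts_at_prod_manifold by (auto simp: charts_at_def)
  obtain d1 d2 where d: "d = prod_chart d1 d2" "d1 \<in> charts MN" "n \<in> fst d1" "d2 \<in> charts MG" "g \<in> fst d2"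
    using assms(2) unfolding p charts_at_prod_manifold by (auto simp: charts_at_def)
  have "((snd (prod_chart d1 d2) \<circ> (\<lambda>y. (fst y, snd y)) \<circ> chart_inv (prod_chart c1 c2)) has_derivative
    (\<lambda>v. (frechet_derivative (snd d1 \<circ> (\<lambda>x. x) \<circ> chart_inv c1) (at (snd c1 n)) (fst v),
          frechet_derivative (snd d2 \<circ> (\<lambda>x. x) \<circ> chart_inv c2) (at (snd c2 g)) (snd v))))
    (at (snd (prod_chart c1 c2) (n, g)))"
    using c d by (intro has_derivative_prod_chart smooth_map_has_derivative smooth_map_id[OF N.manifold]
        smooth_map_id[OF G.manifold] chart_inj[OF N.manifold] chart_inj[OF G.manifold]
        chart_open_image[OF N.manifold] chart_open_image[OF G.manifold])
      (simp_all add: smooth_map_id N.manifold G.manifold)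
  then have "(snd d \<circ> chart_inv c) differentiable (at (snd c p))"
    unfolding differentiable_def c(1) d(1) p by (auto simp: o_def)
  then show ?thesis by (simp add: frechet_derivative_works)
qed

section \<open>Left translations in H and uniqueness of integral curves\<close>

definition DN :: "'n \<Rightarrow> ('n, 'en) chart \<Rightarrow> 'en \<Rightarrow> 'en" where
  "DN n d = frechet_derivative (snd d \<circ> (\<lambda>y. n \<otimes>\<^bsub>N\<^esub> y) \<circ> chart_inv cN) (at (snd cN \<one>\<^bsub>N\<^esub>))"

definition DG :: "'g \<Rightarrow> ('g, 'eg) chart \<Rightarrow> 'eg \<Rightarrow> 'eg" where
  "DG g d = frechet_derivative (snd d \<circ> (\<lambda>y. g \<otimes>\<^bsub>G\<^esub> y) \<circ> chart_inv cG) (at (snd cG \<one>\<^bsub>G\<^esub>))"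

definition D\<pi> :: "'g \<Rightarrow> 'en \<Rightarrow> 'en" where
  "D\<pi> g = frechet_derivative (snd cN \<circ> \<pi> g \<circ> chart_inv cN) (at (snd cN \<one>\<^bsub>N\<^esub>))"

text \<open>Left multiplication by (n, g) acts on the two factors separately. As \<pi> is evaluated
  at the fixed g, no derivative of the action in the direction of G occurs.\<close>

lemma left_mult_has_derivative:
  assumes n: "n \<in> carrier N" and g: "g \<in> carrier G" and d1: "d1 \<in> charts_at MN n" and d2: "d2 \<in> charts_at MG g"
  shows "((snd (prod_chart d1 d2) \<circ> (\<lambda>y. (n, g) \<otimes>\<^bsub>H\<^esub> y) \<circ> chart_inv (prod_chart cN cG)) has_derivative
    (\<lambda>v. (DN n d1 (D\<pi> g (fst v)), DG g d2 (snd v)))) (at (snd (prod_chart cN cG) \<one>\<^bsub>H\<^esub>))"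
proof -
  have d1': "d1 \<in> charts MN" "n \<in> fst d1" and d2': "d2 \<in> charts MG" "g \<in> fst d2"
    using d1 d2 by (auto simp: charts_at_def)
  have DN: "((snd d1 \<circ> (\<lambda>y. n \<otimes>\<^bsub>N\<^esub> y) \<circ> chart_inv cN) has_derivative DN n d1) (at (snd cN \<one>\<^bsub>N\<^esub>))"
    unfolding DN_def using n d1' N.c N.one_c
    by (intro smooth_map_has_derivative[OF N.smooth_map_left_mult]) auto
  have DG: "((snd d2 \<circ> (\<lambda>y. g \<otimes>\<^bsub>G\<^esub> y) \<circ> chart_inv cG) has_derivative DG g d2) (at (snd cG \<one>\<^bsub>G\<^esub>))"
    unfolding DG_def using g d2' G.c G.one_c
    by (intro smooth_map_has_derivative[OF G.smooth_map_left_mult]) auto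
  have D\<pi>: "((snd cN \<circ> \<pi> g \<circ> chart_inv cN) has_derivative D\<pi> g) (at (snd cN \<one>\<^bsub>N\<^esub>))"
    unfolding D\<pi>_def using g N.c N.one_c
    by (intro smooth_map_has_derivative[OF \<pi>_auto(2)]) (auto simp: \<pi>_one)
  have inv1: "chart_inv cN (snd cN \<one>\<^bsub>N\<^esub>) = \<one>\<^bsub>N\<^esub>"
    using N.one_c chart_inj[OF N.manifold N.c] by simp
  have "limitin (mtop MN) (chart_inv cN) \<one>\<^bsub>N\<^esub> (nhds (snd cN \<one>\<^bsub>N\<^esub>))"
    using chart_inv_limitin[OF N.manifold N.c, of "snd cN \<one>\<^bsub>N\<^esub>"] N.one_c inv1 by simp
  from smooth_map_limitin[OF \<pi>_auto(2)[OF g] this]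
  have "\<forall>\<^sub>F x in nhds (snd cN \<one>\<^bsub>N\<^esub>). \<pi> g (chart_inv cN x) \<in> fst cN"
    using N.one_c g by (intro N.eventually_c) (auto simp: \<pi>_one)
  then have ev: "\<forall>\<^sub>F x in at (snd cN \<one>\<^bsub>N\<^esub>). (\<pi> g \<circ> chart_inv cN) x \<in> fst cN"
    by (simp add: eventually_at_filter eventually_mono)
  have "(((snd d1 \<circ> (\<lambda>y. n \<otimes>\<^bsub>N\<^esub> y)) \<circ> (\<pi> g \<circ> chart_inv cN)) has_derivative (\<lambda>v. DN n d1 (D\<pi> g v)))
      (at (snd cN \<one>\<^bsub>N\<^esub>))"
    by (rule chart_chain[where A = "D\<pi> g" and B = "DN n d1", OF UNIV_I chart_inj[OF N.manifold N.c] ev])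
      (use N.one_c g inv1 D\<pi> DN in \<open>simp_all add: \<pi>_one o_def\<close>)
  then have "((snd d1 \<circ> (\<lambda>y. n \<otimes>\<^bsub>N\<^esub> \<pi> g y) \<circ> chart_inv cN) has_derivative (\<lambda>v. DN n d1 (D\<pi> g v)))
      (at (snd cN \<one>\<^bsub>N\<^esub>))"
    by (simp add: o_def)
  then have "((snd (prod_chart d1 d2) \<circ> (\<lambda>y. (n \<otimes>\<^bsub>N\<^esub> \<pi> g (fst y), g \<otimes>\<^bsub>G\<^esub> snd y)) \<circ> chart_inv (prod_chart cN cG))
      has_derivative (\<lambda>v. (DN n d1 (D\<pi> g (fst v)), DG g d2 (snd v)))) (at (snd (prod_chart cN cG) (\<one>\<^bsub>N\<^esub>, \<one>\<^bsub>G\<^esub>)))"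
    by (rule has_derivative_prod_chart[OF _ N.one_c chart_inj[OF N.manifold N.c] chart_open_image[OF N.manifold N.c]
        DG G.one_c chart_inj[OF G.manifold G.c] chart_open_image[OF G.manifold G.c]])
  then show ?thesis by simp
qed

text \<open>\<open>tangent_map\<close> selects its chart at the unit by \<open>SOME\<close>. Giving
  this very choice the name \<open>prod_chart cN cG\<close> makes \<open>left_translate\<close>
  computable without a detour through independence of the chart.\<close>

context
  assumes some: "(SOME c. c \<in> charts_at MH \<one>\<^bsub>H\<^esub>) = prod_chart cN cG"
begin

lemma left_translate_H:
  assumes "h \<in> carrier H"
  shows "left_translate H MH h X d = (if d \<in> charts_at MH h then
    frechet_derivative (snd d \<circ> (\<lambda>y. h \<otimes>\<^bsub>H\<^esub> y) \<circ> chart_inv (prod_chart cN cG))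
      (at (snd (prod_chart cN cG) \<one>\<^bsub>H\<^esub>)) (X (prod_chart cN cG)) else 0)"
proof -
  have "h \<otimes>\<^bsub>H\<^esub> \<one>\<^bsub>H\<^esub> = h" using assms by (rule H.r_one)
  then show ?thesis unfolding left_translate_def tangent_map_def Let_def some by (simp only:)
qed

lemma left_translate_prod_chart:
  assumes "n \<in> carrier N" "g \<in> carrier G" "d1 \<in> charts_at MN n" "d2 \<in> charts_at MG g"
  shows "left_translate H MH (n, g) X (prod_chart d1 d2) =
    (DN n d1 (D\<pi> g (fst (X (prod_chart cN cG)))), DG g d2 (snd (X (prod_chart cN cG))))"
proof -
  have d: "prod_chart d1 d2 \<in> charts_at MH (n, g)" using assms unfolding charts_at_prod_manifold by blast
  have h: "(n, g) \<in> carrier H" using assms by simp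
  show ?thesis
    unfolding left_translate_H[OF h] if_P[OF d]
      frechet_derivative_at[OF left_mult_has_derivative[OF assms], symmetric] ..
qed

lemma velocity_unique:
  assumes \<eta>1: "C1_curve_velocity MH \<eta>1 (\<lambda>s. left_translate H MH (\<eta>1 s) X)"
    and \<eta>2: "C1_curve_velocity MH \<eta>2 (\<lambda>s. left_translate H MH (\<eta>2 s) X)"
    and init: "\<eta>1 0 = \<eta>2 0" and t: "t \<in> {0..1}"
  shows "\<eta>1 t = \<eta>2 t"
proof -
  have comp: "continuous_map (top_of_set {0..1}) (mtop MN) (fst \<circ> \<eta>)"
    "continuous_map (top_of_set {0..1}) (mtop MG) (snd \<circ> \<eta>)"
    "\<And>s d. s \<in> {0..1} \<Longrightarrow> d \<in> charts_at MN (fst (\<eta> s)) \<Longrightarrow> ((snd d \<circ> (fst \<circ> \<eta>)) has_vector_derivative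
       DN (fst (\<eta> s)) d (D\<pi> (snd (\<eta> s)) (fst (X (prod_chart cN cG))))) (at s within {0..1})"
    "\<And>s d. s \<in> {0..1} \<Longrightarrow> d \<in> charts_at MG (snd (\<eta> s)) \<Longrightarrow> ((snd d \<circ> (snd \<circ> \<eta>)) has_vector_derivative
       DG (snd (\<eta> s)) d (snd (X (prod_chart cN cG)))) (at s within {0..1})"
    if \<eta>: "C1_curve_velocity MH \<eta> (\<lambda>s. left_translate H MH (\<eta> s) X)" for \<eta>
  proof -
    have "continuous_map (top_of_set {0..1}) (prod_topology (mtop MN) (mtop MG)) \<eta>"
      using \<eta> by (simp add: C1_curve_velocity_def mtop_prod_manifold)
    then show cont: "continuous_map (top_of_set {0..1}) (mtop MN) (fst \<circ> \<eta>)"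
      "continuous_map (top_of_set {0..1}) (mtop MG) (snd \<circ> \<eta>)"
      by (simp_all add: continuous_map_pairwise)
    have car: "fst (\<eta> s) \<in> carrier N" "snd (\<eta> s) \<in> carrier G" if "s \<in> {0..1}" for s
      using continuous_map_image_subset_topspace[OF cont(1)] continuous_map_image_subset_topspace[OF cont(2)]
        that N.topspace G.topspace by auto
    have der: "((snd (prod_chart d1 d2) \<circ> \<eta>) has_vector_derivative
        (DN (fst (\<eta> s)) d1 (D\<pi> (snd (\<eta> s)) (fst (X (prod_chart cN cG)))), DG (snd (\<eta> s)) d2 (snd (X (prod_chart cN cG)))))
        (at s within {0..1})"
      if s: "s \<in> {0..1}" and d: "d1 \<in> charts_at MN (fst (\<eta> s))" "d2 \<in> charts_at MG (snd (\<eta> s))" for s d1 d2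
    proof -
      have "prod_chart d1 d2 \<in> charts MH" "\<eta> s \<in> fst (prod_chart d1 d2)"
        using d unfolding charts_prod_manifold fst_prod_chart charts_at_def mem_Times_iff by blast+
      then have "((snd (prod_chart d1 d2) \<circ> \<eta>) has_vector_derivative left_translate H MH (\<eta> s) X (prod_chart d1 d2))
          (at s within {0..1})"
        using \<eta> s unfolding C1_curve_velocity_def by blast
      then show ?thesis using left_translate_prod_chart[OF car[OF s] d, of X] by simp
    qed
    have fs: "fst \<circ> (snd (prod_chart d1 d2) \<circ> \<eta>) = snd d1 \<circ> (fst \<circ> \<eta>)"
      "snd \<circ> (snd (prod_chart d1 d2) \<circ> \<eta>) = snd d2 \<circ> (snd \<circ> \<eta>)"
      for d1 :: "('n, 'en) chart" and d2 :: "('g, 'eg) chart"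
      by (auto simp: prod_chart_def fun_eq_iff)
    show "((snd d \<circ> (fst \<circ> \<eta>)) has_vector_derivative
       DN (fst (\<eta> s)) d (D\<pi> (snd (\<eta> s)) (fst (X (prod_chart cN cG))))) (at s within {0..1})"
      if s: "s \<in> {0..1}" and d: "d \<in> charts_at MN (fst (\<eta> s))" for s d
    proof -
      have "snd (\<eta> s) \<in> topspace (mtop MG)" using car[OF s] G.topspace by simp
      then obtain d2 where "d2 \<in> charts MG" "snd (\<eta> s) \<in> fst d2" by (rule chart_exists[OF G.manifold])
      then have d2: "d2 \<in> charts_at MG (snd (\<eta> s))" by (simp add: charts_at_def)
      from bounded_linear.has_vector_derivative[OF bounded_linear_fst der[OF s d d2]]
      show ?thesis using fs(1)[of d d2] by (simp add: o_def)
    qed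
    show "((snd d \<circ> (snd \<circ> \<eta>)) has_vector_derivative
       DG (snd (\<eta> s)) d (snd (X (prod_chart cN cG)))) (at s within {0..1})"
      if s: "s \<in> {0..1}" and d: "d \<in> charts_at MG (snd (\<eta> s))" for s d
    proof -
      have "fst (\<eta> s) \<in> topspace (mtop MN)" using car[OF s] N.topspace by simp
      then obtain d1 where "d1 \<in> charts MN" "fst (\<eta> s) \<in> fst d1" by (rule chart_exists[OF N.manifold])
      then have d1: "d1 \<in> charts_at MN (fst (\<eta> s))" by (simp add: charts_at_def)
      from bounded_linear.has_vector_derivative[OF bounded_linear_snd der[OF s d1 d]]
      show ?thesis using fs(2)[of d1 d] by (simp add: o_def)
    qed
  qed
  note c1 = comp[OF \<eta>1] and c2 = comp[OF \<eta>2]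
  have G_eq: "snd (\<eta>1 s) = snd (\<eta>2 s)" if "s \<in> {0..1}" for s
    using G.left_logarithmic_derivative_unique[OF c1(2) c2(2), of "\<lambda>_. snd (X (prod_chart cN cG))" s]
      c1(4) c2(4) init that by (simp add: DG_def)
  \<comment> \<open>Once the components in G agree, both components in N have the same left
    logarithmic derivative. It depends on time through the component in G, which is why the
    uniqueness lemma admits a w that varies with s.\<close>
  have "fst (\<eta>1 t) = fst (\<eta>2 t)"
    using N.left_logarithmic_derivative_unique[OF c1(1) c2(1), of "\<lambda>s. D\<pi> (snd (\<eta>1 s)) (fst (X (prod_chart cN cG)))" t]
      c1(3) c2(3) init t G_eq by (simp add: DN_def)
  then show ?thesis using G_eq[OF t] by (simp add: prod_eq_iff)
qed

section \<open>Smooth one-parameter subgroups as integral curves\<close>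

context
  fixes \<delta> :: "real \<Rightarrow> 'n \<times> 'g"
  assumes \<delta>_add: "\<And>s t. \<delta> (s + t) = \<delta> s \<otimes>\<^bsub>H\<^esub> \<delta> t"
    and \<delta>_cont: "continuous_map euclideanreal (mtop MH) \<delta>"
    and \<delta>_Ck: "\<And>k t c. c \<in> charts_at MH (\<delta> t) \<Longrightarrow> Ck_at k (snd c \<circ> \<delta>) t"
begin

definition velocity :: "real \<Rightarrow> ('n \<times> 'g, 'en \<times> 'eg) chart \<Rightarrow> 'en \<times> 'eg" where
  "velocity t = (\<lambda>c. if c \<in> charts_at MH (\<delta> t) then vector_derivative (snd c \<circ> \<delta>) (at t) else 0)"

lemma \<delta>_carrier: "\<delta> t \<in> carrier H"
  using continuous_map_image_subset_topspace[OF \<delta>_cont] N.topspace G.topspace by (auto simp: mtop_prod_manifold)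

lemma \<delta>_0: "\<delta> 0 = \<one>\<^bsub>H\<^esub>"
  using \<delta>_add[of 0 0] \<delta>_carrier by (metis H.l_cancel_one' add_0)

lemma \<delta>_eventually: "c \<in> charts_at MH (\<delta> t) \<Longrightarrow> \<forall>\<^sub>F u in nhds t. \<delta> u \<in> fst c"
proof -
  assume c: "c \<in> charts_at MH (\<delta> t)"
  have "limitin (mtop MH) \<delta> (\<delta> t) (nhds t)"
    using continuous_map_limit[OF \<delta>_cont, of "\<lambda>s. s" t "nhds t"] by (simp add: o_def filterlim_ident)
  from limitinD[OF this chart_MH(2)] c show ?thesis by (simp add: charts_at_def)
qed

lemma \<delta>_has_vector_derivative:
  "c \<in> charts_at MH (\<delta> t) \<Longrightarrow> ((snd c \<circ> \<delta>) has_vector_derivative velocity t c) (at t)"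
  using eventually_nhds_x_imp_x[OF Ck_at_SucE(1)[OF \<delta>_Ck[of c t "Suc 0"]]] by (simp add: velocity_def)

text \<open>Applied with h a chart, for the compatibility of tangent vectors, and with h a chart
  after a left multiplication.\<close>

lemma velocity_transition:
  assumes c: "c \<in> charts_at MH (\<delta> t)" and B: "((h \<circ> chart_inv c) has_derivative B) (at (snd c (\<delta> t)))"
  shows "((h \<circ> \<delta>) has_vector_derivative B (velocity t c)) (at t)"
proof (rule chart_chain_vector[where h = h and c = c and B = B and \<gamma> = \<delta>, OF UNIV_I])
  show "inj_on (snd c) (fst c)" using c by (intro chart_MH) (simp add: charts_at_def)
  show "\<forall>\<^sub>F u in at t. \<delta> u \<in> fst c"
    using \<delta>_eventually[OF c] by (simp add: eventually_at_filter eventually_mono)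
  show "\<delta> t \<in> fst c" using c by (simp add: charts_at_def)
qed (rule \<delta>_has_vector_derivative[OF c] B)+

lemma velocity_tangent: "(\<lambda>c. r *\<^sub>R velocity t c) \<in> tangent_space MH (\<delta> t)"
proof -
  have "r *\<^sub>R velocity t d = frechet_derivative (snd d \<circ> chart_inv c) (at (snd c (\<delta> t))) (r *\<^sub>R velocity t c)"
    if c: "c \<in> charts_at MH (\<delta> t)" and d: "d \<in> charts_at MH (\<delta> t)" for c d
  proof -
    let ?B = "frechet_derivative (snd d \<circ> chart_inv c) (at (snd c (\<delta> t)))"
    note B = transition_MH[OF c d]
    have "?B (velocity t c) = velocity t d"
      using vector_derivative_at[OF velocity_transition[OF c B]] vector_derivative_at[OF \<delta>_has_vector_derivative[OF d]]
      by simp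
    then show ?thesis using linear_scale[OF has_derivative_linear[OF B]] by simp
  qed
  moreover have "r *\<^sub>R velocity t c = 0" if "c \<notin> charts_at MH (\<delta> t)" for c
    using that by (simp add: velocity_def)
  ultimately show ?thesis unfolding tangent_space_def by blast
qed

text \<open>Differentiate \<delta>(t + u) = \<delta>(t) \<delta>(u) at u = 0. The factor r is
  carried along because the exponential function is evaluated at all multiples of the velocity at
  0.\<close>

lemma left_translate_velocity:
  "left_translate H MH (\<delta> t) (\<lambda>c. r *\<^sub>R velocity 0 c) = (\<lambda>c. r *\<^sub>R velocity t c)"
proof
  fix d
  show "left_translate H MH (\<delta> t) (\<lambda>c. r *\<^sub>R velocity 0 c) d = r *\<^sub>R velocity t d"
  proof (cases "d \<in> charts_at MH (\<delta> t)")
    case True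
    let ?c = "prod_chart cN cG"
    let ?B = "frechet_derivative (snd d \<circ> (\<lambda>y. \<delta> t \<otimes>\<^bsub>H\<^esub> y) \<circ> chart_inv ?c) (at (snd ?c \<one>\<^bsub>H\<^esub>))"
    obtain n g where ng: "\<delta> t = (n, g)" "n \<in> carrier N" "g \<in> carrier G" using \<delta>_carrier[of t] by auto
    obtain d1 d2 where d: "d = prod_chart d1 d2" "d1 \<in> charts_at MN n" "d2 \<in> charts_at MG g"
      using True unfolding ng charts_at_prod_manifold by blast
    have "(snd d \<circ> (\<lambda>y. \<delta> t \<otimes>\<^bsub>H\<^esub> y) \<circ> chart_inv ?c) differentiable (at (snd ?c \<one>\<^bsub>H\<^esub>))"
      using left_mult_has_derivative[OF ng(2,3) d(2,3)] unfolding ng(1) d(1) differentiable_def by blast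
    then have B: "((snd d \<circ> (\<lambda>y. \<delta> t \<otimes>\<^bsub>H\<^esub> y) \<circ> chart_inv ?c) has_derivative ?B) (at (snd ?c (\<delta> 0)))"
      unfolding \<delta>_0 by (simp only: frechet_derivative_works)
    have c: "?c \<in> charts_at MH (\<delta> 0)"
      using N.c G.c N.one_c G.one_c unfolding \<delta>_0 H_simps charts_at_prod_manifold
      unfolding charts_at_def by blast
    have "(snd d \<circ> (\<lambda>y. \<delta> t \<otimes>\<^bsub>H\<^esub> y) \<circ> \<delta>) = (\<lambda>u. (snd d \<circ> \<delta>) (t + u))" by (simp only: o_def \<delta>_add)
    with velocity_transition[OF c B]
    have 1: "((\<lambda>u. (snd d \<circ> \<delta>) (t + u)) has_vector_derivative ?B (velocity 0 ?c)) (at 0)" by (simp only:)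
    have "((\<lambda>u. t + u) has_vector_derivative 1) (at 0)" by (auto intro!: derivative_eq_intros)
    from vector_diff_chain_at[OF this, of "snd d \<circ> \<delta>" "velocity t d"] \<delta>_has_vector_derivative[OF True]
    have 2: "((\<lambda>u. (snd d \<circ> \<delta>) (t + u)) has_vector_derivative velocity t d) (at 0)" by (simp add: o_def)
    have "?B (velocity 0 ?c) = velocity t d" using vector_derivative_unique_at[OF 1 2] .
    then show ?thesis
      using left_translate_H[OF \<delta>_carrier] True linear_scale[OF has_derivative_linear[OF B]] by (simp only: if_True)
  next
    case False
    then show ?thesis using left_translate_H[OF \<delta>_carrier] by (simp add: velocity_def)
  qed
qed

text \<open>The exponential function is read off at time 1, so time is rescaled: s \<mapsto>
  \<delta>(t s) is the integral curve of t times the velocity at 0 and ends at \<delta>(t).\<close>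

lemma \<delta>_C1_curve_velocity:
  "C1_curve_velocity MH (\<lambda>s. \<delta> (t * s)) (\<lambda>s. left_translate H MH (\<delta> (t * s)) (\<lambda>c. t *\<^sub>R velocity 0 c))"
  unfolding C1_curve_velocity_def left_translate_velocity
proof (intro conjI ballI impI)
  have "continuous_map (top_of_set {0..1}) euclideanreal (\<lambda>s. t * s)"
    by (simp add: continuous_intros)
  from continuous_map_compose[OF this \<delta>_cont]
  show "continuous_map (top_of_set {0..1}) (mtop MH) (\<lambda>s. \<delta> (t * s))" by (simp add: o_def)
  show "(\<lambda>c. t *\<^sub>R velocity (t * s) c) \<in> tangent_space MH (\<delta> (t * s))" for s by (rule velocity_tangent)
  fix c assume c: "c \<in> charts MH"
  show "((snd c \<circ> (\<lambda>s. \<delta> (t * s))) has_vector_derivative t *\<^sub>R velocity (t * s) c) (at s within {0..1})"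
    if "\<delta> (t * s) \<in> fst c" for s
  proof -
    have 1: "((\<lambda>s. t * s) has_vector_derivative t) (at s)" by (auto intro!: derivative_eq_intros)
    have "((snd c \<circ> \<delta>) has_vector_derivative velocity (t * s) c) (at (t * s))"
      using c that by (intro \<delta>_has_vector_derivative) (simp add: charts_at_def)
    from vector_diff_chain_at[OF 1 this] show ?thesis
      by (simp add: o_def has_vector_derivative_at_within)
  qed
  have "isCont (\<lambda>s. velocity (t * s) c) s" if "\<delta> (t * s) \<in> fst c" for s
  proof -
    have c': "c \<in> charts_at MH (\<delta> (t * s))" using c that by (simp add: charts_at_def)
    have "\<forall>\<^sub>F u in nhds (t * s). velocity u c = vector_derivative (snd c \<circ> \<delta>) (at u)"
      using \<delta>_eventually[OF c'] by (rule eventually_mono) (use c in \<open>simp add: velocity_def charts_at_def\<close>)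
    moreover have "isCont (\<lambda>u. vector_derivative (snd c \<circ> \<delta>) (at u)) (t * s)"
      using eventually_nhds_x_imp_x[OF Ck_at_isCont[OF Ck_at_SucE(2)[OF \<delta>_Ck[OF c', of "Suc 0"]]]] .
    ultimately have "isCont (\<lambda>u. velocity u c) (t * s)" using isCont_cong by fast
    then show ?thesis by (rule isCont_o2[rotated]) simp
  qed
  then show "continuous_on {s \<in> {0..1}. \<delta> (t * s) \<in> fst c} (\<lambda>s. t *\<^sub>R velocity (t * s) c)"
    by (intro continuous_intros continuous_at_imp_continuous_on) auto
qed

lemma lie_exp_velocity: "lie_exp H MH (\<lambda>c. t *\<^sub>R velocity 0 c) = \<delta> t"
  unfolding lie_exp_def
proof (rule the_equality)
  show "\<exists>\<eta>. C1_curve_velocity MH \<eta> (\<lambda>s. left_translate H MH (\<eta> s) (\<lambda>c. t *\<^sub>R velocity 0 c)) \<and>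
      \<eta> 0 = \<one>\<^bsub>H\<^esub> \<and> \<eta> 1 = \<delta> t"
    using \<delta>_C1_curve_velocity[of t] \<delta>_0 by (intro exI[of _ "\<lambda>s. \<delta> (t * s)"] conjI) simp_all
  fix y assume "\<exists>\<eta>. C1_curve_velocity MH \<eta> (\<lambda>s. left_translate H MH (\<eta> s) (\<lambda>c. t *\<^sub>R velocity 0 c)) \<and>
      \<eta> 0 = \<one>\<^bsub>H\<^esub> \<and> \<eta> 1 = y"
  then obtain \<eta> where \<eta>: "C1_curve_velocity MH \<eta> (\<lambda>s. left_translate H MH (\<eta> s) (\<lambda>c. t *\<^sub>R velocity 0 c))"
    "\<eta> 0 = \<one>\<^bsub>H\<^esub>" "\<eta> 1 = y" by blast
  show "y = \<delta> t"
    using velocity_unique[OF \<eta>(1) \<delta>_C1_curve_velocity[of t], of 1] \<eta>(2,3) \<delta>_0 by simp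
qed

end

end

end

section \<open>Continuous one-parameter subgroups\<close>

lemma continuous_map_if_limitin:
  fixes f :: "'a::topological_space \<Rightarrow> 'b"
  assumes "\<And>t. limitin X f (f t) (nhds t)"
  shows "continuous_map euclidean X f"
  unfolding continuous_map_def
proof (intro conjI allI impI)
  show "f \<in> topspace euclidean \<rightarrow> topspace X" using assms limitin_topspace by fastforce
  fix U assume U: "openin X U"
  have "open {t. f t \<in> U}"
  proof (rule Topological_Spaces.openI)
    fix t assume "t \<in> {t. f t \<in> U}"
    then have "\<forall>\<^sub>F s in nhds t. f s \<in> U" using limitinD[OF assms U] by simp
    then show "\<exists>T. open T \<and> t \<in> T \<and> T \<subseteq> {t. f t \<in> U}" unfolding eventually_nhds by blast
  qed
  then show "openin euclidean {x \<in> topspace euclidean. f x \<in> U}" by simp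
qed

lemma smooth_map_real_manifold:
  assumes cont: "continuous_map euclideanreal (mtop M) \<delta>"
    and Ck: "\<And>k t c. c \<in> charts_at M (\<delta> t) \<Longrightarrow> Ck_at k (snd c \<circ> \<delta>) t"
    and op: "\<And>c. c \<in> charts M \<Longrightarrow> openin (mtop M) (fst c)"
  shows "smooth_map real_manifold M \<delta>"
  unfolding smooth_map_def
proof (intro conjI ballI)
  show "continuous_map (mtop real_manifold) (mtop M) \<delta>" using cont by (simp add: real_manifold_def)
  fix c d assume c: "c \<in> charts real_manifold" and d: "d \<in> charts M"
  have c': "c = (UNIV, \<lambda>t. t)" using c by (simp add: real_manifold_def)
  have id: "chart_inv c = (\<lambda>t. t)" unfolding c' fst_conv snd_conv by (rule ext) (rule inv_into_f_f, auto)
  have "openin euclideanreal {t \<in> topspace euclideanreal. \<delta> t \<in> fst d}"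
    using cont op[OF d] by (rule openin_continuous_map_preimage)
  then have "open (\<delta> -` fst d)" by (simp add: vimage_def)
  then have "smooth_on (\<delta> -` fst d) (snd d \<circ> \<delta>)"
    by (rule smooth_onI_Ck_at) (rule Ck, simp add: charts_at_def d)
  then show "smooth_on (snd c ` (fst c \<inter> \<delta> -` fst d)) (snd d \<circ> \<delta> \<circ> chart_inv c)"
    unfolding id by (simp add: c' o_def)
qed

lemma (in lie_semidirect) one_parameter_subgroup_conjugate_smooth:
  assumes some: "(SOME c. c \<in> charts_at MH \<one>\<^bsub>H\<^esub>) = prod_chart cN cG"
    and \<gamma>: "continuous_one_parameter_subgroup H MH \<gamma>"
  shows "(\<exists>h\<in>carrier H. \<exists>\<delta>. smooth_one_parameter_subgroup H MH \<delta> \<and>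
             (\<forall>t. \<gamma> t = h \<otimes>\<^bsub>H\<^esub> \<delta> t \<otimes>\<^bsub>H\<^esub> inv\<^bsub>H\<^esub> h)) \<and>
         (\<exists>g\<in>carrier H. \<exists>x\<in>tangent_space MH \<one>\<^bsub>H\<^esub>. \<forall>t.
             \<gamma> t = g \<otimes>\<^bsub>H\<^esub> lie_exp H MH (\<lambda>c. t *\<^sub>R x c) \<otimes>\<^bsub>H\<^esub> inv\<^bsub>H\<^esub> g)"
proof -
  have \<gamma>_add: "\<gamma> (s + t) = \<gamma> s \<otimes>\<^bsub>H\<^esub> \<gamma> t" for s t
    using \<gamma> hom_mult[of \<gamma> real_group H s t]
    unfolding continuous_one_parameter_subgroup_def by (simp add: real_group_def)
  have \<gamma>_cont: "continuous_map euclideanreal (prod_topology (mtop MN) (mtop MG)) \<gamma>"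
    using \<gamma> by (simp add: continuous_one_parameter_subgroup_def mtop_prod_manifold)
  define \<alpha> \<beta> where "\<alpha> = snd \<circ> \<gamma>" and "\<beta> = fst \<circ> \<gamma>"
  have \<alpha>\<beta>: "\<gamma> t = (\<beta> t, \<alpha> t)" for t by (simp add: \<alpha>_def \<beta>_def)
  have \<alpha>: "\<alpha> (s + t) = \<alpha> s \<otimes>\<^bsub>G\<^esub> \<alpha> t" "continuous_map euclideanreal (mtop MG) \<alpha>"
    and \<beta>: "\<beta> (s + t) = \<beta> s \<otimes>\<^bsub>N\<^esub> \<pi> (\<alpha> s) (\<beta> t)" "continuous_map euclideanreal (mtop MN) \<beta>" for s t
    using \<gamma>_add[of s t] \<gamma>_cont by (simp_all add: \<alpha>_def \<beta>_def continuous_map_pairwise)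
  obtain n where n: "n \<in> carrier N"
    and lim: "\<And>t. limitin (mtop MN) (\<lambda>t. twist \<alpha> \<beta> n t)
       (twist \<alpha> \<beta> n t) (nhds t)"
    and Ck_N: "\<And>k d t. d \<in> charts MN \<Longrightarrow> twist \<alpha> \<beta> n t \<in> fst d \<Longrightarrow>
       Ck_at k (\<lambda>t. snd d (twist \<alpha> \<beta> n t)) t"
    using cocycle_smoothing[OF \<alpha> \<beta>] by blast
  have car: "\<alpha> t \<in> carrier G" "\<beta> t \<in> carrier N" for t
    using \<alpha>_carrier[OF \<alpha> \<beta>] \<beta>_carrier[OF \<alpha> \<beta>] by auto
  define \<delta> where "\<delta> t = (twist \<alpha> \<beta> n t, \<alpha> t)" for t
  \<comment> \<open>Chosen so that h^(-1) \<gamma>(t) h has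
    \<open>twist \<alpha> \<beta> n t\<close> as its component in N and still \<alpha> t as its
    component in G.\<close>
  define h where "h = (inv\<^bsub>N\<^esub> n, \<one>\<^bsub>G\<^esub>)"
  have h: "h \<in> carrier H" using n by (simp add: h_def)
  have inv_h: "inv\<^bsub>H\<^esub> h = (n, \<one>\<^bsub>G\<^esub>)"
    using n by (intro H.inv_equality) (simp_all add: h_def \<pi>_unit)
  have \<gamma>_car: "\<gamma> t \<in> carrier H" for t using car by (simp add: \<alpha>\<beta>)
  have \<delta>: "\<delta> t = inv\<^bsub>H\<^esub> h \<otimes>\<^bsub>H\<^esub> \<gamma> t \<otimes>\<^bsub>H\<^esub> h" for t
    unfolding inv_h using n car by (simp add: \<delta>_def h_def \<alpha>\<beta> \<pi>_unit)
  have conj: "\<gamma> t = h \<otimes>\<^bsub>H\<^esub> \<delta> t \<otimes>\<^bsub>H\<^esub> inv\<^bsub>H\<^esub> h" for t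
    unfolding \<delta> using h \<gamma>_car
    by (metis H.inv_closed H.inv_solve_left H.inv_solve_right H.m_assoc H.m_closed)
  have \<delta>_add: "\<delta> (s + t) = \<delta> s \<otimes>\<^bsub>H\<^esub> \<delta> t" for s t
  proof -
    have "h \<otimes>\<^bsub>H\<^esub> (inv\<^bsub>H\<^esub> h \<otimes>\<^bsub>H\<^esub> z) = z"
      if "z \<in> carrier H" for z
      using that h H.m_assoc[of h "inv\<^bsub>H\<^esub> h" z] by (metis H.inv_closed H.l_one H.r_inv)
    then show ?thesis
      unfolding \<delta> \<gamma>_add using h \<gamma>_car by (metis H.inv_closed H.m_assoc H.m_closed)
  qed
  have \<delta>_cont: "continuous_map euclideanreal (mtop MH) \<delta>"
    using continuous_map_if_limitin[OF lim] \<alpha>(2)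
    by (simp add: mtop_prod_manifold continuous_map_pairwise \<delta>_def[abs_def] o_def)
  have Ck_G: "Ck_at k (\<lambda>s. snd d (\<alpha> s)) t" if "d \<in> charts MG" "\<alpha> t \<in> fst d" for k d t
  proof (rule G.Ck_at_left_translate[where \<gamma> = \<alpha> and \<alpha> = \<alpha>, OF car(1)[of t] _ _ that])
    show "\<forall>\<^sub>F u in nhds 0. \<alpha> u \<in> fst cG"
      using \<alpha>_limitin[OF \<alpha> \<beta>, of 0] \<alpha>_0[OF \<alpha> \<beta>] G.one_c by (intro G.eventually_c) auto
    show "Ck_at k (\<lambda>u. snd cG (\<alpha> u)) 0" by (rule G.continuous_hom_Ck_at_0[OF \<alpha>])
  qed (rule \<alpha>)
  have \<delta>_Ck: "Ck_at k (snd c \<circ> \<delta>) t" if "c \<in> charts_at MH (\<delta> t)" for k c t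
  proof -
    have "c \<in> charts_at MH (fst (\<delta> t), snd (\<delta> t))" using that by simp
    then obtain d1 d2 where c: "c = prod_chart d1 d2" and d: "d1 \<in> charts MN" "fst (\<delta> t) \<in> fst d1"
      "d2 \<in> charts MG" "snd (\<delta> t) \<in> fst d2"
      unfolding charts_at_prod_manifold unfolding charts_at_def by blast
    have "snd c \<circ> \<delta> = (\<lambda>s. (snd d1 (fst (\<delta> s)), snd d2 (snd (\<delta> s))))"
      by (simp add: c prod_chart_def fun_eq_iff map_prod_def split_beta)
    then show ?thesis
      using Ck_at_Pair[OF Ck_N[OF d(1)] Ck_G[OF d(3)]] d by (simp add: \<delta>_def)
  qed
  have \<delta>_car: "\<delta> t \<in> carrier H" for t using n car by (simp add: \<delta>_def)
  have "\<delta> \<in> hom real_group H"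
    using \<delta>_add \<delta>_car by (auto simp: hom_def real_group_def simp del: H_simps)
  moreover have "smooth_map real_manifold MH \<delta>"
    by (rule smooth_map_real_manifold[OF \<delta>_cont \<delta>_Ck chart_MH(2)])
  ultimately have "smooth_one_parameter_subgroup H MH \<delta>" by (simp add: smooth_one_parameter_subgroup_def)
  moreover have "velocity \<delta> 0 \<in> tangent_space MH \<one>\<^bsub>H\<^esub>"
    using velocity_tangent[OF some \<delta>_add \<delta>_cont \<delta>_Ck, of 1 0] \<delta>_0[OF some \<delta>_add \<delta>_cont \<delta>_Ck]
    by (simp del: H_simps)
  moreover have "lie_exp H MH (\<lambda>c. t *\<^sub>R velocity \<delta> 0 c) = \<delta> t" for t
    by (rule lie_exp_velocity[OF some \<delta>_add \<delta>_cont \<delta>_Ck])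
  ultimately show ?thesis using conj h by metis
qed

theorem proposition4p17:
  fixes G :: "('g, 'x) monoid_scheme" and MG :: "('g, 'eg::banach) manifold"
    and N :: "('n, 'y) monoid_scheme" and MN :: "('n, 'en::banach) manifold"
    and \<pi> :: "'g \<Rightarrow> 'n \<Rightarrow> 'n"
    and H :: "('n \<times> 'g) monoid" and MH :: "('n \<times> 'g, 'en \<times> 'eg) manifold"
    and \<gamma> :: "real \<Rightarrow> 'n \<times> 'g"
  assumes "banach_lie_group G MG"
    and "banach_lie_group N MN"
    and "\<pi> \<in> hom G (lie_aut_group N MN)"
    and "continuous_map (prod_topology (mtop MG) (mtop MN)) (mtop MN) (\<lambda>(g, n). \<pi> g n)"
    and "H = semidirect_product N G \<pi>"
    and "MH = prod_manifold MN MG"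
    and "comm_group N"
    and "continuous_one_parameter_subgroup H MH \<gamma>"
  shows "(\<exists>h\<in>carrier H. \<exists>\<delta>. smooth_one_parameter_subgroup H MH \<delta> \<and>
             (\<forall>t. \<gamma> t = h \<otimes>\<^bsub>H\<^esub> \<delta> t \<otimes>\<^bsub>H\<^esub> inv\<^bsub>H\<^esub> h)) \<and>
         (\<exists>g\<in>carrier H. \<exists>x\<in>tangent_space MH \<one>\<^bsub>H\<^esub>. \<forall>t.
             \<gamma> t = g \<otimes>\<^bsub>H\<^esub> lie_exp H MH (\<lambda>c. t *\<^sub>R x c) \<otimes>\<^bsub>H\<^esub> inv\<^bsub>H\<^esub> g)"
proof -
  have manifolds: "banach_manifold MN" "banach_manifold MG"
    and top: "topspace (mtop MN) = carrier N" "topspace (mtop MG) = carrier G"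
    and groups: "group N" "group G"
    using assms(1,2) by (auto simp: banach_lie_group_def)
  have one: "\<one>\<^bsub>semidirect_product N G \<pi>\<^esub> = (\<one>\<^bsub>N\<^esub>, \<one>\<^bsub>G\<^esub>)" by (simp add: semidirect_product_def)
  have units: "\<one>\<^bsub>N\<^esub> \<in> topspace (mtop MN)" "\<one>\<^bsub>G\<^esub> \<in> topspace (mtop MG)"
    using groups top by (auto simp: group.is_monoid monoid.one_closed)
  obtain c1 where "c1 \<in> charts MN" "\<one>\<^bsub>N\<^esub> \<in> fst c1" using chart_exists[OF manifolds(1) units(1)] .
  moreover obtain c2 where "c2 \<in> charts MG" "\<one>\<^bsub>G\<^esub> \<in> fst c2" using chart_exists[OF manifolds(2) units(2)] .
  ultimately have "prod_chart c1 c2 \<in> charts_at (prod_manifold MN MG) \<one>\<^bsub>semidirect_product N G \<pi>\<^esub>"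
    unfolding one charts_at_prod_manifold unfolding charts_at_def by blast
  \<comment> \<open>Every chart of the product manifold is a product chart, so the one selected by
    \<open>SOME\<close> splits into the charts cN and cG in which the whole argument is carried
    out.\<close>
  from someI[of "\<lambda>c. c \<in> charts_at (prod_manifold MN MG) \<one>\<^bsub>semidirect_product N G \<pi>\<^esub>", OF this]
  obtain cN cG where some: "(SOME c. c \<in> charts_at (prod_manifold MN MG) \<one>\<^bsub>semidirect_product N G \<pi>\<^esub>) = prod_chart cN cG"
    and cN: "cN \<in> charts_at MN \<one>\<^bsub>N\<^esub>" and cG: "cG \<in> charts_at MG \<one>\<^bsub>G\<^esub>"
    unfolding one charts_at_prod_manifold by blast
  interpret lie_semidirect G MG cG N MN cN \<pi>
    using assms groups cN cG
    by (intro lie_semidirect.intro banach_lie_chart.intro banach_lie_chart_axioms.intro lie_semidirect_axioms.intro)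
      (simp_all add: charts_at_def)
  show ?thesis
    using assms(8) one_parameter_subgroup_conjugate_smooth[OF some] unfolding assms(5,6) by blast
qed

end
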